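(* As $H\to\infty$, $N_{D_4}(H)\asymp H^2(\log H)^2$, i.e. there are constants $C_1,C_2>0$ with $C_1H^2(\log H)^2\le N_{D_4}(H)\le C_2H^2(\log H)^2$ for all sufficiently large $H$.
   Context: Let $\mathcal S_H$ be the set of monic quartic polynomials $X^4+aX^3+bX^2+cX+d$ with $a,b,c,d\in\mathbb Z\cap[-H,H]$ that are irreducible over $\mathbb Q$. For a group $G$, $N_G(H)=\#\{f\in\mathcal S_H: G_f\simeq G\}$, where $G_f$ is the Galois group of $f$ over $\mathbb Q$. $D_4$ denotes the dihedral group of order 8. *)

theory Defs
  imports Complex_Main "HOL-Algebra.Group" "HOL-Computational_Algebra.Polynomial"
begin

definition is_subfield_C :: "complex set \<Rightarrow> bool" where
  "is_subfield_C F \<longleftrightarrow> 0 \<in> F \<and> 1 \<in> F \<and>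
     (\<forall>x\<in>F. \<forall>y\<in>F. x + y \<in> F \<and> x - y \<in> F \<and> x * y \<in> F) \<and>
     (\<forall>x\<in>F. x \<noteq> 0 \<longrightarrow> inverse x \<in> F)"

definition roots_C :: "int poly \<Rightarrow> complex set" where
  "roots_C f = {z. poly (map_poly of_int f) z = 0}"

definition splitting_field_C :: "int poly \<Rightarrow> complex set" where
  "splitting_field_C f = \<Inter>{F. is_subfield_C F \<and> roots_C f \<subseteq> F}"

text \<open>Galois group of f over Q: the field automorphisms of its splitting field
  (these automatically fix Q), under composition.\<close>
definition galois_group :: "int poly \<Rightarrow> (complex \<Rightarrow> complex) monoid" where
  "galois_group f = (let K = splitting_field_C f in
     \<lparr>carrier = {\<sigma>. \<sigma> \<in> extensional K \<and> bij_betw \<sigma> K K \<and>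
                   (\<forall>x\<in>K. \<forall>y\<in>K. \<sigma> (x + y) = \<sigma> x + \<sigma> y \<and> \<sigma> (x * y) = \<sigma> x * \<sigma> y)},
      monoid.mult = (\<lambda>\<sigma> \<tau>. compose K \<sigma> \<tau>),
      monoid.one = restrict id K\<rparr>)"

text \<open>The dihedral group of order 8, as the symmetries i \<mapsto> a + s*i (mod 4), s = \<plusminus>1,
  of the vertices {0,1,2,3} of a square.\<close>
definition D4 :: "(nat \<Rightarrow> nat) monoid" where
  "D4 = \<lparr>carrier = {restrict (\<lambda>i. (a + s * i) mod 4) {..<4} | a s. a < 4 \<and> (s = 1 \<or> s = 3)},
         monoid.mult = (\<lambda>\<sigma> \<tau>. compose {..<4} \<sigma> \<tau>),
         monoid.one = restrict id {..<4}\<rparr>"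

definition quartic :: "int \<Rightarrow> int \<Rightarrow> int \<Rightarrow> int \<Rightarrow> int poly" where
  "quartic a b c d = [:d, c, b, a, 1:]"

definition N_D4 :: "nat \<Rightarrow> nat" where
  "N_D4 H = card {(a, b, c, d). a \<in> {-int H..int H} \<and> b \<in> {-int H..int H} \<and>
      c \<in> {-int H..int H} \<and> d \<in> {-int H..int H} \<and>
      irreducible (map_poly (of_int :: int \<Rightarrow> rat) (quartic a b c d)) \<and>
      galois_group (quartic a b c d) \<cong> D4}"

end

(* A quartic with Galois group D4 has a pairing of its roots preserved by all automorphisms, so
   x = b0 b2 + b1 b3 is a rational integer and (x^2 - 4d)(a^2 - 4b + 4x) = (xa - 2c)^2. Generically
   this means x^2 - 4d = u v^2 and a^2 - 4b + 4x = u w^2: the quartic is the norm of a quadratic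
   polynomial over Q(sqrt u), with linear coefficient (a + w sqrt u)/2 and constant (x + v sqrt u)/2.

   Upper bound: write A, A' = x +- v sqrt u and B, B' = a +- w sqrt u. All of A A', B B', A B', A' B are
   O(H), and one of these four numbers is at least M sqrt u for M = max(v,w). Hence x and a lie in
   intervals of length O(H / (M sqrt u)), which leaves O(H^2 / (u M^2)) choices for (x, a). Summing
   over v, w and u gives H^2 (log H)^2. Imaginary u and the degenerate cases contribute H^2 log H.

   Lower bound: for squarefree u > 1, suitable v, w and x, a slightly above v sqrt u, w sqrt u the
   height is O(H), and congruences modulo 3 make the norm N of the discriminant of the quadratic
   factor satisfy N = u N = 2 mod 3. Neither N nor u N is then a square, which forces irreducibility
   and Galois group D4. *)
theory Submission
  imports Defs "HOL-Computational_Algebra.Fundamental_Theorem_Algebra"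
    "HOL-Computational_Algebra.Nth_Powers" "HOL-Computational_Algebra.Squarefree"
begin

section \<open>Extension of field homomorphisms\<close>

text \<open>The two logarithms have separate sources: \<open>1/u\<close> summed over
  \<open>u\<close> gives one, and \<open>1/M^2\<close> summed over the pairs \<open>(v, w)\<close>
  with maximum \<open>M\<close> gives the other, since there are about \<open>2 M\<close> such
  pairs. An interval contains a number of integers proportional to its length only if it is not too
  short, so in both bounds the parameters are restricted so that \<open>H / (M sqrt u)\<close> stays
  bounded below. The upper bound may count a quartic several times; the lower bound must control
  repetitions. There a squarefree \<open>u\<close> makes \<open>u\<close>, \<open>v\<close>,
  \<open>w\<close> recoverable from \<open>u v^2\<close> and \<open>u w^2\<close>, and the only
  ambiguity left is the choice of a root of the cubic resolvent, at most three. The height is taken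
  as \<open>144 k^4\<close>, with \<open>u\<close> up to \<open>k^2\<close> and \<open>v\<close>
  from order \<open>k^2\<close> to order \<open>k^3\<close>: both ranges span a power of
  \<open>k\<close>, so each sum yields a full logarithm, and the intervals for \<open>x\<close> and
  \<open>a\<close> keep lengths between a constant and order \<open>k^2\<close>. The Galois group
  consists of maps on a subset of the complex numbers, so the field theory is done for subfields of
  C and homomorphisms into C, where the fundamental theorem of algebra supplies the images of new
  elements.\<close>

definition field_hom_on :: "complex set \<Rightarrow> (complex \<Rightarrow> complex) \<Rightarrow> bool" where
  "field_hom_on F \<sigma> \<longleftrightarrow> \<sigma> 1 = 1 \<and>
     (\<forall>x\<in>F. \<forall>y\<in>F. \<sigma> (x + y) = \<sigma> x + \<sigma> y \<and> \<sigma> (x * y) = \<sigma> x * \<sigma> y)"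

lemma subfield_C_closed:
  assumes "is_subfield_C F"
  shows "0 \<in> F" "1 \<in> F"
    "\<And>x y. x \<in> F \<Longrightarrow> y \<in> F \<Longrightarrow> x + y \<in> F"
    "\<And>x y. x \<in> F \<Longrightarrow> y \<in> F \<Longrightarrow> x - y \<in> F"
    "\<And>x y. x \<in> F \<Longrightarrow> y \<in> F \<Longrightarrow> x * y \<in> F"
    "\<And>x. x \<in> F \<Longrightarrow> - x \<in> F"
    "\<And>x. x \<in> F \<Longrightarrow> inverse x \<in> F"
    "\<And>x y. x \<in> F \<Longrightarrow> y \<in> F \<Longrightarrow> x / y \<in> F"
    "\<And>x n. x \<in> F \<Longrightarrow> x ^ n \<in> F"
proof -
  note F = assms[unfolded is_subfield_C_def]
  show 0: "0 \<in> F" and 1: "1 \<in> F"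
    and "\<And>x y. x \<in> F \<Longrightarrow> y \<in> F \<Longrightarrow> x + y \<in> F"
    and 2: "\<And>x y. x \<in> F \<Longrightarrow> y \<in> F \<Longrightarrow> x - y \<in> F"
    and 3: "\<And>x y. x \<in> F \<Longrightarrow> y \<in> F \<Longrightarrow> x * y \<in> F"
    using F by auto
  show "- x \<in> F" if "x \<in> F" for x using 2[OF 0 that] by simp
  show 4: "inverse x \<in> F" if "x \<in> F" for x using F that 0 by (cases "x = 0") auto
  show "x / y \<in> F" if "x \<in> F" "y \<in> F" for x y
    using 3[OF that(1) 4[OF that(2)]] by (simp add: divide_inverse)
  show "x ^ n \<in> F" if "x \<in> F" for x n
    by (induction n) (use 1 3 that in auto)
qed

lemma subfield_C_of_nat: "is_subfield_C F \<Longrightarrow> of_nat n \<in> F"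
  by (induction n) (auto intro: subfield_C_closed)

lemma subfield_C_of_int: "is_subfield_C F \<Longrightarrow> of_int n \<in> F"
  by (cases n rule: int_cases2) (auto intro: subfield_C_closed subfield_C_of_nat)

lemma Rats_subset_subfield_C: "is_subfield_C F \<Longrightarrow> \<rat> \<subseteq> F"
  by (metis Rats_cases' subsetI subfield_C_closed(8) subfield_C_of_int)

lemma subfield_C_numeral: "is_subfield_C F \<Longrightarrow> numeral n \<in> F"
  using subfield_C_of_nat[of F "numeral n"] by simp

lemma is_subfield_C_Rats: "is_subfield_C \<rat>"
  by (auto simp: is_subfield_C_def)

lemma field_hom_onD:
  assumes "is_subfield_C F" "field_hom_on F \<sigma>"
  shows "\<sigma> 1 = 1" "\<sigma> 0 = 0"
    "\<And>x y. x \<in> F \<Longrightarrow> y \<in> F \<Longrightarrow> \<sigma> (x + y) = \<sigma> x + \<sigma> y"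
    "\<And>x y. x \<in> F \<Longrightarrow> y \<in> F \<Longrightarrow> \<sigma> (x * y) = \<sigma> x * \<sigma> y"
    "\<And>x. x \<in> F \<Longrightarrow> \<sigma> (- x) = - \<sigma> x"
    "\<And>x y. x \<in> F \<Longrightarrow> y \<in> F \<Longrightarrow> \<sigma> (x - y) = \<sigma> x - \<sigma> y"
    "\<And>x. x \<in> F \<Longrightarrow> x \<noteq> 0 \<Longrightarrow> \<sigma> x \<noteq> 0"
    "\<And>x. x \<in> F \<Longrightarrow> \<sigma> (inverse x) = inverse (\<sigma> x)"
    "\<And>x y. x \<in> F \<Longrightarrow> y \<in> F \<Longrightarrow> \<sigma> (x / y) = \<sigma> x / \<sigma> y"
    "inj_on \<sigma> F"
proof -
  note F = subfield_C_closed[OF assms(1)]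
  show 1: "\<sigma> 1 = 1"
    and add: "\<And>x y. x \<in> F \<Longrightarrow> y \<in> F \<Longrightarrow> \<sigma> (x + y) = \<sigma> x + \<sigma> y"
    and mult: "\<And>x y. x \<in> F \<Longrightarrow> y \<in> F \<Longrightarrow> \<sigma> (x * y) = \<sigma> x * \<sigma> y"
    using assms(2) by (auto simp: field_hom_on_def)
  show 0: "\<sigma> 0 = 0" using add[of 0 0] F(1) by simp
  show m: "\<sigma> (- x) = - \<sigma> x" if "x \<in> F" for x
    using add[OF that F(6)[OF that]] 0 by (simp add: eq_neg_iff_add_eq_0 add.commute)
  show d: "\<sigma> (x - y) = \<sigma> x - \<sigma> y" if "x \<in> F" "y \<in> F" for x y
    using add[OF that(1) F(6)[OF that(2)]] m[OF that(2)] by simp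
  show nz: "\<sigma> x \<noteq> 0" if "x \<in> F" "x \<noteq> 0" for x
    using mult[OF that(1) F(7)[OF that(1)]] that(2) 1 by auto
  show i: "\<sigma> (inverse x) = inverse (\<sigma> x)" if "x \<in> F" for x
  proof (cases "x = 0")
    case False
    then show ?thesis
      using mult[OF that F(7)[OF that]] 1 nz[OF that] by (simp add: field_simps)
  qed (simp add: 0)
  show "\<sigma> (x / y) = \<sigma> x / \<sigma> y" if "x \<in> F" "y \<in> F" for x y
    using mult[OF that(1) F(7)[OF that(2)]] i[OF that(2)] by (simp add: divide_inverse)
  show "inj_on \<sigma> F"
    by (rule inj_onI) (metis F(4) d eq_iff_diff_eq_0 nz)
qed

text \<open>A splitting field is an intersection of subfields, so a property of all its elements is
  proved by exhibiting a subfield that has it. Preimages, fixed sets and images are the candidates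
  attached to a homomorphism.\<close>

lemma subfield_C_fixed:
  assumes "is_subfield_C F" "field_hom_on F \<sigma>" "is_subfield_C K" "K \<subseteq> F"
  shows "is_subfield_C {z\<in>F. \<sigma> z \<in> K}" "is_subfield_C {z\<in>F. \<sigma> z = z}" "is_subfield_C (\<sigma> ` K)"
proof -
  note F = subfield_C_closed[OF assms(1)] subfield_C_closed[OF assms(3)] field_hom_onD[OF assms(1,2)]
  show "is_subfield_C {z\<in>F. \<sigma> z \<in> K}" "is_subfield_C {z\<in>F. \<sigma> z = z}"
    unfolding is_subfield_C_def using F by simp_all
  note K = subfield_C_closed[OF assms(3)] and \<sigma> = field_hom_onD[OF assms(1,2)]
  have KF: "x \<in> F" if "x \<in> K" for x using that assms(4) by auto
  show "is_subfield_C (\<sigma> ` K)"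
    unfolding is_subfield_C_def
  proof (intro conjI ballI impI)
    show "0 \<in> \<sigma> ` K" "1 \<in> \<sigma> ` K"
      using imageI[OF K(1), of \<sigma>] imageI[OF K(2), of \<sigma>] \<sigma>(1,2) by auto
    fix x y assume "x \<in> \<sigma> ` K" "y \<in> \<sigma> ` K"
    then obtain x' y' where x: "x = \<sigma> x'" "x' \<in> K" and y: "y = \<sigma> y'" "y' \<in> K" by blast
    show "x + y \<in> \<sigma> ` K" "x - y \<in> \<sigma> ` K" "x * y \<in> \<sigma> ` K"
      using imageI[OF K(3)[OF x(2) y(2)], of \<sigma>] imageI[OF K(4)[OF x(2) y(2)], of \<sigma>]
        imageI[OF K(5)[OF x(2) y(2)], of \<sigma>] \<sigma>(3,4,6)[OF KF[OF x(2)] KF[OF y(2)]] x y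
      by auto
  next
    fix x assume "x \<in> \<sigma> ` K" "x \<noteq> 0"
    then obtain x' where x: "x = \<sigma> x'" "x' \<in> K" by blast
    then show "inverse x \<in> \<sigma> ` K"
      using imageI[OF K(7)[OF x(2)], of \<sigma>] \<sigma>(8)[OF KF[OF x(2)]] by simp
  qed
qed

lemma field_hom_on_of_int:
  assumes "is_subfield_C F" "field_hom_on F \<sigma>"
  shows "\<sigma> (of_int n) = of_int n"
proof -
  note * = field_hom_onD[OF assms] subfield_C_of_nat[OF assms(1)] subfield_C_closed[OF assms(1)]
  have "\<sigma> (of_nat k) = of_nat k" for k
    by (induction k) (use * in auto)
  then show ?thesis
    by (cases n rule: int_cases2) (use * in auto)
qed

lemma field_hom_on_Rats:
  assumes "is_subfield_C F" "field_hom_on F \<sigma>" "x \<in> \<rat>"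
  shows "\<sigma> x = x"
proof -
  from assms(3) obtain a b where "x = of_int a / of_int b" by (rule Rats_cases') auto
  then show ?thesis
    using field_hom_onD(9)[OF assms(1,2)] field_hom_on_of_int[OF assms(1,2)] subfield_C_of_int[OF assms(1)]
    by simp
qed

lemma field_hom_on_power:
  assumes "is_subfield_C F" "field_hom_on F \<sigma>" "x \<in> F"
  shows "\<sigma> (x ^ n) = \<sigma> x ^ n"
  by (induction n) (use assms field_hom_onD[OF assms(1,2)] subfield_C_closed[OF assms(1)] in auto)

section \<open>Polynomials with coefficients in a subfield\<close>

definition over :: "complex set \<Rightarrow> complex poly \<Rightarrow> bool" where
  "over F p \<longleftrightarrow> (\<forall>i. coeff p i \<in> F)"

lemma over_pCons [simp]: "over F (pCons c p) \<longleftrightarrow> c \<in> F \<and> over F p"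
  by (auto simp: over_def coeff_pCons split: nat.splits)

lemma over_add: "is_subfield_C F \<Longrightarrow> over F p \<Longrightarrow> over F q \<Longrightarrow> over F (p + q)"
  and over_diff: "is_subfield_C F \<Longrightarrow> over F p \<Longrightarrow> over F q \<Longrightarrow> over F (p - q)"
  and over_minus: "is_subfield_C F \<Longrightarrow> over F p \<Longrightarrow> over F (- p)"
  and over_smult: "is_subfield_C F \<Longrightarrow> c \<in> F \<Longrightarrow> over F p \<Longrightarrow> over F (smult c p)"
  and over_0: "is_subfield_C F \<Longrightarrow> over F 0"
  and over_monom: "is_subfield_C F \<Longrightarrow> c \<in> F \<Longrightarrow> over F (monom c n)"
  by (auto simp: over_def subfield_C_closed)

lemma over_mult:
  assumes "is_subfield_C F" "over F p" "over F q"
  shows "over F (p * q)"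
  using assms(2) by (induction p) (auto intro!: over_add over_smult simp: assms over_0 subfield_C_closed)

lemma poly_over: "is_subfield_C F \<Longrightarrow> over F p \<Longrightarrow> z \<in> F \<Longrightarrow> poly p z \<in> F"
  by (induction p) (auto simp: subfield_C_closed)

context
  fixes F \<sigma>
  assumes F: "is_subfield_C F" and \<sigma>: "field_hom_on F \<sigma>"
begin

lemma map_poly_hom_add:
  "over F p \<Longrightarrow> over F q \<Longrightarrow> map_poly \<sigma> (p + q) = map_poly \<sigma> p + map_poly \<sigma> q"
  by (intro poly_eqI) (simp add: coeff_map_poly field_hom_onD[OF F \<sigma>] over_def)

lemma map_poly_hom_diff:
  "over F p \<Longrightarrow> over F q \<Longrightarrow> map_poly \<sigma> (p - q) = map_poly \<sigma> p - map_poly \<sigma> q"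
  by (intro poly_eqI) (simp add: coeff_map_poly field_hom_onD[OF F \<sigma>] over_def)

lemma map_poly_hom_smult:
  "c \<in> F \<Longrightarrow> over F p \<Longrightarrow> map_poly \<sigma> (smult c p) = smult (\<sigma> c) (map_poly \<sigma> p)"
  by (intro poly_eqI) (simp add: coeff_map_poly field_hom_onD[OF F \<sigma>] over_def)

lemma map_poly_hom_mult:
  assumes "over F p" "over F q"
  shows "map_poly \<sigma> (p * q) = map_poly \<sigma> p * map_poly \<sigma> q"
  using assms(1)
  by (induction p)
     (auto simp: map_poly_pCons field_hom_onD[OF F \<sigma>] map_poly_hom_add map_poly_hom_smult assms(2)
       over_smult over_mult F subfield_C_closed)

lemma poly_map_poly_hom:
  "over F p \<Longrightarrow> z \<in> F \<Longrightarrow> poly (map_poly \<sigma> p) (\<sigma> z) = \<sigma> (poly p z)"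
  by (induction p)
     (auto simp: map_poly_pCons field_hom_onD[OF F \<sigma>] poly_over F subfield_C_closed)

end

text \<open>Long division: cancelling a leading term takes only a quotient of two coefficients, so
  nothing leaves \<open>F\<close>. A divisor of degree at least 1 makes
  \<open>degree r < degree b\<close> true also for \<open>r = 0\<close>, whose degree counts as
  0.\<close>

lemma over_division:
  assumes F: "is_subfield_C F" and b: "over F b" "degree b \<ge> 1" and a: "over F a"
  shows "\<exists>k r. over F k \<and> over F r \<and> a = b * k + r \<and> degree r < degree b"
  using a
proof (induction "degree a" arbitrary: a rule: less_induct)
  case less
  show ?case
  proof (cases "degree a < degree b")
    case True
    then show ?thesis using less.prems over_0[OF F] by (intro exI[of _ 0] exI[of _ a]) auto
  next
    case False
    define c where "c = lead_coeff a / lead_coeff b"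
    define t where "t = monom c (degree a - degree b)"
    have t: "over F t" unfolding t_def c_def
      by (intro over_monom F) (use F less.prems b in \<open>auto simp: over_def intro: subfield_C_closed\<close>)
    have b0: "b \<noteq> 0" using b by auto
    have a0: "a \<noteq> 0" using b False by auto
    have c0: "c \<noteq> 0" using a0 b0 by (auto simp: c_def)
    have dt: "degree (b * t) = degree a"
      using False b0 c0 by (subst degree_mult_eq) (auto simp: t_def degree_monom_eq)
    have lt: "lead_coeff (b * t) = lead_coeff a"
      using b0 c0 by (subst lead_coeff_mult) (auto simp: t_def degree_monom_eq c_def)
    have "degree (a - b * t) < degree a"
    proof (cases "a - b * t = 0")
      case True
      then show ?thesis using False b by simp
    next
      case False
      have "degree (a - b * t) \<le> degree a" using dt by (intro degree_diff_le) auto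
      moreover have "coeff (a - b * t) (degree a) = 0" using lt dt by simp
      ultimately show ?thesis using False by (metis le_neq_implies_less leading_coeff_0_iff)
    qed
    from less.hyps[OF this over_diff[OF F less.prems over_mult[OF F b(1) t]]]
    obtain k r where kr: "over F k" "over F r" "a - b * t = b * k + r" "degree r < degree b" by blast
    moreover have "a = b * (k + t) + r" using kr(3) by (simp add: algebra_simps)
    ultimately show ?thesis using over_add[OF F kr(1) t] by blast
  qed
qed

section \<open>Minimal polynomials and simple extensions\<close>

definition minimal_poly :: "complex set \<Rightarrow> complex \<Rightarrow> complex poly \<Rightarrow> bool" where
  "minimal_poly F z m \<longleftrightarrow> over F m \<and> m \<noteq> 0 \<and> poly m z = 0 \<and>
     (\<forall>p. over F p \<longrightarrow> p \<noteq> 0 \<longrightarrow> poly p z = 0 \<longrightarrow> degree m \<le> degree p)"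

lemma minimal_poly_exists:
  assumes "over F p" "p \<noteq> 0" "poly p z = 0"
  shows "\<exists>m. minimal_poly F z m"
proof -
  have "\<exists>m. (over F m \<and> m \<noteq> 0 \<and> poly m z = 0) \<and>
     (\<forall>p. over F p \<and> p \<noteq> 0 \<and> poly p z = 0 \<longrightarrow> degree m \<le> degree p)"
    by (rule ex_has_least_nat) (use assms in auto)
  then show ?thesis unfolding minimal_poly_def by blast
qed

lemma minimal_poly_degree: "minimal_poly F z m \<Longrightarrow> degree m \<ge> 1"
  by (metis One_nat_def Suc_leI degree_eq_zeroE gr0I minimal_poly_def mult_zero_right poly_0 poly_pCons add_0_right pCons_0_0)

text \<open>Descent on the degree takes the place of a Bezout identity. If \<open>p\<close> has at
  least the degree of \<open>m\<close>, its remainder has the same value at \<open>z\<close>.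
  Otherwise divide \<open>m\<close> by \<open>p\<close>: the quotient \<open>k\<close> is nonzero of
  smaller degree than \<open>m\<close>, so it does not vanish at \<open>z\<close>, and the remainder
  takes the nonzero value \<open>- k(z) p(z)\<close>. Inverting that value and multiplying by
  \<open>- k(z)\<close> inverts \<open>p(z)\<close>.\<close>

lemma minimal_poly_inverse:
  assumes F: "is_subfield_C F" and m: "minimal_poly F z m" and p: "over F p" "poly p z \<noteq> 0"
  shows "\<exists>q. over F q \<and> poly q z * poly p z = 1"
  using p
proof (induction "degree p" arbitrary: p rule: less_induct)
  case less
  have m': "over F m" "m \<noteq> 0" "poly m z = 0"
    "\<And>p. over F p \<Longrightarrow> p \<noteq> 0 \<Longrightarrow> poly p z = 0 \<Longrightarrow> degree m \<le> degree p"
    using m by (auto simp: minimal_poly_def)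
  have dm: "degree m \<ge> 1" by (rule minimal_poly_degree[OF m])
  consider "degree p = 0" | "degree p \<ge> degree m" | "1 \<le> degree p" "degree p < degree m"
    by linarith
  then show ?case
  proof cases
    case 1
    then obtain c where c: "p = [:c:]" by (auto elim: degree_eq_zeroE)
    then show ?thesis
      using less.prems F by (intro exI[of _ "[:inverse c:]"]) (auto simp: subfield_C_closed over_0)
  next
    case 2
    obtain k r where r: "over F k" "over F r" "p = m * k + r" "degree r < degree m"
      using over_division[OF F m'(1) dm less.prems(1)] by blast
    then have "poly r z = poly p z" using m'(3) by simp
    then show ?thesis using less.hyps[of r] r 2 less.prems by auto
  next
    case 3
    obtain k r where r: "over F k" "over F r" "m = p * k + r" "degree r < degree p"
      using over_division[OF F less.prems(1) 3(1) m'(1)] by blast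
    have k0: "k \<noteq> 0" using r 3 by auto
    have "degree m = degree (p * k)"
      using r k0 3 by (metis add.right_neutral degree_add_eq_left degree_mult_eq less.prems(2) poly_0 trans_less_add1)
    then have "degree k < degree m"
      using k0 3 less.prems by (subst (asm) degree_mult_eq) auto
    then have "poly k z \<noteq> 0" using m'(4)[OF r(1) k0] by auto
    moreover have eq: "poly r z = - (poly k z * poly p z)"
      using m'(3) r(3) by (simp add: eq_neg_iff_add_eq_0 add.commute mult.commute)
    ultimately have "poly r z \<noteq> 0" using less.prems by simp
    then obtain q where "over F q" "poly q z * poly r z = 1"
      using less.hyps[of r] r by blast
    then show ?thesis
      using eq by (intro exI[of _ "- (q * k)"]) (auto intro!: over_minus over_mult F r simp: mult.assoc)
  qed
qed

lemma minimal_poly_dvd: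
  assumes F: "is_subfield_C F" and m: "minimal_poly F z m" and p: "over F p" "poly p z = 0"
  shows "\<exists>k. over F k \<and> p = m * k"
proof -
  obtain k r where r: "over F k" "over F r" "p = m * k + r" "degree r < degree m"
    using over_division[OF F _ minimal_poly_degree[OF m] p(1)] m minimal_poly_def by blast
  moreover have "r = 0"
    using m r p unfolding minimal_poly_def by (metis add_0 linorder_not_less mult_zero_left poly_add poly_mult)
  ultimately show ?thesis by auto
qed

definition adjoin :: "complex set \<Rightarrow> complex \<Rightarrow> complex set" where
  "adjoin F z = {poly p z |p. over F p}"

lemma subset_adjoin:
  assumes "is_subfield_C F"
  shows "insert z F \<subseteq> adjoin F z"
proof -
  have "x \<in> adjoin F z" if "x \<in> F" for x
    unfolding adjoin_def using that over_0[OF assms] by (intro CollectI exI[of _ "[:x:]"]) auto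
  moreover have "z \<in> adjoin F z"
    unfolding adjoin_def using over_0[OF assms] assms
    by (intro CollectI exI[of _ "[:0, 1:]"]) (simp add: subfield_C_closed)
  ultimately show ?thesis by auto
qed

lemma is_subfield_C_adjoin:
  assumes F: "is_subfield_C F" and m: "minimal_poly F z m"
  shows "is_subfield_C (adjoin F z)"
  unfolding is_subfield_C_def
proof (intro conjI ballI impI)
  show "0 \<in> adjoin F z" "1 \<in> adjoin F z"
    using subset_adjoin[OF F] subfield_C_closed[OF F] by auto
next
  fix x y assume "x \<in> adjoin F z" "y \<in> adjoin F z"
  then obtain p q where pq: "over F p" "x = poly p z" "over F q" "y = poly q z" by (auto simp: adjoin_def)
  show "x + y \<in> adjoin F z" "x - y \<in> adjoin F z" "x * y \<in> adjoin F z"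
    unfolding adjoin_def using pq over_add[OF F] over_diff[OF F] over_mult[OF F]
    by (auto simp flip: poly_add poly_diff poly_mult)
next
  fix x assume "x \<in> adjoin F z" and x0: "x \<noteq> 0"
  then obtain p where p: "over F p" "x = poly p z" by (auto simp: adjoin_def)
  then obtain q where q: "over F q" "poly q z * poly p z = 1"
    using minimal_poly_inverse[OF F m p(1)] x0 by auto
  have "inverse x = poly q z"
    using q(2) p(2) inverse_unique by (metis mult.commute)
  then show "inverse x \<in> adjoin F z" unfolding adjoin_def using q by auto
qed

lemma field_hom_extend:
  assumes F: "is_subfield_C F" and \<sigma>: "field_hom_on F \<sigma>" and m: "minimal_poly F z m"
    and w: "poly (map_poly \<sigma> m) w = 0"
  shows "\<exists>\<sigma>'. field_hom_on (adjoin F z) \<sigma>' \<and> (\<forall>x\<in>F. \<sigma>' x = \<sigma> x) \<and> \<sigma>' z = w"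
proof -
  \<comment> \<open>An element of \<open>adjoin F z\<close> has many polynomial expressions. The
    choice does not matter: two of them differ by a multiple of \<open>m\<close>, and
    \<open>map_poly \<sigma> m\<close> vanishes at \<open>w\<close>.\<close>
  define \<sigma>' where "\<sigma>' = (\<lambda>y. poly (map_poly \<sigma> (SOME p. over F p \<and> poly p z = y)) w)"
  note \<sigma>0 = field_hom_onD(2)[OF F \<sigma>]
  have \<sigma>': "\<sigma>' (poly p z) = poly (map_poly \<sigma> p) w" if p: "over F p" for p
  proof -
    define q where "q = (SOME q. over F q \<and> poly q z = poly p z)"
    have q: "over F q" "poly q z = poly p z"
      unfolding q_def using someI[of "\<lambda>q. over F q \<and> poly q z = poly p z" p] p by auto
    obtain k where k: "over F k" "q - p = m * k"
      using minimal_poly_dvd[OF F m over_diff[OF F q(1) p]] q by auto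
    have "map_poly \<sigma> q - map_poly \<sigma> p = map_poly \<sigma> m * map_poly \<sigma> k"
      using m by (simp add: minimal_poly_def flip: map_poly_hom_diff[OF F \<sigma> q(1) p] map_poly_hom_mult[OF F \<sigma> _ k(1)] k(2))
    then have "poly (map_poly \<sigma> q) w - poly (map_poly \<sigma> p) w = 0"
      using w by (metis mult_zero_left poly_diff poly_mult)
    then show ?thesis by (simp add: \<sigma>'_def q_def)
  qed
  have agree: "\<sigma>' x = \<sigma> x" if "x \<in> F" for x
    using \<sigma>'[of "[:x:]"] that over_0[OF F] \<sigma>0 by (simp add: map_poly_pCons)
  have hom: "field_hom_on (adjoin F z) \<sigma>'"
    unfolding field_hom_on_def
  proof (intro conjI ballI)
    show "\<sigma>' 1 = 1" using agree[of 1] F by (simp add: subfield_C_closed field_hom_onD[OF F \<sigma>])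
    fix x y assume "x \<in> adjoin F z" "y \<in> adjoin F z"
    then obtain p q where pq: "over F p" "x = poly p z" "over F q" "y = poly q z" by (auto simp: adjoin_def)
    show "\<sigma>' (x + y) = \<sigma>' x + \<sigma>' y"
      using \<sigma>'[OF over_add[OF F pq(1,3)]] pq \<sigma>' by (simp add: map_poly_hom_add[OF F \<sigma>])
    show "\<sigma>' (x * y) = \<sigma>' x * \<sigma>' y"
      using \<sigma>'[OF over_mult[OF F pq(1,3)]] pq \<sigma>' by (simp add: map_poly_hom_mult[OF F \<sigma>])
  qed
  have "over F [:0, 1:]" using over_0[OF F] F by (simp add: subfield_C_closed)
  from \<sigma>'[OF this] have "\<sigma>' z = w"
    using \<sigma>0 field_hom_onD(1)[OF F \<sigma>] by (simp add: map_poly_pCons)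
  then show ?thesis using hom agree by (intro exI[of _ \<sigma>']) auto
qed

lemma field_hom_extend_finite:
  assumes "finite A" and F: "is_subfield_C F" and \<sigma>: "field_hom_on F \<sigma>"
    and alg: "\<And>z. z \<in> A \<Longrightarrow> \<exists>p. over \<rat> p \<and> p \<noteq> 0 \<and> poly p z = 0"
  shows "\<exists>F' \<sigma>'. is_subfield_C F' \<and> field_hom_on F' \<sigma>' \<and> A \<union> F \<subseteq> F' \<and> (\<forall>x\<in>F. \<sigma>' x = \<sigma> x)"
  using assms(1) alg
proof (induction A rule: finite_induct)
  case empty
  then show ?case using F \<sigma> by auto
next
  case (insert z A)
  then obtain F1 \<sigma>1 where 1: "is_subfield_C F1" "field_hom_on F1 \<sigma>1" "A \<union> F \<subseteq> F1" "\<forall>x\<in>F. \<sigma>1 x = \<sigma> x"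
    by (metis insertI2)
  obtain p where "over \<rat> p" "p \<noteq> 0" "poly p z = 0" using insert.prems by blast
  moreover from this have "over F1 p" using Rats_subset_subfield_C[OF 1(1)] by (auto simp: over_def)
  ultimately obtain m where m: "minimal_poly F1 z m" using minimal_poly_exists by blast
  have om: "over F1 m" using m by (simp add: minimal_poly_def)
  \<comment> \<open>Injectivity of \<open>\<sigma>1\<close> keeps the leading coefficient nonzero,
    so the transported polynomial is not constant and has a complex root to serve as the image of
    \<open>z\<close>.\<close>
  have "coeff (map_poly \<sigma>1 m) (degree m) \<noteq> 0"
    using m om unfolding minimal_poly_def over_def
    by (simp add: coeff_map_poly field_hom_onD[OF 1(1,2)])
  then have "degree (map_poly \<sigma>1 m) \<ge> 1"
    using minimal_poly_degree[OF m] le_degree order_trans by blast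
  then have "\<exists>w. poly (map_poly \<sigma>1 m) w = 0"
    by (intro fundamental_theorem_of_algebra_alt) auto
  then obtain w where "poly (map_poly \<sigma>1 m) w = 0" by blast
  from field_hom_extend[OF 1(1,2) m this] obtain \<sigma>' where
    "field_hom_on (adjoin F1 z) \<sigma>'" "\<forall>x\<in>F1. \<sigma>' x = \<sigma>1 x" by blast
  then show ?case
    using 1 subset_adjoin[OF 1(1), of z] is_subfield_C_adjoin[OF 1(1) m]
    by (intro exI[of _ "adjoin F1 z"] exI[of _ \<sigma>']) auto
qed

text \<open>The minimal polynomial of an irrational \<open>x\<close> has degree at least 2, and
  \<open>x\<close> is a simple root because the derivative has smaller degree. After dividing out
  \<open>X - x\<close>, a root \<open>w\<close> different from \<open>x\<close> remains, and the
  identity of the rationals extends by sending \<open>x\<close> to \<open>w\<close>.\<close>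

lemma field_hom_move_irrational:
  assumes p: "over \<rat> p" "p \<noteq> 0" "poly p x = 0" and x: "x \<notin> \<rat>"
  shows "\<exists>F \<sigma>. is_subfield_C F \<and> field_hom_on F \<sigma> \<and> x \<in> F \<and> \<sigma> x \<noteq> x"
proof -
  obtain m where m: "minimal_poly \<rat> x m" using minimal_poly_exists p by blast
  then have m': "over \<rat> m" "m \<noteq> 0" "poly m x = 0" by (auto simp: minimal_poly_def)
  have id: "field_hom_on \<rat> id" by (simp add: field_hom_on_def)
  obtain k where k: "m = [:-x, 1:] * k" using m'(3) by (auto simp: poly_eq_0_iff_dvd)
  have dm: "degree m \<noteq> 1"
  proof
    assume "degree m = 1"
    then have "m = [:coeff m 0, coeff m 1:]" "coeff m 1 \<noteq> 0"
      by (auto intro!: poly_eqI simp: coeff_pCons coeff_eq_0 split: nat.splits)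
         (metis One_nat_def leading_coeff_0_iff m'(2))
    then obtain c e where ce: "m = [:c, e:]" "e \<noteq> 0" by blast
    then have "x = (- c) / e" using m'(3) by (simp add: field_simps add_eq_0_iff2)
    moreover have "c \<in> \<rat>" "e \<in> \<rat>" using ce(1) m'(1) by auto
    ultimately show False using x by (simp only: Rats_divide Rats_minus_iff not_True_eq_False)
  qed
  have pd: "over \<rat> (pderiv m)" using m'(1) by (auto simp: over_def coeff_pderiv)
  have "pderiv m \<noteq> 0" using minimal_poly_degree[OF m] by (auto simp: pderiv_eq_0_iff)
  moreover have "degree (pderiv m) < degree m"
    using minimal_poly_degree[OF m] by (simp add: degree_pderiv)
  ultimately have "poly (pderiv m) x \<noteq> 0" using m pd unfolding minimal_poly_def by (meson linorder_not_less)
  moreover have "pderiv m = [:-x, 1:] * pderiv k + k * pderiv [:-x, 1:]" by (simp only: k pderiv_mult)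
  ultimately have kx: "poly k x \<noteq> 0" by (simp add: pderiv_pCons)
  have "degree m = 1 + degree k" using k m' by (subst k, subst degree_mult_eq) auto
  then have "degree k \<noteq> 0" using dm by auto
  then have "\<exists>w. poly k w = 0" by (intro fundamental_theorem_of_algebra_alt) auto
  then obtain w where w: "poly k w = 0" by blast
  have "map_poly id m = m" by (intro poly_eqI) (simp add: coeff_map_poly)
  then have "poly (map_poly id m) w = 0" using w k by simp
  from field_hom_extend[OF is_subfield_C_Rats id m this] obtain \<sigma> where
    "field_hom_on (adjoin \<rat> x) \<sigma>" "\<sigma> x = w" by blast
  moreover have "w \<noteq> x" using kx w by auto
  ultimately show ?thesis
    using subset_adjoin[OF is_subfield_C_Rats, of x] is_subfield_C_adjoin[OF is_subfield_C_Rats m]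
    by (intro exI[of _ "adjoin \<rat> x"] exI[of _ \<sigma>]) auto
qed

section \<open>Automorphisms of the splitting field\<close>

lemma is_subfield_C_splitting_field: "is_subfield_C (splitting_field_C f)"
  unfolding is_subfield_C_def splitting_field_C_def by (auto simp: subfield_C_closed)

lemma roots_C_subset_splitting_field: "roots_C f \<subseteq> splitting_field_C f"
  by (auto simp: splitting_field_C_def)

lemma splitting_field_C_subset: "is_subfield_C F \<Longrightarrow> roots_C f \<subseteq> F \<Longrightarrow> splitting_field_C f \<subseteq> F"
  by (auto simp: splitting_field_C_def)

lemma galois_group_simps:
  "\<sigma> \<in> carrier (galois_group f) \<longleftrightarrow>
     \<sigma> \<in> extensional (splitting_field_C f) \<and> bij_betw \<sigma> (splitting_field_C f) (splitting_field_C f) \<and>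
     (\<forall>x\<in>splitting_field_C f. \<forall>y\<in>splitting_field_C f.
        \<sigma> (x + y) = \<sigma> x + \<sigma> y \<and> \<sigma> (x * y) = \<sigma> x * \<sigma> y)"
  "monoid.mult (galois_group f) \<sigma> \<tau> = compose (splitting_field_C f) \<sigma> \<tau>"
  "monoid.one (galois_group f) = restrict id (splitting_field_C f)"
  by (auto simp: galois_group_def Let_def)

text \<open>The group asks only for additive and multiplicative bijections. Then
  \<open>\<sigma> 1\<close> is idempotent and, by injectivity, different from
  \<open>\<sigma> 0 = 0\<close>, so it is 1.\<close>

lemma galois_field_hom:
  assumes "\<sigma> \<in> carrier (galois_group f)"
  shows "field_hom_on (splitting_field_C f) \<sigma>"
proof -
  let ?K = "splitting_field_C f"
  note K = subfield_C_closed[OF is_subfield_C_splitting_field[of f]]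
  have add: "\<sigma> (x + y) = \<sigma> x + \<sigma> y" and mult: "\<sigma> (x * y) = \<sigma> x * \<sigma> y"
    if "x \<in> ?K" "y \<in> ?K" for x y
    using assms that by (auto simp: galois_group_simps)
  have inj: "inj_on \<sigma> ?K" using assms by (auto simp: galois_group_simps bij_betw_def)
  have "\<sigma> 0 = 0" using add[of 0 0] K by simp
  then have "\<sigma> 1 \<noteq> 0" using inj K(1,2) by (metis inj_onD zero_neq_one)
  then have "\<sigma> 1 = 1" using mult[of 1 1] K by simp
  then show ?thesis using add mult by (simp add: field_hom_on_def)
qed

lemma map_poly_hom_of_int_poly:
  assumes "is_subfield_C F" "field_hom_on F \<sigma>"
  shows "map_poly \<sigma> (map_poly of_int f) = map_poly of_int f"
  by (intro poly_eqI) (simp add: coeff_map_poly field_hom_onD[OF assms] field_hom_on_of_int[OF assms])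

lemma over_of_int_poly: "is_subfield_C F \<Longrightarrow> over F (map_poly of_int f)"
  by (simp add: over_def coeff_map_poly subfield_C_of_int)

lemma field_hom_roots_C:
  assumes "is_subfield_C F" "field_hom_on F \<sigma>" "z \<in> F" "z \<in> roots_C f"
  shows "\<sigma> z \<in> roots_C f"
  using poly_map_poly_hom[OF assms(1,2) over_of_int_poly[OF assms(1)] assms(3), of f] assms(4)
  by (simp add: map_poly_hom_of_int_poly[OF assms(1,2)] roots_C_def field_hom_onD[OF assms(1,2)])

lemma galois_roots_C:
  "\<sigma> \<in> carrier (galois_group f) \<Longrightarrow> z \<in> roots_C f \<Longrightarrow> \<sigma> z \<in> roots_C f"
  using field_hom_roots_C[OF is_subfield_C_splitting_field galois_field_hom]
    roots_C_subset_splitting_field by blast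

text \<open>The elements on which two automorphisms agree form a subfield; once it contains the
  roots it is the whole splitting field. Outside of it both maps take the default value.\<close>

lemma galois_eqI:
  assumes \<sigma>: "\<sigma> \<in> carrier (galois_group f)" and \<tau>: "\<tau> \<in> carrier (galois_group f)"
    and eq: "\<And>z. z \<in> roots_C f \<Longrightarrow> \<sigma> z = \<tau> z"
  shows "\<sigma> = \<tau>"
proof -
  let ?K = "splitting_field_C f"
  note K = is_subfield_C_splitting_field[of f]
  note hs = subfield_C_closed[OF K] field_hom_onD[OF K galois_field_hom[OF \<sigma>]]
     field_hom_onD[OF K galois_field_hom[OF \<tau>]]
  have "is_subfield_C {z\<in>?K. \<sigma> z = \<tau> z}"
    unfolding is_subfield_C_def using hs by simp
  moreover have "roots_C f \<subseteq> {z\<in>?K. \<sigma> z = \<tau> z}"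
    using eq roots_C_subset_splitting_field by auto
  ultimately have "?K \<subseteq> {z\<in>?K. \<sigma> z = \<tau> z}" by (rule splitting_field_C_subset)
  then show ?thesis
    using \<sigma> \<tau> by (intro extensionalityI[of _ ?K]) (auto simp: galois_group_simps)
qed

lemma of_int_poly_nonzero: "f \<noteq> 0 \<Longrightarrow> map_poly of_int f \<noteq> (0 :: 'a :: ring_char_0 poly)"
  by (simp add: map_poly_eq_0_iff)

lemma finite_roots_C: "f \<noteq> 0 \<Longrightarrow> finite (roots_C f)"
  unfolding roots_C_def using poly_roots_finite[OF of_int_poly_nonzero] .

text \<open>Normality of the splitting field. \<open>\<tau>\<close> maps the finite set of roots
  injectively into itself, hence onto itself. Preimage and image of the splitting field are then
  subfields that contain the roots, which gives both inclusions between the field and its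
  image.\<close>

lemma field_hom_restrict_galois:
  assumes f: "f \<noteq> 0" and F: "is_subfield_C F" and \<tau>: "field_hom_on F \<tau>" and r: "roots_C f \<subseteq> F"
  shows "restrict \<tau> (splitting_field_C f) \<in> carrier (galois_group f)"
proof -
  let ?K = "splitting_field_C f" and ?R = "roots_C f"
  note K = is_subfield_C_splitting_field[of f]
  have KF: "?K \<subseteq> F" using splitting_field_C_subset[OF F r] .
  have inj: "inj_on \<tau> F" using field_hom_onD(10)[OF F \<tau>] .
  have sub: "\<tau> ` ?R \<subseteq> ?R" using field_hom_roots_C[OF F \<tau>] r by auto
  have surj: "\<tau> ` ?R = ?R"
    by (rule endo_inj_surj[OF finite_roots_C[OF f] sub inj_on_subset[OF inj r]])
  have "?K \<subseteq> {z\<in>F. \<tau> z \<in> ?K}"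
    using sub r roots_C_subset_splitting_field by (intro splitting_field_C_subset subfield_C_fixed[OF F \<tau> K KF]) blast
  moreover have "?K \<subseteq> \<tau> ` ?K"
    using surj roots_C_subset_splitting_field by (intro splitting_field_C_subset subfield_C_fixed[OF F \<tau> K KF]) blast
  ultimately have "\<tau> ` ?K = ?K" by auto
  then have "bij_betw (restrict \<tau> ?K) ?K ?K"
    using inj_on_subset[OF inj KF] by (auto simp: bij_betw_def inj_on_def)
  then show ?thesis
    using KF field_hom_onD[OF F \<tau>] subfield_C_closed[OF K] by (auto simp: galois_group_simps subset_iff)
qed

text \<open>The homomorphism that moves an irrational \<open>x\<close> lives on a field that may
  lack the roots. It is extended to them and then restricted to the splitting field, where it
  becomes an automorphism that still moves \<open>x\<close>.\<close>

lemma galois_fixed_rational: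
  assumes f: "f \<noteq> 0" and x: "x \<in> splitting_field_C f" and p: "over \<rat> p" "p \<noteq> 0" "poly p x = 0"
    and fixed: "\<And>\<sigma>. \<sigma> \<in> carrier (galois_group f) \<Longrightarrow> \<sigma> x = x"
  shows "x \<in> \<rat>"
proof (rule ccontr)
  assume "x \<notin> \<rat>"
  then obtain F \<sigma> where F: "is_subfield_C F" "field_hom_on F \<sigma>" "x \<in> F" "\<sigma> x \<noteq> x"
    using field_hom_move_irrational p by blast
  have "\<exists>p. over \<rat> p \<and> p \<noteq> 0 \<and> poly p z = 0" if "z \<in> roots_C f" for z
    using that over_of_int_poly[OF is_subfield_C_Rats] of_int_poly_nonzero[OF f]
    by (intro exI[of _ "map_poly of_int f"]) (auto simp: roots_C_def)
  then obtain F' \<sigma>' where F': "is_subfield_C F'" "field_hom_on F' \<sigma>'" "roots_C f \<union> F \<subseteq> F'" "\<forall>x\<in>F. \<sigma>' x = \<sigma> x"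
    using field_hom_extend_finite[OF finite_roots_C[OF f] F(1,2)] by blast
  from F'(3) have "restrict \<sigma>' (splitting_field_C f) \<in> carrier (galois_group f)"
    by (intro field_hom_restrict_galois[OF f F'(1,2)]) auto
  from fixed[OF this] show False using x F F' by simp
qed

section \<open>Quartics with dihedral Galois group\<close>

lemma of_int_quartic:
  "map_poly of_int (quartic a b c d) = [:of_int d, of_int c, of_int b, of_int a, 1 :: 'a :: ring_char_0:]"
  by (simp add: quartic_def map_poly_pCons)

lemma quartic_nonzero: "quartic a b c d \<noteq> 0"
  by (simp add: quartic_def)

lemma roots_C_quartic:
  "z \<in> roots_C (quartic a b c d) \<longleftrightarrow> z ^ 4 + of_int a * z ^ 3 + of_int b * z ^ 2 + of_int c * z + of_int d = 0"
  by (simp add: roots_C_def of_int_quartic algebra_simps power2_eq_square power3_eq_cube power4_eq_xxxx)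

text \<open>Both sides are monic of degree 4, so their difference has degree at most 3 but four
  distinct zeros.\<close>

lemma quartic_factor_roots:
  assumes "{\<beta>0, \<beta>1, \<beta>2, \<beta>3} \<subseteq> roots_C (quartic a b c d)" "distinct [\<beta>0, \<beta>1, \<beta>2, \<beta>3]"
  shows "map_poly of_int (quartic a b c d) = [:-\<beta>0, 1:] * [:-\<beta>1, 1:] * [:-\<beta>2, 1:] * [:-\<beta>3, 1:]"
proof (rule ccontr)
  define q where "q = [:-\<beta>0, 1:] * [:-\<beta>1, 1:] * [:-\<beta>2, 1:] * [:-\<beta>3, 1:]"
  define p where "p = map_poly of_int (quartic a b c d) - q"
  have q: "poly q z = (z - \<beta>0) * (z - \<beta>1) * (z - \<beta>2) * (z - \<beta>3)" for z
    unfolding q_def by (simp only: poly_mult poly_pCons poly_0) simp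
  assume "map_poly of_int (quartic a b c d) \<noteq> [:-\<beta>0, 1:] * [:-\<beta>1, 1:] * [:-\<beta>2, 1:] * [:-\<beta>3, 1:]"
  then have p0: "p \<noteq> 0" unfolding p_def q_def right_minus_eq .
  have "degree p \<le> 3"
    by (rule degree_le) (auto simp: p_def q_def of_int_quartic coeff_pCons less_Suc_eq numeral_eq_Suc split: nat.splits)
  then have "card {x. poly p x = 0} \<le> 3" using card_poly_roots_bound[OF p0] by linarith
  moreover have "{\<beta>0, \<beta>1, \<beta>2, \<beta>3} \<subseteq> {x. poly p x = 0}"
    using assms(1) by (auto simp: p_def q roots_C_def)
  then have "card {\<beta>0, \<beta>1, \<beta>2, \<beta>3} \<le> card {x. poly p x = 0}"
    by (intro card_mono poly_roots_finite p0)
  ultimately show False using assms(2) by simp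
qed

lemma quartic_vieta:
  assumes "{\<beta>0, \<beta>1, \<beta>2, \<beta>3} \<subseteq> roots_C (quartic a b c d)" "distinct [\<beta>0, \<beta>1, \<beta>2, \<beta>3]"
  shows "of_int a = - (\<beta>0 + \<beta>1 + \<beta>2 + \<beta>3)"
    "of_int b = \<beta>0 * \<beta>1 + \<beta>0 * \<beta>2 + \<beta>0 * \<beta>3 + \<beta>1 * \<beta>2 + \<beta>1 * \<beta>3 + \<beta>2 * \<beta>3"
    "of_int c = - (\<beta>0 * \<beta>1 * \<beta>2 + \<beta>0 * \<beta>1 * \<beta>3 + \<beta>0 * \<beta>2 * \<beta>3 + \<beta>1 * \<beta>2 * \<beta>3)"
    "of_int d = \<beta>0 * \<beta>1 * \<beta>2 * \<beta>3"
    "roots_C (quartic a b c d) = {\<beta>0, \<beta>1, \<beta>2, \<beta>3}"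
proof -
  note eq = quartic_factor_roots[OF assms]
  have *: "[:of_int d, of_int c, of_int b, of_int a, 1:] = [:-\<beta>0, 1:] * [:-\<beta>1, 1:] * [:-\<beta>2, 1:] * [:-\<beta>3, 1:]"
    using eq by (simp only: of_int_quartic)
  show "of_int a = - (\<beta>0 + \<beta>1 + \<beta>2 + \<beta>3)"
    "of_int b = \<beta>0 * \<beta>1 + \<beta>0 * \<beta>2 + \<beta>0 * \<beta>3 + \<beta>1 * \<beta>2 + \<beta>1 * \<beta>3 + \<beta>2 * \<beta>3"
    "of_int c = - (\<beta>0 * \<beta>1 * \<beta>2 + \<beta>0 * \<beta>1 * \<beta>3 + \<beta>0 * \<beta>2 * \<beta>3 + \<beta>1 * \<beta>2 * \<beta>3)"
    "of_int d = \<beta>0 * \<beta>1 * \<beta>2 * \<beta>3"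
    using * by (auto simp: algebra_simps)
  show "roots_C (quartic a b c d) = {\<beta>0, \<beta>1, \<beta>2, \<beta>3}"
    unfolding roots_C_def eq poly_mult poly_pCons poly_0 by auto
qed

lemma galois_compose_closed:
  assumes "f \<noteq> 0" "\<sigma> \<in> carrier (galois_group f)" "\<tau> \<in> carrier (galois_group f)"
  shows "compose (splitting_field_C f) \<sigma> \<tau> \<in> carrier (galois_group f)"
proof -
  let ?K = "splitting_field_C f"
  have in_K: "\<tau> x \<in> ?K" if "x \<in> ?K" for x
    using assms(3) that by (auto simp: galois_group_simps dest: bij_betwE)
  have "field_hom_on ?K (\<lambda>x. \<sigma> (\<tau> x))"
    using galois_field_hom[OF assms(2)] galois_field_hom[OF assms(3)] in_K by (auto simp: field_hom_on_def)
  from field_hom_restrict_galois[OF assms(1) is_subfield_C_splitting_field this roots_C_subset_splitting_field]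
  show ?thesis by (simp add: compose_def)
qed

section \<open>Symmetries of the square and the resolvent root\<close>

definition D4_map :: "nat \<Rightarrow> nat \<Rightarrow> nat \<Rightarrow> nat" where
  "D4_map a s = restrict (\<lambda>i. (a + s * i) mod 4) {..<4}"

lemma D4_carrier: "g \<in> carrier D4 \<longleftrightarrow> (\<exists>a s. a < 4 \<and> (s = 1 \<or> s = 3) \<and> g = D4_map a s)"
  by (auto simp: D4_def D4_map_def)

lemma D4_mult: "monoid.mult D4 g h = compose {..<4} g h"
  by (simp add: D4_def)

lemma D4_map_compose: "compose {..<4} (D4_map a s) (D4_map b t) = D4_map ((a + s * b) mod 4) ((s * t) mod 4)"
proof -
  have "(a + s * ((b + t * i) mod 4)) mod 4 = ((a + s * b) mod 4 + (s * t) mod 4 * i) mod 4" for i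
  proof -
    have "(a + s * ((b + t * i) mod 4)) mod 4 = (a + s * (b + t * i)) mod 4"
      by (metis mod_add_right_eq mod_mult_right_eq)
    also have "\<dots> = ((a + s * b) + (s * t) * i) mod 4" by (simp add: algebra_simps)
    also have "\<dots> = ((a + s * b) mod 4 + (s * t) mod 4 * i) mod 4"
      by (intro mod_add_cong mod_mult_cong) simp_all
    finally show ?thesis .
  qed
  then show ?thesis by (auto simp: compose_def D4_map_def restrict_def fun_eq_iff)
qed

lemma D4_half_turn_central:
  assumes "g \<in> carrier D4"
  shows "compose {..<4} g (D4_map 2 1) = compose {..<4} (D4_map 2 1) g"
proof -
  obtain a s where g: "s = 1 \<or> s = 3" "g = D4_map a s" using assms D4_carrier by blast
  have "(a + s * 2) mod 4 = (2 + a) mod 4" using g(1) by presburger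
  then show ?thesis by (simp only: g(2) D4_map_compose mult_1 mult_1_right)
qed

lemma D4_map_rotations:
  "compose {..<4} (D4_map 1 1) (D4_map 1 1) = D4_map 2 1"
  "compose {..<4} (D4_map 2 1) (D4_map 1 1) = D4_map 3 1"
  "compose {..<4} (D4_map 2 1) (D4_map 2 1) = D4_map 0 1"
  "compose {..<4} (D4_map 0 1) (D4_map 1 1) = D4_map 1 1"
  unfolding D4_map_compose by (rule arg_cong2[where f = D4_map]; simp)+

lemma D4_map_3_neq_1: "D4_map 3 1 \<noteq> D4_map 1 1"
proof
  assume "D4_map 3 1 = D4_map 1 1"
  from fun_cong[OF this, of 0] show False by (simp add: D4_map_def)
qed

text \<open>The rotation by a quarter turn acts on the roots as a 4-cycle, and its square is central, so
  the pairing of each root with its opposite is respected by all automorphisms.\<close>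

lemma galois_D4_root_cycle:
  assumes iso: "galois_group (quartic a b c d) \<cong> D4"
  obtains \<beta>0 \<beta>1 \<beta>2 \<beta>3 where
    "{\<beta>0, \<beta>1, \<beta>2, \<beta>3} \<subseteq> roots_C (quartic a b c d)" "distinct [\<beta>0, \<beta>1, \<beta>2, \<beta>3]"
    "\<And>\<sigma>. \<sigma> \<in> carrier (galois_group (quartic a b c d)) \<Longrightarrow> 
       \<sigma> \<beta>0 * \<sigma> \<beta>2 + \<sigma> \<beta>1 * \<sigma> \<beta>3 = \<beta>0 * \<beta>2 + \<beta>1 * \<beta>3"
proof -
  define f where "f = quartic a b c d"
  let ?G = "galois_group f" and ?K = "splitting_field_C f" and ?R = "roots_C f"
  have f0: "f \<noteq> 0" by (simp add: f_def quartic_nonzero)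
  note closed = galois_compose_closed[OF f0]
  from iso obtain h where h: "h \<in> hom ?G D4" "bij_betw h (carrier ?G) (carrier D4)"
    by (auto simp: is_iso_def iso_def f_def)
  have hc: "h (compose ?K \<sigma> \<tau>) = compose {..<4} (h \<sigma>) (h \<tau>)"
    if "\<sigma> \<in> carrier ?G" "\<tau> \<in> carrier ?G" for \<sigma> \<tau>
    using h(1) that by (auto simp: hom_def galois_group_simps D4_mult)
  have inj: "\<sigma> = \<tau>" if "h \<sigma> = h \<tau>" "\<sigma> \<in> carrier ?G" "\<tau> \<in> carrier ?G" for \<sigma> \<tau>
    using h(2) that by (auto simp: bij_betw_def dest: inj_onD)
  have hD: "h \<sigma> \<in> carrier D4" if "\<sigma> \<in> carrier ?G" for \<sigma>
    using h(2) that by (rule bij_betw_apply)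
  have "D4_map 1 1 \<in> carrier D4" unfolding D4_carrier by (intro exI[of _ 1] conjI) auto
  then obtain r where r: "r \<in> carrier ?G" "h r = D4_map 1 1"
    using h(2) by (metis bij_betw_def imageE)
  define t where "t = compose ?K r r"
  have t: "t \<in> carrier ?G" "h t = D4_map 2 1"
    unfolding t_def using closed[OF r(1) r(1)] hc[OF r(1) r(1)] r(2) by (auto simp only: D4_map_rotations)
  have RK: "z \<in> ?K" if "z \<in> ?R" for z using that roots_C_subset_splitting_field by blast
  have tr: "t z = r (r z)" if "z \<in> ?R" for z using RK[OF that] by (simp add: t_def compose_eq)
  note rR = galois_roots_C[OF r(1)]
  have central: "\<sigma> (t z) = t (\<sigma> z)" if "\<sigma> \<in> carrier ?G" "z \<in> ?R" for \<sigma> z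
  proof -
    have "h (compose ?K \<sigma> t) = h (compose ?K t \<sigma>)"
      using D4_half_turn_central[OF hD[OF that(1)]] hc t that by simp
    then have "compose ?K \<sigma> t = compose ?K t \<sigma>" using inj closed t that by blast
    from fun_cong[OF this, of z] show ?thesis using RK[OF that(2)] by (simp add: compose_eq)
  qed
  \<comment> \<open>The half turn \<open>t\<close> is not the identity. Comparing \<open>t r\<close>
    with \<open>r\<close> shows this inside the group and yields directly a moved root of the form
    \<open>r \<beta>\<close>.\<close>
  have "h (compose ?K t r) = D4_map 3 1"
    using hc[OF t(1) r(1)] t(2) r(2) by (simp only: D4_map_rotations)
  then have "compose ?K t r \<noteq> r" using r(2) D4_map_3_neq_1 by metis
  then obtain \<beta> where \<beta>: "\<beta> \<in> ?R" "compose ?K t r \<beta> \<noteq> r \<beta>"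
    using galois_eqI[OF closed[OF t(1) r(1)] r(1)] by blast
  have "h (compose ?K (compose ?K t t) r) = h r"
    using hc[OF closed[OF t(1) t(1)] r(1)] hc[OF t(1) t(1)] t(2) r(2) by (simp only: D4_map_rotations)
  then have eq: "compose ?K (compose ?K t t) r = r" using inj closed t(1) r(1) by blast
  define \<beta>0 \<beta>1 \<beta>2 \<beta>3 where \<beta>s: "\<beta>0 = r \<beta>" "\<beta>1 = r \<beta>0" "\<beta>2 = r \<beta>1" "\<beta>3 = r \<beta>2"
  have R: "\<beta>0 \<in> ?R" "\<beta>1 \<in> ?R" "\<beta>2 \<in> ?R" "\<beta>3 \<in> ?R" using rR \<beta>(1) by (auto simp: \<beta>s)
  have ne: "\<beta>2 \<noteq> \<beta>0" using \<beta>(2) RK[OF \<beta>(1)] tr[OF R(1)] by (simp add: compose_eq \<beta>s)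
  have cyc: "r \<beta>3 = \<beta>0"
    using fun_cong[OF eq, of \<beta>] RK[OF \<beta>(1)] RK[OF R(1)] tr[OF R(1)] tr[OF R(3)] by (simp add: compose_eq \<beta>s)
  \<comment> \<open>If two of the four coincided, following the cycle would lead to
    \<open>\<beta>2 = \<beta>0\<close>.\<close>
  have d: "distinct [\<beta>0, \<beta>1, \<beta>2, \<beta>3]" using ne cyc \<beta>s by auto
  have tv: "t \<beta>0 = \<beta>2" "t \<beta>1 = \<beta>3" "t \<beta>2 = \<beta>0" "t \<beta>3 = \<beta>1"
    using tr R cyc by (auto simp: \<beta>s)
  have sub: "{\<beta>0, \<beta>1, \<beta>2, \<beta>3} \<subseteq> ?R" using R by auto
  have all: "?R = {\<beta>0, \<beta>1, \<beta>2, \<beta>3}"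
    using quartic_vieta(5)[OF _ d] sub unfolding f_def by blast
  have "\<sigma> \<beta>0 * \<sigma> \<beta>2 + \<sigma> \<beta>1 * \<sigma> \<beta>3 = \<beta>0 * \<beta>2 + \<beta>1 * \<beta>3" if \<sigma>: "\<sigma> \<in> carrier ?G" for \<sigma>
  proof -
    have "inj_on \<sigma> ?K" using \<sigma> by (auto simp: galois_group_simps bij_betw_def)
    then have "\<sigma> \<beta>1 \<noteq> \<sigma> \<beta>0" "\<sigma> \<beta>1 \<noteq> \<sigma> \<beta>2"
      using d RK R by (auto dest: inj_onD)
    \<comment> \<open>The images of the two pairs are again orbits of \<open>t\<close>, and
      different ones, so they are the same two pairs in some order.\<close>
    moreover have "\<sigma> \<beta>2 = t (\<sigma> \<beta>0)" "\<sigma> \<beta>3 = t (\<sigma> \<beta>1)"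
      using central[OF \<sigma>] R tv by metis+
    moreover have "\<sigma> \<beta>0 \<in> {\<beta>0, \<beta>1, \<beta>2, \<beta>3}" "\<sigma> \<beta>1 \<in> {\<beta>0, \<beta>1, \<beta>2, \<beta>3}"
      using galois_roots_C[OF \<sigma>] R all by auto
    ultimately show ?thesis using tv by (elim insertE emptyE) (simp_all add: algebra_simps)
  qed
  then show ?thesis using that sub d unfolding f_def by blast
qed

text \<open>The two factors on the left are the squares of
  \<open>\<beta>0 \<beta>2 - \<beta>1 \<beta>3\<close> and
  \<open>\<beta>0 + \<beta>2 - \<beta>1 - \<beta>3\<close>, and \<open>x a - 2 c\<close> is minus
  the product of these two numbers. Expanded, the equation is four times the cubic resolvent, which
  is monic with integer coefficients; hence the root \<open>x\<close>, rational because all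
  automorphisms fix it, is an integer.\<close>

lemma galois_D4_resolvent_root:
  assumes iso: "galois_group (quartic a b c d) \<cong> D4"
  shows "\<exists>x::int. (x\<^sup>2 - 4 * d) * (a\<^sup>2 - 4 * b + 4 * x) = (x * a - 2 * c)\<^sup>2"
proof -
  let ?f = "quartic a b c d"
  obtain \<beta>0 \<beta>1 \<beta>2 \<beta>3 where
    \<beta>: "{\<beta>0, \<beta>1, \<beta>2, \<beta>3} \<subseteq> roots_C ?f" "distinct [\<beta>0, \<beta>1, \<beta>2, \<beta>3]"
    "\<And>\<sigma>. \<sigma> \<in> carrier (galois_group ?f) \<Longrightarrow> \<sigma> \<beta>0 * \<sigma> \<beta>2 + \<sigma> \<beta>1 * \<sigma> \<beta>3 = \<beta>0 * \<beta>2 + \<beta>1 * \<beta>3"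
    by (rule galois_D4_root_cycle[OF iso]) blast
  define x where "x = \<beta>0 * \<beta>2 + \<beta>1 * \<beta>3"
  note v = quartic_vieta[OF \<beta>(1,2)]
  note K = is_subfield_C_splitting_field[of ?f]
  have RK: "z \<in> splitting_field_C ?f" if "z \<in> {\<beta>0, \<beta>1, \<beta>2, \<beta>3}" for z
    using that \<beta>(1) roots_C_subset_splitting_field by blast
  have id: "(x\<^sup>2 - 4 * of_int d) * ((of_int a)\<^sup>2 - 4 * of_int b + 4 * x) = (x * of_int a - 2 * of_int c)\<^sup>2"
    unfolding x_def v(1-4) by algebra
  define p :: "complex poly" where
    "p = [:of_int (4 * b * d - a\<^sup>2 * d - c\<^sup>2), of_int (a * c - 4 * d), of_int (- b), 1:]"
  have px: "poly p x = 0" using id by (simp add: p_def) algebra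
  have "over \<rat> p" "p \<noteq> 0" by (simp_all add: p_def over_def coeff_pCons split: nat.splits)
  moreover have "\<sigma> x = x" if "\<sigma> \<in> carrier (galois_group ?f)" for \<sigma>
    using \<beta>(3)[OF that] RK by (simp add: x_def field_hom_onD[OF K galois_field_hom[OF that]] subfield_C_closed[OF K])
  moreover have "x \<in> splitting_field_C ?f" using RK by (simp add: x_def subfield_C_closed[OF K])
  ultimately have "x \<in> \<rat>" using galois_fixed_rational[OF quartic_nonzero _ _ _ px] by blast
  moreover have "algebraic_int x"
    by (rule algebraic_int.intros[OF _ _ px]) (auto simp: p_def coeff_pCons split: nat.splits)
  ultimately obtain n where n: "x = of_int n" using rational_algebraic_int_is_int Ints_cases by blast
  have "of_int ((n\<^sup>2 - 4 * d) * (a\<^sup>2 - 4 * b + 4 * n)) = (of_int ((n * a - 2 * c)\<^sup>2) :: complex)"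
    using id n by simp
  then show ?thesis by (intro exI[of _ n]) (simp only: of_int_eq_iff)
qed

section \<open>Quadratic extensions, and criteria for D4 and irreducibility\<close>

lemma minimal_poly_sqrt:
  assumes F: "is_subfield_C F" and e: "e \<notin> F" "e\<^sup>2 \<in> F"
  shows "minimal_poly F e [:- (e\<^sup>2), 0, 1:]"
  unfolding minimal_poly_def
proof (intro conjI allI impI)
  show "over F [:- e\<^sup>2, 0, 1:]" using e(2) F by (simp add: over_0 subfield_C_closed)
  fix p assume p: "over F p" "p \<noteq> 0" "poly p e = 0"
  show "degree [:- e\<^sup>2, 0, 1:] \<le> degree p"
  proof (rule ccontr)
    assume "\<not> ?thesis"
    then have "degree p \<le> 1" by simp
    then have pe: "p = [:coeff p 0, coeff p 1:]"
      by (intro poly_eqI) (auto simp: coeff_pCons coeff_eq_0 split: nat.splits)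
    then have "coeff p 0 + e * coeff p 1 = 0" using p(3)
      by (metis add.right_neutral mult_zero_right poly_0 poly_pCons)
    moreover from this have c1: "coeff p 1 \<noteq> 0" using p(2) pe by auto
    ultimately have "e = - coeff p 0 / coeff p 1"
      by (simp add: field_simps eq_neg_iff_add_eq_0 add.commute)
    then show False using e(1) p(1) F by (auto simp: over_def subfield_C_closed)
  qed
qed (simp_all add: power2_eq_square)

lemma adjoin_sqrt:
  assumes F: "is_subfield_C F" and e: "e\<^sup>2 \<in> F" and t: "t \<in> adjoin F e"
  shows "\<exists>y\<in>F. \<exists>z\<in>F. t = y + z * e"
proof -
  from t obtain p where "over F p" "t = poly p e" by (auto simp: adjoin_def)
  then show ?thesis
  proof (induction p arbitrary: t)
    case 0
    then show ?case using subfield_C_closed(1)[OF F] by (intro bexI[of _ 0]) auto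
  next
    case (pCons c p)
    then obtain y z where yz: "y \<in> F" "z \<in> F" "poly p e = y + z * e" by (metis over_pCons)
    then have "t = (c + z * e\<^sup>2) + y * e" using pCons by (simp add: algebra_simps power2_eq_square)
    moreover have "c + z * e\<^sup>2 \<in> F" using pCons yz e by (simp add: subfield_C_closed[OF F])
    ultimately show ?case using yz by auto
  qed
qed

lemma field_hom_extend_sqrt:
  assumes F: "is_subfield_C F" and \<sigma>: "field_hom_on F \<sigma>" and e: "e \<notin> F" "e\<^sup>2 \<in> F" and g: "g\<^sup>2 = \<sigma> (e\<^sup>2)"
  shows "\<exists>\<sigma>'. field_hom_on (adjoin F e) \<sigma>' \<and> (\<forall>x\<in>F. \<sigma>' x = \<sigma> x) \<and> \<sigma>' e = g"
  using field_hom_extend[OF F \<sigma> minimal_poly_sqrt[OF F e], of g] e g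
  by (simp add: map_poly_pCons field_hom_onD[OF F \<sigma>] power2_eq_square)

lemma is_subfield_C_adjoin_sqrt:
  "is_subfield_C F \<Longrightarrow> e \<notin> F \<Longrightarrow> e\<^sup>2 \<in> F \<Longrightarrow> is_subfield_C (adjoin F e)"
  using is_subfield_C_adjoin minimal_poly_sqrt by blast

lemma D4_map_less: "i < 4 \<Longrightarrow> D4_map a s i < 4"
  by (simp add: D4_map_def)

text \<open>Numbering the roots turns automorphisms into permutations of indices. \<open>sub\<close>
  and \<open>sup\<close> say that exactly the symmetries of the square occur, and an automorphism is
  determined by its values on the roots.\<close>

lemma galois_iso_D4:
  assumes f: "f \<noteq> 0" and \<alpha>: "inj_on \<alpha> {..<4::nat}" "roots_C f = \<alpha> ` {..<4}"
    and sub: "\<And>\<sigma>. \<sigma> \<in> carrier (galois_group f) \<Longrightarrow> \<exists>g\<in>carrier D4. \<forall>i<4. \<sigma> (\<alpha> i) = \<alpha> (g i)"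
    and sup: "\<And>g. g \<in> carrier D4 \<Longrightarrow> \<exists>\<sigma>\<in>carrier (galois_group f). \<forall>i<4. \<sigma> (\<alpha> i) = \<alpha> (g i)"
  shows "galois_group f \<cong> D4"
proof -
  let ?G = "galois_group f" and ?K = "splitting_field_C f"
  \<comment> \<open>The restriction gives the permutation the same default values outside
    \<open>{..<4}\<close> as the elements of \<open>D4\<close> have.\<close>
  define \<Phi> where "\<Phi> \<sigma> = restrict (\<lambda>i. inv_into {..<4} \<alpha> (\<sigma> (\<alpha> i))) {..<4}" for \<sigma>
  have \<Phi>: "\<Phi> \<sigma> = g" if g: "g \<in> carrier D4" "\<forall>i<4. \<sigma> (\<alpha> i) = \<alpha> (g i)" for \<sigma> g
  proof -
    obtain a s where "g = D4_map a s" using g(1) D4_carrier by blast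
    then have "g i < 4" if "i < 4" for i using D4_map_less that by simp
    then have "\<Phi> \<sigma> i = g i" if "i < 4" for i
      using g(2) that \<alpha>(1) by (simp add: \<Phi>_def inv_into_f_f)
    moreover have "\<Phi> \<sigma> i = g i" if "\<not> i < 4" for i
      using that \<open>g = _\<close> by (simp add: \<Phi>_def D4_map_def)
    ultimately show ?thesis by blast
  qed
  have in_K: "\<alpha> i \<in> ?K" if "i < 4" for i
    using \<alpha>(2) that roots_C_subset_splitting_field by blast
  have "\<Phi> \<in> hom ?G D4"
    unfolding hom_def
  proof (intro CollectI conjI funcsetI ballI)
    show "\<Phi> \<sigma> \<in> carrier D4" if "\<sigma> \<in> carrier ?G" for \<sigma> using sub[OF that] \<Phi> by metis
    fix \<sigma> \<tau> assume *: "\<sigma> \<in> carrier ?G" "\<tau> \<in> carrier ?G"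
    obtain g where g: "g \<in> carrier D4" "\<forall>i<4. \<sigma> (\<alpha> i) = \<alpha> (g i)" using sub[OF *(1)] by blast
    obtain h where h: "h \<in> carrier D4" "\<forall>i<4. \<tau> (\<alpha> i) = \<alpha> (h i)" using sub[OF *(2)] by blast
    obtain a s b t where gh: "g = D4_map a s" "h = D4_map b t" "s = 1 \<or> s = 3" "t = 1 \<or> t = 3"
      using g(1) h(1) D4_carrier by blast
    have "(s * t) mod 4 = 1 \<or> (s * t) mod 4 = 3" using gh(3,4) by auto
    then have "compose {..<4} g h \<in> carrier D4"
      unfolding gh(1,2) D4_map_compose D4_carrier by (intro exI conjI) auto
    moreover have "\<forall>i<4. compose ?K \<sigma> \<tau> (\<alpha> i) = \<alpha> (compose {..<4} g h i)"
      using g(2) h(2) in_K gh D4_map_less by (simp add: compose_eq)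
    ultimately have "\<Phi> (compose ?K \<sigma> \<tau>) = compose {..<4} g h" by (rule \<Phi>)
    then show "\<Phi> (monoid.mult ?G \<sigma> \<tau>) = monoid.mult D4 (\<Phi> \<sigma>) (\<Phi> \<tau>)"
      using \<Phi>[OF g] \<Phi>[OF h] by (simp add: galois_group_simps D4_mult)
  qed
  moreover have "bij_betw \<Phi> (carrier ?G) (carrier D4)"
    unfolding bij_betw_def
  proof
    show "inj_on \<Phi> (carrier ?G)"
    proof (rule inj_onI)
      fix \<sigma> \<tau> assume *: "\<sigma> \<in> carrier ?G" "\<tau> \<in> carrier ?G" "\<Phi> \<sigma> = \<Phi> \<tau>"
      then obtain g where "\<forall>i<4. \<sigma> (\<alpha> i) = \<alpha> (g i)" "\<forall>i<4. \<tau> (\<alpha> i) = \<alpha> (g i)"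
        using sub \<Phi> by metis
      then show "\<sigma> = \<tau>" using \<alpha>(2) by (intro galois_eqI[OF *(1,2)]) auto
    qed
    show "\<Phi> ` carrier ?G = carrier D4"
    proof (intro equalityI subsetI)
      fix g assume "g \<in> \<Phi> ` carrier ?G"
      then show "g \<in> carrier D4" using sub \<Phi> by (metis imageE)
    next
      fix g assume g: "g \<in> carrier D4"
      then obtain \<sigma> where "\<sigma> \<in> carrier ?G" "\<forall>i<4. \<sigma> (\<alpha> i) = \<alpha> (g i)" using sup by blast
      then show "g \<in> \<Phi> ` carrier ?G" using \<Phi>[OF g] by (metis imageI)
    qed
  qed
  ultimately show ?thesis by (auto simp: is_iso_def iso_def)
qed

text \<open>A factor \<open>g\<close> of positive degree shares a complex root with
  \<open>f\<close>. Automorphisms fix its rational coefficients, so by transitivity every root of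
  \<open>f\<close> is a root of \<open>g\<close>; as \<open>f\<close> has \<open>degree f\<close>
  distinct roots, the cofactor is constant.\<close>

lemma irreducible_transitive:
  assumes f: "f \<noteq> 0" "degree f \<ge> 1" "card (roots_C f) = degree f"
    and trans: "\<And>y z. y \<in> roots_C f \<Longrightarrow> z \<in> roots_C f \<Longrightarrow> \<exists>\<sigma>\<in>carrier (galois_group f). \<sigma> y = z"
  shows "irreducible (map_poly (of_int :: int \<Rightarrow> rat) f)"
proof (rule irreducibleI)
  let ?f = "map_poly (of_int :: int \<Rightarrow> rat) f"
  have df: "degree ?f = degree f" by (rule degree_map_poly) simp
  show "?f \<noteq> 0" using f(1) by (rule of_int_poly_nonzero)
  then show "\<not> is_unit ?f" using f(2) df by (simp add: is_unit_iff_degree)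
  fix g h assume gh: "?f = g * h"
  have nz: "g \<noteq> 0" "h \<noteq> 0" using gh \<open>?f \<noteq> 0\<close> by auto
  have dsum: "degree g + degree h = degree f"
    using gh df nz by (metis degree_mult_eq)
  define c where "c = (map_poly of_rat :: rat poly \<Rightarrow> complex poly)"
  have "c ?f = map_poly of_int f" by (intro poly_eqI) (simp add: c_def coeff_map_poly)
  moreover have "c (g * h) = c g * c h"
    by (intro poly_eqI) (simp add: c_def coeff_map_poly coeff_mult of_rat_sum of_rat_mult)
  ultimately have cf: "map_poly of_int f = c g * c h" using gh by simp
  have dg: "degree (c g) = degree g" unfolding c_def by (rule degree_map_poly) simp
  have "is_unit h" if d: "degree g \<noteq> 0"
  proof -
    have "\<exists>z. poly (c g) z = 0" using d dg by (intro fundamental_theorem_of_algebra_alt) auto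
    then obtain z where z: "poly (c g) z = 0" by blast
    then have zR: "z \<in> roots_C f" by (simp add: roots_C_def cf)
    have "poly (c g) y = 0" if y: "y \<in> roots_C f" for y
    proof -
      obtain \<sigma> where \<sigma>: "\<sigma> \<in> carrier (galois_group f)" "\<sigma> z = y" using trans[OF zR y] by blast
      note hom = is_subfield_C_splitting_field[of f] galois_field_hom[OF \<sigma>(1)]
      have rat: "of_rat q \<in> splitting_field_C f" for q
        using Rats_subset_subfield_C[OF hom(1)] by auto
      have "over (splitting_field_C f) (c g)" by (simp add: over_def c_def coeff_map_poly rat)
      moreover have "map_poly \<sigma> (c g) = c g"
        by (intro poly_eqI) (simp add: c_def coeff_map_poly field_hom_onD[OF hom] field_hom_on_Rats[OF hom])
      ultimately show ?thesis
        using poly_map_poly_hom[OF hom, of "c g" z] z zR roots_C_subset_splitting_field \<sigma>(2)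
        by (auto simp: field_hom_onD[OF hom])
    qed
    moreover have "c g \<noteq> 0" using d dg by auto
    ultimately have "degree f \<le> degree (c g)"
      using card_poly_roots_bound[of "c g"] card_mono[OF poly_roots_finite[of "c g"], of "roots_C f"] f(3)
      by (metis (mono_tags, lifting) le_trans mem_Collect_eq subsetI)
    then show ?thesis using dsum dg nz by (simp add: is_unit_iff_degree)
  qed
  then show "is_unit g \<or> is_unit h"
    by (cases "degree g = 0") (simp_all add: is_unit_iff_degree nz)
qed

section \<open>Norms of quadratic polynomials\<close>

text \<open>The quartic is the norm of \<open>X\<^sup>2 + (a + w s) X + (x + v s)\<close> from \<open>\<rat>(s)\<close>, and \<open>nd\<close> is the norm
  of the discriminant of this quadratic factor.\<close>

lemma lessThan_four: "{..<4::nat} = {0, 1, 2, 3}"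
  by auto

lemma D4_map_values:
  "D4_map b k 0 = b mod 4" "D4_map b k 1 = (b + k) mod 4"
  "D4_map b k 2 = (b + k * 2) mod 4" "D4_map b k 3 = (b + k * 3) mod 4"
  by (simp_all add: D4_map_def)

lemma less_four_cases: "(i::nat) < 4 \<Longrightarrow> i = 0 \<or> i = 1 \<or> i = 2 \<or> i = 3"
  by auto

lemma quadratic_formula:
  fixes p q e :: complex
  assumes "e\<^sup>2 = p\<^sup>2 - 4 * q"
  shows "((- p + e) / 2)\<^sup>2 + p * ((- p + e) / 2) + q = 0" "((- p - e) / 2)\<^sup>2 + p * ((- p - e) / 2) + q = 0"
proof -
  have "((- p + e) / 2)\<^sup>2 + p * ((- p + e) / 2) + q = (e\<^sup>2 - (p\<^sup>2 - 4 * q)) / 4"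
    "((- p - e) / 2)\<^sup>2 + p * ((- p - e) / 2) + q = (e\<^sup>2 - (p\<^sup>2 - 4 * q)) / 4"
    by (simp_all add: field_simps power2_eq_square)
  with assms show "((- p + e) / 2)\<^sup>2 + p * ((- p + e) / 2) + q = 0" "((- p - e) / 2)\<^sup>2 + p * ((- p - e) / 2) + q = 0"
    by simp_all
qed

text \<open>\<open>e1\<close> and \<open>e2\<close> are square roots of the discriminants of the
  factor and its conjugate, so \<open>(e1 e2)^2 = nd\<close>. Together the two conditions
  \<open>nonsquare\<close> say that \<open>nd\<close> is no square in \<open>\<rat>(s)\<close>,
  which keeps \<open>e1\<close> and \<open>e2\<close> independent over that field. A nonzero
  \<open>w\<close> lets \<open>s\<close> be recovered from the roots.\<close>

locale quadratic_norm =
  fixes a w x v u nd :: int and s e1 e2 :: complex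
  assumes w: "w \<noteq> 0"
    and nd: "nd = (a\<^sup>2 + u * w\<^sup>2 - 4 * x)\<^sup>2 - u * (2 * a * w - 4 * v)\<^sup>2"
    and s: "s\<^sup>2 = of_int u" "s \<notin> \<rat>"
    and e1: "e1\<^sup>2 = (of_int a + of_int w * s)\<^sup>2 - 4 * (of_int x + of_int v * s)"
    and e2: "e2\<^sup>2 = (of_int a - of_int w * s)\<^sup>2 - 4 * (of_int x - of_int v * s)"
    and nonsquare: "\<And>r. r \<in> \<rat> \<Longrightarrow> r\<^sup>2 \<noteq> (of_int nd :: complex)"
      "\<And>r. r \<in> \<rat> \<Longrightarrow> r\<^sup>2 \<noteq> (of_int (u * nd) :: complex)"
begin

definition f :: "int poly" where
  "f = quartic (2 * a) (2 * x + a\<^sup>2 - u * w\<^sup>2) (2 * (a * x - u * v * w)) (x\<^sup>2 - u * v\<^sup>2)"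

text \<open>Indices of equal parity belong to the same quadratic factor, so the two roots of a
  factor are opposite vertices of the square.\<close>

definition \<alpha> :: "nat \<Rightarrow> complex" where
  "\<alpha> i = [(- (of_int a + of_int w * s) + e1) / 2, (- (of_int a - of_int w * s) + e2) / 2,
          (- (of_int a + of_int w * s) - e1) / 2, (- (of_int a - of_int w * s) - e2) / 2] ! i"

lemma \<alpha>_simps:
  "\<alpha> 0 = (- (of_int a + of_int w * s) + e1) / 2"
  "\<alpha> 1 = (- (of_int a - of_int w * s) + e2) / 2"
  "\<alpha> 2 = (- (of_int a + of_int w * s) - e1) / 2"
  "\<alpha> 3 = (- (of_int a - of_int w * s) - e2) / 2"
  by (simp_all add: \<alpha>_def numeral_eq_Suc)

lemma e1_e2: "(e1 * e2)\<^sup>2 = of_int nd"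
  unfolding power_mult_distrib e1 e2 nd of_int_diff of_int_mult of_int_power of_int_add of_int_numeral
    s(1)[symmetric]
  by algebra

section \<open>The tower of three quadratic extensions\<close>

definition F1 where "F1 = adjoin \<rat> s"
definition F2 where "F2 = adjoin F1 e1"
definition F3 where "F3 = adjoin F2 e2"

lemma s2_rat: "s\<^sup>2 \<in> \<rat>" by (simp add: s)

lemma F1: "is_subfield_C F1" "s \<in> F1" "\<rat> \<subseteq> F1"
  using is_subfield_C_adjoin_sqrt[OF is_subfield_C_Rats s(2) s2_rat] subset_adjoin[OF is_subfield_C_Rats]
  by (auto simp: F1_def)

lemma F1_cases: "t \<in> F1 \<Longrightarrow> \<exists>y\<in>\<rat>. \<exists>z\<in>\<rat>. t = y + z * s"
  using adjoin_sqrt[OF is_subfield_C_Rats s2_rat] by (simp add: F1_def)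

lemma conjugation:
  assumes "\<sigma>s = s \<or> \<sigma>s = - s"
  obtains \<sigma> where "field_hom_on F1 \<sigma>" "\<sigma> s = \<sigma>s"
proof -
  have "field_hom_on \<rat> id" by (simp add: field_hom_on_def)
  moreover have "\<sigma>s\<^sup>2 = id (s\<^sup>2)" using assms by auto
  ultimately obtain \<sigma> where "field_hom_on (adjoin \<rat> s) \<sigma>" "\<sigma> s = \<sigma>s"
    using field_hom_extend_sqrt[OF is_subfield_C_Rats _ s(2) s2_rat] by blast
  then show ?thesis using that by (simp add: F1_def)
qed

lemma F1_rat: "of_int n \<in> F1" "numeral k \<in> F1"
  using subfield_C_of_int[OF F1(1)] subfield_C_numeral[OF F1(1)] by auto

lemma e_squares_in_F1: "e1\<^sup>2 \<in> F1" "e2\<^sup>2 \<in> F1"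
  unfolding e1 e2 by (intro subfield_C_closed[OF F1(1)] F1 F1_rat)+

lemma hom_e_squares:
  assumes "is_subfield_C F" "field_hom_on F \<sigma>" "s \<in> F"
  shows "\<sigma> s = s \<Longrightarrow> \<sigma> (e1\<^sup>2) = e1\<^sup>2" "\<sigma> s = s \<Longrightarrow> \<sigma> (e2\<^sup>2) = e2\<^sup>2"
    "\<sigma> s = - s \<Longrightarrow> \<sigma> (e1\<^sup>2) = e2\<^sup>2" "\<sigma> s = - s \<Longrightarrow> \<sigma> (e2\<^sup>2) = e1\<^sup>2"
proof -
  have num: "\<sigma> (numeral n) = numeral n" for n
    using field_hom_on_of_int[OF assms(1,2), of "numeral n"] by simp
  note F = subfield_C_closed[OF assms(1)] subfield_C_of_int[OF assms(1)] subfield_C_numeral[OF assms(1)]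
  note h = field_hom_onD[OF assms(1,2)] field_hom_on_of_int[OF assms(1,2)] field_hom_on_power[OF assms(1,2)] num
  have "\<sigma> (e1\<^sup>2) = (of_int a + of_int w * \<sigma> s)\<^sup>2 - 4 * (of_int x + of_int v * \<sigma> s)"
    "\<sigma> (e2\<^sup>2) = (of_int a - of_int w * \<sigma> s)\<^sup>2 - 4 * (of_int x - of_int v * \<sigma> s)"
    unfolding e1 e2 by (simp_all add: h F assms(3))
  then show "\<sigma> s = s \<Longrightarrow> \<sigma> (e1\<^sup>2) = e1\<^sup>2" "\<sigma> s = s \<Longrightarrow> \<sigma> (e2\<^sup>2) = e2\<^sup>2"
    "\<sigma> s = - s \<Longrightarrow> \<sigma> (e1\<^sup>2) = e2\<^sup>2" "\<sigma> s = - s \<Longrightarrow> \<sigma> (e2\<^sup>2) = e1\<^sup>2"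
    unfolding e1 e2 by simp_all
qed

text \<open>\<open>t * \<sigma> t\<close> is the norm of \<open>t\<close> from
  \<open>\<rat>(s)\<close>, hence rational, while \<open>nd\<close> is no rational square.\<close>

lemma F1_norm_square:
  assumes t: "t \<in> F1" and \<sigma>: "field_hom_on F1 \<sigma>" "\<sigma> s = - s" and eq: "(t * \<sigma> t)\<^sup>2 = of_int nd"
  shows False
proof -
  obtain y z where yz: "y \<in> \<rat>" "z \<in> \<rat>" "t = y + z * s" using F1_cases[OF t] by blast
  have \<sigma>t: "\<sigma> t = y - z * s"
    using yz F1 \<sigma> by (simp add: field_hom_onD[OF F1(1) \<sigma>(1)] field_hom_on_Rats[OF F1(1) \<sigma>(1)]
        subfield_C_closed[OF F1(1)] subset_iff)
  have "t * \<sigma> t = (y + z * s) * (y - z * s)" by (simp only: \<sigma>t) (simp only: yz(3))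
  also have "\<dots> = y\<^sup>2 - z\<^sup>2 * of_int u" unfolding s(1)[symmetric] by algebra
  finally have "t * \<sigma> t = y\<^sup>2 - z\<^sup>2 * of_int u" .
  then have "t * \<sigma> t \<in> \<rat>" using yz by simp
  then show False using nonsquare(1) eq by blast
qed

text \<open>For the first two, take norms: \<open>e1^2\<close> and \<open>e2^2\<close> are conjugate
  with product \<open>nd\<close>. For the third, squaring \<open>t = y + z s\<close> forces
  \<open>y z = 0\<close> because \<open>s\<close> is irrational; then \<open>nd\<close> is
  \<open>y^2\<close> or \<open>z^2 u\<close>, and in the latter case
  \<open>u nd = (z u)^2\<close>.\<close>

lemma nonsquare_F1:
  assumes t: "t \<in> F1"
  shows "t\<^sup>2 \<noteq> e1\<^sup>2" "t\<^sup>2 \<noteq> e2\<^sup>2" "t\<^sup>2 \<noteq> of_int nd"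
proof -
  obtain \<sigma> where \<sigma>: "field_hom_on F1 \<sigma>" "\<sigma> s = - s" using conjugation[of "-s"] by auto
  have sq: "(t * \<sigma> t)\<^sup>2 = t\<^sup>2 * \<sigma> (t\<^sup>2)"
    using field_hom_on_power[OF F1(1) \<sigma>(1) t, of 2] by (simp add: power_mult_distrib)
  note h = hom_e_squares(3,4)[OF F1(1) \<sigma>(1) F1(2) \<sigma>(2)]
  show "t\<^sup>2 \<noteq> e1\<^sup>2"
  proof
    assume "t\<^sup>2 = e1\<^sup>2"
    then have "(t * \<sigma> t)\<^sup>2 = (e1 * e2)\<^sup>2" using sq h by (simp add: power_mult_distrib)
    then show False using F1_norm_square[OF t \<sigma>] e1_e2 by simp
  qed
  show "t\<^sup>2 \<noteq> e2\<^sup>2"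
  proof
    assume "t\<^sup>2 = e2\<^sup>2"
    then have "(t * \<sigma> t)\<^sup>2 = (e1 * e2)\<^sup>2" using sq h by (simp add: power_mult_distrib mult.commute)
    then show False using F1_norm_square[OF t \<sigma>] e1_e2 by simp
  qed
  show "t\<^sup>2 \<noteq> of_int nd"
  proof
    assume eq: "t\<^sup>2 = of_int nd"
    obtain y z where yz: "y \<in> \<rat>" "z \<in> \<rat>" "t = y + z * s" using F1_cases[OF t] by blast
    have "2 * y * z * s = of_int nd - y\<^sup>2 - z\<^sup>2 * of_int u"
      unfolding eq[symmetric] yz(3) s(1)[symmetric] by algebra
    then have rat: "2 * y * z * s \<in> \<rat>" using yz by simp
    have "2 * y * z = 0"
    proof (rule ccontr)
      assume nz: "2 * y * z \<noteq> 0"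
      then have "s = 2 * y * z * s / (2 * y * z)" by simp
      moreover have "2 * y * z * s / (2 * y * z) \<in> \<rat>" using rat yz by (intro Rats_divide) auto
      ultimately show False using s(2) by metis
    qed
    then consider "y = 0" | "z = 0" by auto
    then show False
    proof cases
      case 1
      have "(z * of_int u)\<^sup>2 = of_int u * (z * s)\<^sup>2" unfolding s(1)[symmetric] by algebra
      also have "\<dots> = of_int (u * nd)" using eq yz(3) 1 by simp
      finally show ?thesis using nonsquare(2)[of "z * of_int u"] yz by simp
    next
      case 2
      then show ?thesis using nonsquare(1)[OF yz(1)] eq yz(3) by simp
    qed
  qed
qed

lemma e_notin_F1: "e1 \<notin> F1" "e2 \<notin> F1" "e1 * e2 \<notin> F1"
  using nonsquare_F1 e1_e2 by blast+

lemma F2: "is_subfield_C F2" "F1 \<subseteq> F2" "e1 \<in> F2"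
  using is_subfield_C_adjoin_sqrt[OF F1(1) e_notin_F1(1) e_squares_in_F1(1)] subset_adjoin[OF F1(1)]
  by (auto simp: F2_def)

text \<open>Squaring \<open>e2 = y + z e1\<close> forces \<open>y z = 0\<close> because
  \<open>e1\<close> is not in \<open>F1\<close>. Then \<open>z = 0\<close> puts \<open>e2\<close>
  into \<open>F1\<close>, and \<open>y = 0\<close> puts \<open>e1 e2\<close> into
  \<open>F1\<close>.\<close>

lemma e2_notin_F2: "e2 \<notin> F2"
proof
  assume "e2 \<in> F2"
  then obtain y z where yz: "y \<in> F1" "z \<in> F1" "e2 = y + z * e1"
    using adjoin_sqrt[OF F1(1) e_squares_in_F1(1)] unfolding F2_def by blast
  note F = subfield_C_closed[OF F1(1)]
  have eq: "2 * y * z * e1 = e2\<^sup>2 - y\<^sup>2 - z\<^sup>2 * e1\<^sup>2"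
    unfolding yz(3) by algebra
  have rat: "2 * y * z * e1 \<in> F1" unfolding eq by (intro F yz e_squares_in_F1)
  have "2 * y * z = 0"
  proof (rule ccontr)
    assume nz: "2 * y * z \<noteq> 0"
    then have "e1 = 2 * y * z * e1 / (2 * y * z)" by simp
    moreover have "2 * y * z * e1 / (2 * y * z) \<in> F1" by (intro F(8) rat F(5) yz F1_rat)
    ultimately show False using e_notin_F1(1) by metis
  qed
  then consider "y = 0" | "z = 0" by auto
  then show False
  proof cases
    case 1
    then have "e1 * e2 = z * e1\<^sup>2" using yz(3) by (simp add: power2_eq_square)
    then show ?thesis using e_notin_F1(3) F(5)[OF yz(2) e_squares_in_F1(1)] by simp
  next
    case 2
    then show ?thesis using yz e_notin_F1(2) by simp
  qed
qed

lemma F3: "is_subfield_C F3" "F1 \<subseteq> F3" "F2 \<subseteq> F3" "e1 \<in> F3" "e2 \<in> F3"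
proof -
  have "e2\<^sup>2 \<in> F2" using e_squares_in_F1 F2 by auto
  then show "is_subfield_C F3" "F1 \<subseteq> F3" "F2 \<subseteq> F3" "e1 \<in> F3" "e2 \<in> F3"
    using is_subfield_C_adjoin_sqrt[OF F2(1) e2_notin_F2] subset_adjoin[OF F2(1), of e2] F2
    by (auto simp: F3_def)
qed

text \<open>The square roots \<open>e1\<close> and \<open>e2\<close> are adjoined one at a time,
  with a free sign for each image. Together with the two choices for the image of \<open>s\<close>
  this gives eight homomorphisms.\<close>

lemma hom_F3_exists:
  assumes \<sigma>: "field_hom_on F1 \<sigma>" and g: "g1\<^sup>2 = \<sigma> (e1\<^sup>2)" "g2\<^sup>2 = \<sigma> (e2\<^sup>2)"
  obtains \<tau> where "field_hom_on F3 \<tau>" "\<tau> s = \<sigma> s" "\<tau> e1 = g1" "\<tau> e2 = g2"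
proof -
  obtain \<sigma>' where 1: "field_hom_on F2 \<sigma>'" "\<forall>x\<in>F1. \<sigma>' x = \<sigma> x" "\<sigma>' e1 = g1"
    using field_hom_extend_sqrt[OF F1(1) \<sigma> e_notin_F1(1) e_squares_in_F1(1) g(1)] by (auto simp: F2_def)
  have "e2\<^sup>2 \<in> F2" using e_squares_in_F1 F2 by auto
  moreover have "g2\<^sup>2 = \<sigma>' (e2\<^sup>2)" using g(2) 1(2) e_squares_in_F1 by simp
  ultimately obtain \<tau> where "field_hom_on F3 \<tau>" "\<forall>x\<in>F2. \<tau> x = \<sigma>' x" "\<tau> e2 = g2"
    using field_hom_extend_sqrt[OF F2(1) 1(1) e2_notin_F2] by (auto simp: F3_def)
  then show ?thesis using that 1 F1(2) F2 by (metis subsetD)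
qed

lemma \<alpha>_in_F3: "i < 4 \<Longrightarrow> \<alpha> i \<in> F3"
proof -
  note F = subfield_C_closed[OF F3(1)] subfield_C_of_int[OF F3(1)] subfield_C_numeral[OF F3(1)]
  have sF: "s \<in> F3" using F1 F3 by auto
  have "\<alpha> 0 \<in> F3" "\<alpha> 1 \<in> F3" "\<alpha> 2 \<in> F3" "\<alpha> 3 \<in> F3"
    unfolding \<alpha>_simps by (intro F F3 sF)+
  then show "i < 4 \<Longrightarrow> \<alpha> i \<in> F3"
    using less_four_cases by metis
qed

text \<open>\<open>F2\<close> separates the two factors: it contains \<open>\<alpha> 0\<close> and
  \<open>\<alpha> 2\<close>, and solving for \<open>e2\<close> shows that it contains neither
  \<open>\<alpha> 1\<close> nor \<open>\<alpha> 3\<close>.\<close>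

lemma \<alpha>_distinct: "distinct [\<alpha> 0, \<alpha> 1, \<alpha> 2, \<alpha> 3]"
proof -
  note F = subfield_C_closed[OF F2(1)] subfield_C_of_int[OF F2(1)] subfield_C_numeral[OF F2(1)]
  have ws: "s \<in> F2" using F1 F2 by auto
  have e0: "e1 \<noteq> 0" "e2 \<noteq> 0" using e_notin_F1 subfield_C_closed(1)[OF F1(1)] by metis+
  have "\<alpha> 0 \<in> F2" "\<alpha> 2 \<in> F2" unfolding \<alpha>_simps by (intro F F2(3) ws)+
  moreover have "\<alpha> 1 \<notin> F2"
  proof
    assume *: "\<alpha> 1 \<in> F2"
    have "e2 = 2 * \<alpha> 1 + (of_int a - of_int w * s)" unfolding \<alpha>_simps by (simp add: field_simps)
    moreover have "\<dots> \<in> F2" by (intro F ws *)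
    ultimately show False using e2_notin_F2 by simp
  qed
  moreover have "\<alpha> 3 \<notin> F2"
  proof
    assume *: "\<alpha> 3 \<in> F2"
    have "e2 = - (2 * \<alpha> 3 + (of_int a - of_int w * s))" unfolding \<alpha>_simps by (simp add: field_simps)
    moreover have "\<dots> \<in> F2" by (intro F ws *)
    ultimately show False using e2_notin_F2 by simp
  qed
  moreover have "\<alpha> 0 \<noteq> \<alpha> 2" "\<alpha> 1 \<noteq> \<alpha> 3" unfolding \<alpha>_simps using e0 by (simp_all add: field_simps)
  ultimately show ?thesis unfolding distinct.simps list.set insert_iff empty_iff by metis
qed

lemma \<alpha>_roots: "{\<alpha> 0, \<alpha> 1, \<alpha> 2, \<alpha> 3} \<subseteq> roots_C f"
proof -
  have 1: "z \<in> roots_C f"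
    if "z\<^sup>2 + (of_int a + of_int w * s) * z + (of_int x + of_int v * s) = 0 \<or>
        z\<^sup>2 + (of_int a - of_int w * s) * z + (of_int x - of_int v * s) = 0" for z
  proof -
    have "z ^ 4 + of_int (2 * a) * z ^ 3 + of_int (2 * x + a\<^sup>2 - u * w\<^sup>2) * z ^ 2 +
        of_int (2 * (a * x - u * v * w)) * z + of_int (x\<^sup>2 - u * v\<^sup>2) =
      (z\<^sup>2 + (of_int a + of_int w * s) * z + (of_int x + of_int v * s)) *
      (z\<^sup>2 + (of_int a - of_int w * s) * z + (of_int x - of_int v * s))"
      unfolding of_int_diff of_int_mult of_int_power of_int_add of_int_numeral s(1)[symmetric] by algebra
    then show ?thesis using that unfolding f_def roots_C_quartic by auto
  qed
  note quadratic_formula[OF e1] quadratic_formula[OF e2]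
  then show ?thesis unfolding insert_subset \<alpha>_simps using 1 by blast
qed

lemma roots_C_f: "roots_C f = \<alpha> ` {..<4}"
  using quartic_vieta(5)[OF \<alpha>_roots[unfolded f_def] \<alpha>_distinct] unfolding f_def lessThan_four by simp

lemma card_roots_C_f: "card (roots_C f) = 4"
proof -
  have "roots_C f = set [\<alpha> 0, \<alpha> 1, \<alpha> 2, \<alpha> 3]" unfolding roots_C_f lessThan_four by simp
  then show ?thesis using distinct_card[OF \<alpha>_distinct] by simp
qed

lemma \<alpha>_inj: "inj_on \<alpha> {..<4}"
  using card_roots_C_f unfolding roots_C_f by (intro eq_card_imp_inj_on) auto

lemma f_nonzero: "f \<noteq> 0"
  by (simp add: f_def quartic_nonzero)

lemma degree_f: "degree f = 4"
  by (simp add: f_def quartic_def)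

text \<open>An automorphism is described by the triple of images of \<open>s\<close>, \<open>e1\<close> and \<open>e2\<close>.\<close>

definition compatible :: "complex \<Rightarrow> complex \<Rightarrow> complex \<Rightarrow> bool" where
  "compatible t g1 g2 \<longleftrightarrow> t = s \<and> g1\<^sup>2 = e1\<^sup>2 \<and> g2\<^sup>2 = e2\<^sup>2 \<or> t = - s \<and> g1\<^sup>2 = e2\<^sup>2 \<and> g2\<^sup>2 = e1\<^sup>2"

text \<open>The right-hand sides are the formulas for the four roots with \<open>s\<close>,
  \<open>e1\<close>, \<open>e2\<close> replaced by their images, so \<open>g\<close> is the induced
  permutation of the vertices.\<close>

definition moves :: "(nat \<Rightarrow> nat) \<Rightarrow> complex \<Rightarrow> complex \<Rightarrow> complex \<Rightarrow> bool" where
  "moves g t g1 g2 \<longleftrightarrow>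
     \<alpha> (g 0) = (- (of_int a + of_int w * t) + g1) / 2 \<and> \<alpha> (g 1) = (- (of_int a - of_int w * t) + g2) / 2 \<and>
     \<alpha> (g 2) = (- (of_int a + of_int w * t) - g1) / 2 \<and> \<alpha> (g 3) = (- (of_int a - of_int w * t) - g2) / 2"

lemma hom_\<alpha>:
  assumes L: "is_subfield_C L" and \<tau>: "field_hom_on L \<tau>" and "s \<in> L" "e1 \<in> L" "e2 \<in> L"
    and m: "moves g (\<tau> s) (\<tau> e1) (\<tau> e2)"
  shows "\<forall>i<4. \<tau> (\<alpha> i) = \<alpha> (g i)"
proof -
  note F = subfield_C_closed[OF L] subfield_C_of_int[OF L] subfield_C_numeral[OF L]
  have num: "\<tau> 2 = 2" using field_hom_on_of_int[OF L \<tau>, of 2] by simp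
  note h = field_hom_onD[OF L \<tau>] field_hom_on_of_int[OF L \<tau>] num
  have "\<tau> (\<alpha> 0) = \<alpha> (g 0)" "\<tau> (\<alpha> 1) = \<alpha> (g 1)" "\<tau> (\<alpha> 2) = \<alpha> (g 2)" "\<tau> (\<alpha> 3) = \<alpha> (g 3)"
    unfolding conjunct1[OF m[unfolded moves_def]] conjunct1[OF conjunct2[OF m[unfolded moves_def]]]
      conjunct1[OF conjunct2[OF conjunct2[OF m[unfolded moves_def]]]]
      conjunct2[OF conjunct2[OF conjunct2[OF m[unfolded moves_def]]]] \<alpha>_simps
    by (simp_all add: h F assms(3-5))
  then show ?thesis using less_four_cases by metis
qed

text \<open>Changing the sign of \<open>e1\<close> exchanges vertices 0 and 2, changing that of
  \<open>e2\<close> exchanges 1 and 3, and \<open>s\<close> going to \<open>- s\<close> exchanges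
  the two diagonals. The quarter turn sends \<open>e1\<close> to \<open>e2\<close> and
  \<open>e2\<close> to \<open>- e1\<close>.\<close>

lemma moves_D4:
  "moves (D4_map 0 1) s e1 e2" "moves (D4_map 0 3) s e1 (- e2)"
  "moves (D4_map 2 3) s (- e1) e2" "moves (D4_map 2 1) s (- e1) (- e2)"
  "moves (D4_map 1 1) (- s) e2 (- e1)" "moves (D4_map 1 3) (- s) e2 e1"
  "moves (D4_map 3 1) (- s) (- e2) e1" "moves (D4_map 3 3) (- s) (- e2) (- e1)"
  unfolding moves_def D4_map_values by (simp_all add: \<alpha>_simps \<alpha>_simps(2)[unfolded One_nat_def] \<alpha>_simps(3)[unfolded numeral_2_eq_2])

lemma compatible_moves:
  assumes "compatible t g1 g2"
  shows "\<exists>g\<in>carrier D4. moves g t g1 g2"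
proof -
  have D: "b < 4 \<Longrightarrow> D4_map b 1 \<in> carrier D4" "b < 4 \<Longrightarrow> D4_map b 3 \<in> carrier D4" for b
    using D4_carrier by blast+
  have "t = s \<and> (g1 = e1 \<or> g1 = - e1) \<and> (g2 = e2 \<or> g2 = - e2) \<or>
        t = - s \<and> (g1 = e2 \<or> g1 = - e2) \<and> (g2 = e1 \<or> g2 = - e1)"
    using assms unfolding compatible_def power2_eq_iff by blast
  then show ?thesis
    by (elim disjE conjE) (simp only:, rule bexI, rule moves_D4, rule D, simp)+
qed

lemma moves_compatible:
  assumes "g \<in> carrier D4"
  shows "\<exists>t g1 g2. compatible t g1 g2 \<and> moves g t g1 g2"
proof -
  obtain b k where g: "b < 4" "k = 1 \<or> k = 3" "g = D4_map b k" using assms D4_carrier by blast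
  show ?thesis
    using less_four_cases[OF g(1)] g(2) unfolding g(3)
    by (elim disjE) (simp only:, intro exI conjI, rule_tac [2] moves_D4, simp add: compatible_def)+
qed

lemma galois_D4: "galois_group f \<cong> D4"
  and irreducible_f: "irreducible (map_poly (of_int :: int \<Rightarrow> rat) f)"
proof -
  let ?G = "galois_group f" and ?K = "splitting_field_C f"
  have sup: "\<exists>\<sigma>\<in>carrier ?G. \<forall>i<4. \<sigma> (\<alpha> i) = \<alpha> (g i)" if "g \<in> carrier D4" for g
  proof -
    obtain t g1 g2 where t: "compatible t g1 g2" "moves g t g1 g2" using moves_compatible[OF \<open>g \<in> carrier D4\<close>] by blast
    then have "t = s \<or> t = - s" by (auto simp: compatible_def)
    then obtain \<sigma> where \<sigma>: "field_hom_on F1 \<sigma>" "\<sigma> s = t" by (rule conjugation)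
    have "g1\<^sup>2 = \<sigma> (e1\<^sup>2)" "g2\<^sup>2 = \<sigma> (e2\<^sup>2)"
      using t(1) hom_e_squares[OF F1(1) \<sigma>(1) F1(2)] \<sigma>(2) by (auto simp: compatible_def)
    then obtain \<tau> where \<tau>: "field_hom_on F3 \<tau>" "\<tau> s = t" "\<tau> e1 = g1" "\<tau> e2 = g2"
      using hom_F3_exists[OF \<sigma>(1)] \<sigma>(2) by metis
    have "s \<in> F3" using F1 F3 by auto
    then have "\<forall>i<4. \<tau> (\<alpha> i) = \<alpha> (g i)"
      using hom_\<alpha>[OF F3(1) \<tau>(1) _ F3(4,5)] t(2) \<tau>(2-4) by simp
    moreover have "roots_C f \<subseteq> F3" unfolding roots_C_f using \<alpha>_in_F3 by auto
    moreover have "\<alpha> i \<in> ?K" if "i < 4" for i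
      using roots_C_subset_splitting_field[of f] that unfolding roots_C_f by auto
    ultimately show ?thesis
      using field_hom_restrict_galois[OF f_nonzero F3(1) \<tau>(1)] by (intro bexI[of _ "restrict \<tau> ?K"]) auto
  qed
  have sub: "\<exists>g\<in>carrier D4. \<forall>i<4. \<sigma> (\<alpha> i) = \<alpha> (g i)" if \<sigma>: "\<sigma> \<in> carrier ?G" for \<sigma>
  proof -
    note K = is_subfield_C_splitting_field[of f]
    note F = subfield_C_closed[OF K] subfield_C_of_int[OF K] subfield_C_numeral[OF K]
    note hom = galois_field_hom[OF \<sigma>]
    have \<alpha>K: "\<alpha> 0 \<in> ?K" "\<alpha> 1 \<in> ?K" "\<alpha> 2 \<in> ?K" "\<alpha> 3 \<in> ?K"
      using \<alpha>_roots roots_C_subset_splitting_field[of f] by auto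
    \<comment> \<open>The root sums of the two factors differ by \<open>2 w s\<close>; here a
      nonzero \<open>w\<close> is essential.\<close>
    have "s = (\<alpha> 1 + \<alpha> 3 - \<alpha> 0 - \<alpha> 2) / (2 * of_int w)" "e1 = \<alpha> 0 - \<alpha> 2" "e2 = \<alpha> 1 - \<alpha> 3"
      unfolding \<alpha>_simps using w by (simp_all add: field_simps)
    moreover have "(\<alpha> 1 + \<alpha> 3 - \<alpha> 0 - \<alpha> 2) / (2 * of_int w) \<in> ?K" "\<alpha> 0 - \<alpha> 2 \<in> ?K" "\<alpha> 1 - \<alpha> 3 \<in> ?K"
      by (intro F \<alpha>K)+
    ultimately have sK: "s \<in> ?K" "e1 \<in> ?K" "e2 \<in> ?K" by simp_all
    have pow: "\<sigma> (z\<^sup>2) = (\<sigma> z)\<^sup>2" if "z \<in> ?K" for z using field_hom_on_power[OF K hom that] .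
    have "(\<sigma> s)\<^sup>2 = s\<^sup>2"
      using pow[OF sK(1)] field_hom_on_of_int[OF K hom, of u] s(1) by simp
    then have "\<sigma> s = s \<or> \<sigma> s = - s" by (simp add: power2_eq_iff)
    then have "compatible (\<sigma> s) (\<sigma> e1) (\<sigma> e2)"
      using hom_e_squares[OF K hom sK(1)] pow sK unfolding compatible_def by auto
    then show ?thesis using compatible_moves hom_\<alpha>[OF K hom sK] by blast
  qed
  show "galois_group f \<cong> D4"
    by (rule galois_iso_D4[OF f_nonzero \<alpha>_inj roots_C_f sub sup])
  show "irreducible (map_poly (of_int :: int \<Rightarrow> rat) f)"
  proof (rule irreducible_transitive[OF f_nonzero])
    fix y z assume "y \<in> roots_C f" "z \<in> roots_C f"
    then obtain i j where ij: "i < 4" "y = \<alpha> i" "j < 4" "z = \<alpha> j" unfolding roots_C_f by auto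
    \<comment> \<open>The rotation that takes \<open>i\<close> to \<open>j\<close>; adding 4 first
      keeps the subtraction of natural numbers from being truncated.\<close>
    define b where "b = (j + 4 - i) mod 4"
    have "b < 4" by (simp add: b_def)
    then have "D4_map b 1 \<in> carrier D4" using D4_carrier by blast
    moreover have "D4_map b 1 i = j"
      using less_four_cases[OF ij(1)] less_four_cases[OF ij(3)] by (elim disjE) (simp_all add: b_def D4_map_def)
    ultimately show "\<exists>\<sigma>\<in>carrier ?G. \<sigma> y = z" using sup ij by metis
  qed (simp_all add: card_roots_C_f degree_f)
qed

end

section \<open>The upper bound\<close>

lemma sum_inverse_le_ln:
  assumes "n \<ge> 1"
  shows "(\<Sum>k=1..n. 1 / real k) \<le> 1 + ln (real n)"
  using assms
proof (induction n rule: dec_induct)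
  case (step n)
  have "ln (real n / real (Suc n)) \<le> real n / real (Suc n) - 1"
    using step.hyps by (intro ln_le_minus_one) auto
  also have "\<dots> = - 1 / real (Suc n)" by (simp add: field_simps)
  finally have "1 / real (Suc n) \<le> ln (real (Suc n)) - ln (real n)"
    using step.hyps by (simp add: ln_div)
  then show ?case using step by (simp add: sum.cl_ivl_Suc)
qed simp

lemma sum_inverse_ge_ln:
  assumes "1 \<le> m" "m \<le> n"
  shows "ln (real n / real m) \<le> (\<Sum>k=m..<n. 1 / real k)"
  using assms(2)
proof (induction n rule: dec_induct)
  case base
  then show ?case using assms by simp
next
  case (step n)
  have n: "n \<ge> 1" using step assms by simp
  have "ln (real (Suc n) / real n) \<le> real (Suc n) / real n - 1"
    using n by (intro ln_le_minus_one) auto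
  also have "\<dots> = 1 / real n" using n by (simp add: field_simps)
  finally have "ln (real (Suc n)) - ln (real n) \<le> 1 / real n"
    using n by (simp add: ln_div)
  then show ?case using step n assms by (simp add: ln_div)
qed

lemma card_int_near:
  assumes "\<rho> \<ge> 0"
  shows "finite {x::int. \<bar>of_int x - c\<bar> \<le> (\<rho>::real)}" "real (card {x::int. \<bar>of_int x - c\<bar> \<le> \<rho>}) \<le> 2 * \<rho> + 1"
proof -
  have "{x::int. \<bar>of_int x - c\<bar> \<le> \<rho>} = {\<lceil>c - \<rho>\<rceil>..\<lfloor>c + \<rho>\<rfloor>}"
    by (auto simp: abs_le_iff ceiling_le_iff le_floor_iff)
  moreover have "real_of_int (\<lfloor>c + \<rho>\<rfloor> + 1 - \<lceil>c - \<rho>\<rceil>) \<le> 2 * \<rho> + 1" by linarith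
  ultimately show "finite {x::int. \<bar>of_int x - c\<bar> \<le> \<rho>}" "real (card {x::int. \<bar>of_int x - c\<bar> \<le> \<rho>}) \<le> 2 * \<rho> + 1"
    using assms by simp_all
qed

lemma card_nat_le:
  assumes "r \<ge> 0"
  shows "finite {x::nat. 1 \<le> x \<and> real x \<le> r}" "real (card {x::nat. 1 \<le> x \<and> real x \<le> r}) \<le> r"
proof -
  have "{x::nat. 1 \<le> x \<and> real x \<le> r} = {1..nat \<lfloor>r\<rfloor>}"
    using assms by (auto simp: le_nat_floor le_nat_iff le_floor_iff)
  then show "finite {x::nat. 1 \<le> x \<and> real x \<le> r}" "real (card {x::nat. 1 \<le> x \<and> real x \<le> r}) \<le> r"
    using assms by simp_all
qed

lemma sum_int_abs_le:
  fixes g :: "nat \<Rightarrow> real"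
  assumes "\<And>k. g k \<ge> 0"
  shows "(\<Sum>x\<in>{-int m..int m}. g (nat \<bar>x\<bar>)) \<le> 2 * (\<Sum>k\<le>m. g k)"
proof -
  have sub: "{-int m..int m} \<subseteq> int ` {..m} \<union> (\<lambda>k. - int k) ` {..m}"
  proof
    fix x assume "x \<in> {-int m..int m}"
    then show "x \<in> int ` {..m} \<union> (\<lambda>k. - int k) ` {..m}"
      by (cases x rule: int_cases2) auto
  qed
  have "(\<Sum>x\<in>{-int m..int m}. g (nat \<bar>x\<bar>)) \<le> (\<Sum>x\<in>int ` {..m} \<union> (\<lambda>k. - int k) ` {..m}. g (nat \<bar>x\<bar>))"
    by (intro sum_mono2 sub) (auto simp: assms)
  also have "\<dots> \<le> (\<Sum>x\<in>int ` {..m}. g (nat \<bar>x\<bar>)) + (\<Sum>x\<in>(\<lambda>k. - int k) ` {..m}. g (nat \<bar>x\<bar>))"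
    by (subst sum.union_inter[symmetric]) (auto intro!: sum_nonneg simp: assms)
  also have "\<dots> = 2 * (\<Sum>k\<le>m. g k)"
    by (simp add: sum.reindex inj_on_def)
  finally show ?thesis .
qed

text \<open>If \<open>v\<close> is the larger index, the \<open>v\<close> possible values of
  \<open>w\<close> contribute \<open>v * (1 / v^2) = 1 / v\<close>. The double sum thus costs a
  single logarithm.\<close>

lemma sum_max_square_le:
  "(\<Sum>v=1..n. \<Sum>w=1..n. 1 / (real (max v w))\<^sup>2) \<le> 2 * (\<Sum>v=1..n. 1 / real v)"
proof -
  define g where "g v w = (if w \<le> v then 1 / (real v)\<^sup>2 else 0)" for v w :: nat
  have g: "(\<Sum>w=1..n. g v w) = 1 / real v" if "v \<in> {1..n}" for v
  proof -
    have "(\<Sum>w=1..n. g v w) = (\<Sum>w\<in>{1..v}. 1 / (real v)\<^sup>2)"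
      unfolding g_def using that by (intro sum.mono_neutral_cong_right) auto
    then show ?thesis using that by (simp add: power2_eq_square)
  qed
  have "(\<Sum>v=1..n. \<Sum>w=1..n. 1 / (real (max v w))\<^sup>2) \<le> (\<Sum>v=1..n. \<Sum>w=1..n. g v w + g w v)"
    by (intro sum_mono) (auto simp: g_def max_def)
  also have "\<dots> = (\<Sum>v=1..n. \<Sum>w=1..n. g v w) + (\<Sum>v=1..n. \<Sum>w=1..n. g w v)"
    by (simp add: sum.distrib)
  also have "(\<Sum>v=1..n. \<Sum>w=1..n. g w v) = (\<Sum>w=1..n. \<Sum>v=1..n. g w v)" by (rule sum.swap)
  also have "(\<Sum>v=1..n. \<Sum>w=1..n. g v w) = (\<Sum>v=1..n. 1 / real v)" by (intro sum.cong g refl)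
  finally show ?thesis by simp
qed

section \<open>Parametrising the solutions of the resolvent equation\<close>

lemma square_product_decompose:
  fixes P Q S :: int
  assumes "P \<noteq> 0" "Q \<noteq> 0" "P * Q = S\<^sup>2"
  shows "\<exists>\<eta> \<epsilon> u v w. \<eta> \<in> {1, -1} \<and> \<epsilon> \<in> {1, -1} \<and> u \<ge> 1 \<and> v \<ge> 1 \<and> w \<ge> 1 \<and>
     P = \<eta> * int (u * v\<^sup>2) \<and> Q = \<eta> * int (u * w\<^sup>2) \<and> S = \<epsilon> * int (u * v * w)"
proof -
  define p q r where "p = nat \<bar>P\<bar>" and "q = nat \<bar>Q\<bar>" and "r = nat \<bar>S\<bar>"
  have pq: "p \<noteq> 0" "q \<noteq> 0" using assms by (auto simp: p_def q_def)
  have "int (p * q) = int (r\<^sup>2)"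
    using assms(3) by (simp add: p_def q_def r_def flip: abs_mult)
  then have pqr: "p * q = r\<^sup>2" by (simp only: of_nat_eq_iff)
  \<comment> \<open>Dividing by the gcd leaves coprime numbers whose product is a square, so each of
    them is a square. This \<open>u\<close> may have square factors; solutions that arise more than
    once do no harm to an upper bound.\<close>
  define u where "u = gcd p q"
  have u: "u \<ge> 1" using pq by (simp add: u_def Suc_le_eq)
  have "gcd p q \<noteq> 0" using pq by simp
  from gcd_coprime_exists[OF this] obtain p' q' where "p = p' * gcd p q" "q = q' * gcd p q"
    and cop: "coprime p' q'" by blast
  then have p': "p = u * p'" and q': "q = u * q'" by (simp_all add: u_def mult.commute)
  have "r\<^sup>2 = u\<^sup>2 * (p' * q')"
    unfolding pqr[symmetric] unfolding p' q' power2_eq_square by (simp only: ac_simps)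
  then have "u\<^sup>2 dvd r\<^sup>2" by simp
  then have "u dvd r" by (simp add: pow_divides_pow_iff)
  then obtain t where t: "r = u * t" by (rule dvdE)
  have "u\<^sup>2 * (p' * q') = u\<^sup>2 * t\<^sup>2" using pqr p' q' t by (simp add: power2_eq_square algebra_simps)
  then have pq': "p' * q' = t\<^sup>2" using u by simp
  then have "is_nth_power 2 (p' * q')" by (rule is_nth_powerI)
  moreover have "p' > 0" "q' > 0" using pq p' q' by auto
  ultimately have "is_nth_power 2 p'" "is_nth_power 2 q'"
    using is_nth_power_mult_coprime_natD[OF cop] by auto
  then obtain v w where v: "p' = v\<^sup>2" and w: "q' = w\<^sup>2" by (auto elim!: is_nth_powerE)
  have vw: "v \<ge> 1" "w \<ge> 1" using \<open>p' > 0\<close> \<open>q' > 0\<close> v w by (auto simp: Suc_le_eq intro!: Nat.gr0I)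
  have "t = v * w" using pq' v w by (metis power_mult_distrib power2_eq_iff_nonneg zero_le)
  then have r: "r = u * v * w" using t by simp
  have "P * Q > 0" using assms by (metis mult_eq_0_iff zero_le_power2 order_le_less)
  then have sgn_eq: "sgn Q = sgn P" by (auto simp: sgn_if zero_less_mult_iff)
  define \<eta> \<epsilon> where "\<eta> = sgn P" and "\<epsilon> = sgn S"
  have "S \<noteq> 0" using assms by auto
  then have signs: "\<eta> \<in> {1, -1}" "\<epsilon> \<in> {1, -1}" using assms(1) by (auto simp: \<eta>_def \<epsilon>_def sgn_if)
  have "P = \<eta> * int p" "Q = \<eta> * int q" "S = \<epsilon> * int r"
    using sgn_mult_abs[of P] sgn_mult_abs[of Q] sgn_mult_abs[of S]
    by (simp_all add: \<eta>_def \<epsilon>_def p_def q_def r_def sgn_eq)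
  then have "P = \<eta> * int (u * v\<^sup>2)" "Q = \<eta> * int (u * w\<^sup>2)" "S = \<epsilon> * int (u * v * w)"
    unfolding p' q' v w r .
  then show ?thesis using signs u vw by blast
qed

text \<open>The equation is four times a monic cubic in \<open>x\<close>. If \<open>X = |x|\<close>
  exceeded \<open>4 h\<close>, the lower terms would be at most
  \<open>(h + (h + 4)/4 + (h + 5)/16) X^2\<close>, which is less than \<open>(4 h + 1) X^2\<close>
  and hence less than \<open>X^3\<close>.\<close>

lemma resolvent_root_bound:
  fixes a b c d x h :: int
  assumes h: "h \<ge> 1" "\<bar>a\<bar> \<le> h" "\<bar>b\<bar> \<le> h" "\<bar>c\<bar> \<le> h" "\<bar>d\<bar> \<le> h"
    and eq: "(x\<^sup>2 - 4 * d) * (a\<^sup>2 - 4 * b + 4 * x) = (x * a - 2 * c)\<^sup>2"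
  shows "\<bar>x\<bar> \<le> 4 * h"
proof (rule ccontr)
  define X where "X = \<bar>x\<bar>"
  assume "\<not> \<bar>x\<bar> \<le> 4 * h"
  then have X: "X \<ge> 4 * h + 1" by (simp add: X_def)
  have "4 * (x ^ 3) = 4 * (b * x\<^sup>2 - (a * c - 4 * d) * x + (a\<^sup>2 * d - 4 * b * d + c\<^sup>2))"
    using eq by algebra
  then have cubic: "x ^ 3 = b * x\<^sup>2 - (a * c - 4 * d) * x + (a\<^sup>2 * d - 4 * b * d + c\<^sup>2)" by simp
  have m: "\<bar>p * q\<bar> \<le> r * t" if "\<bar>p\<bar> \<le> r" "\<bar>q\<bar> \<le> t" for p q r t :: int
    using that by (simp add: abs_mult mult_mono')
  have "\<bar>b * x\<^sup>2\<bar> \<le> h * X\<^sup>2" using h by (intro m) (auto simp: X_def)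
  moreover have "\<bar>(a * c - 4 * d) * x\<bar> \<le> (h * h + 4 * h) * X"
    using m[OF h(2) h(4)] h(5) by (intro m) (auto simp: X_def)
  moreover have "\<bar>a\<^sup>2 * d\<bar> \<le> h * h * h" using m[OF h(2,2)] h by (intro m) (auto simp: power2_eq_square)
  moreover have "\<bar>b * d\<bar> \<le> h * h" "\<bar>c\<^sup>2\<bar> \<le> h * h"
    using m[OF h(3,5)] m[OF h(4,4)] by (auto simp: power2_eq_square)
  moreover have "X ^ 3 = \<bar>x ^ 3\<bar>" by (simp add: X_def power_abs)
  ultimately have "X ^ 3 \<le> h * X\<^sup>2 + (h * h + 4 * h) * X + (h * h * h + 5 * (h * h))"
    using cubic by linarith
  moreover have "X ^ 3 = X * X\<^sup>2" by (simp add: power2_eq_square power3_eq_cube)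
  moreover have "(4 * h) * X\<^sup>2 + X\<^sup>2 \<le> X * X\<^sup>2" using mult_right_mono[OF X, of "X\<^sup>2"] by (simp add: algebra_simps)
  moreover have hX: "h * (4 * X) \<le> X * X" using X h mult_right_mono[of "4 * h" X X] by simp
  then have "(h + 4) * (h * (4 * X)) \<le> (h + 4) * X\<^sup>2" using h by (simp add: power2_eq_square mult_left_mono)
  moreover have "16 * (h * h) \<le> X\<^sup>2" using X h mult_mono[of "4 * h" X "4 * h" X] by (simp add: power2_eq_square)
  then have "(h + 5) * (16 * (h * h)) \<le> (h + 5) * X\<^sup>2" using h by (intro mult_left_mono) auto
  moreover have "h * X\<^sup>2 \<ge> X\<^sup>2" using h by (simp add: mult_right_mono[of 1 h "X\<^sup>2", simplified])
  moreover have "X\<^sup>2 > 0" using X h by simp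
  ultimately show False by (simp add: algebra_simps)
qed

text \<open>Irreducibility and the Galois group are dropped: the upper bound holds for all quartics
  in the box whose cubic resolvent has an integer root.\<close>

definition resolvent_set :: "nat \<Rightarrow> (int \<times> int \<times> int \<times> int) set" where
  "resolvent_set H = {(a, b, c, d). a \<in> {-int H..int H} \<and> b \<in> {-int H..int H} \<and>
      c \<in> {-int H..int H} \<and> d \<in> {-int H..int H} \<and>
      (\<exists>x. (x\<^sup>2 - 4 * d) * (a\<^sup>2 - 4 * b + 4 * x) = (x * a - 2 * c)\<^sup>2)}"

text \<open>These pairs cover the degenerate solutions: if one factor of the equation vanishes, then
  \<open>x a = 2 c\<close>.\<close>

definition small_products :: "nat \<Rightarrow> (int \<times> int) set" where
  "small_products H = {(x, a). \<bar>x\<bar> \<le> 4 * int H \<and> \<bar>a\<bar> \<le> 4 * int H \<and> \<bar>x * a\<bar> \<le> 2 * int H}"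

text \<open>Two boxes, around the point \<open>(s v, \<epsilon> s w)\<close> and its negative. Near
  these points \<open>x^2 - u v^2\<close>, \<open>a^2 - u w^2\<close> and
  \<open>x a - \<epsilon> u v w\<close> are all of order \<open>H\<close>.\<close>

definition near_pairs :: "nat \<Rightarrow> int \<Rightarrow> nat \<Rightarrow> nat \<Rightarrow> nat \<Rightarrow> (int \<times> int) set" where
  "near_pairs H \<epsilon> u v w =
    (let s = sqrt (real u); \<rho> = 20 * real H / (s * real (max v w)) in
     {(x, a). \<bar>of_int x - s * real v\<bar> \<le> \<rho> \<and> \<bar>of_int a - of_int \<epsilon> * s * real w\<bar> \<le> \<rho>} \<union>
     {(x, a). \<bar>of_int x + s * real v\<bar> \<le> \<rho> \<and> \<bar>of_int a + of_int \<epsilon> * s * real w\<bar> \<le> \<rho>})"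

text \<open>\<open>21 H^2\<close> covers both \<open>x^2 - 4 d\<close>, at most
  \<open>16 H^2 + 4 H\<close>, and \<open>a^2 - 4 b + 4 x\<close>, at most
  \<open>H^2 + 20 H\<close>.\<close>

definition real_params :: "int \<Rightarrow> nat \<Rightarrow> (nat \<times> nat \<times> nat \<times> int \<times> int) set" where
  "real_params \<epsilon> H = {(u, v, w, x, a). u \<ge> 1 \<and> v \<ge> 1 \<and> w \<ge> 1 \<and> u * (max v w)\<^sup>2 \<le> 21 * H\<^sup>2 \<and>
     (x, a) \<in> near_pairs H \<epsilon> u v w}"

text \<open>With negative sign the equations read \<open>x^2 + u v^2 = 4 d\<close> and
  \<open>a^2 + u w^2 = 4 b - 4 x\<close>; nothing can cancel on the left, so every term is at most
  \<open>20 H\<close>.\<close>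

definition imaginary_params :: "nat \<Rightarrow> (nat \<times> nat \<times> nat \<times> int \<times> int) set" where
  "imaginary_params H = {(u, v, w, x, a). u \<ge> 1 \<and> v \<ge> 1 \<and> w \<ge> 1 \<and>
     u * v\<^sup>2 \<le> 20 * H \<and> u * w\<^sup>2 \<le> 20 * H \<and> x\<^sup>2 \<le> 20 * int H \<and> a\<^sup>2 \<le> 20 * int H}"

text \<open>Solves the three equations for \<open>b\<close>, \<open>c\<close> and \<open>d\<close>;
  on parameters that come from a solution the divisions are exact.\<close>

definition decode :: "int \<Rightarrow> int \<Rightarrow> nat \<times> nat \<times> nat \<times> int \<times> int \<Rightarrow> int \<times> int \<times> int \<times> int" where
  "decode \<eta> \<epsilon> = (\<lambda>(u, v, w, x, a). (a, (a\<^sup>2 + 4 * x - \<eta> * int (u * w\<^sup>2)) div 4,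
     (x * a - \<epsilon> * int (u * v * w)) div 2, (x\<^sup>2 - \<eta> * int (u * v\<^sup>2)) div 4))"

text \<open>With \<open>P = A * B'\<close> and \<open>Q = A' * B\<close>: opposite large values of \<open>P\<close> and \<open>Q\<close> could cancel in \<open>P + Q\<close>,
  but their product is controlled as well.\<close>

lemma bounded_of_sum_and_product:
  fixes P Q h :: real
  assumes "\<bar>P + Q\<bar> \<le> 4 * h" "\<bar>P * Q\<bar> \<le> 80 * h\<^sup>2" "h > 0"
  shows "\<bar>P\<bar> \<le> 20 * h"
proof (rule ccontr)
  assume *: "\<not> \<bar>P\<bar> \<le> 20 * h"
  then have "\<bar>Q\<bar> \<ge> 16 * h" using assms by linarith
  with * assms(3) have "(20 * h) * (16 * h) \<le> \<bar>P\<bar> * \<bar>Q\<bar>" by (intro mult_mono) auto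
  then have "320 * h\<^sup>2 \<le> 80 * h\<^sup>2" using assms(2) by (simp add: abs_mult power2_eq_square)
  then show False using assms(3) by simp
qed

text \<open>From \<open>A - A' = 2 s v\<close> and \<open>B - B' = 2 \<epsilon> s w\<close>, one of
  the four numbers has absolute value at least \<open>s max v w\<close>. A large \<open>A\<close> or
  \<open>B\<close> bounds both \<open>A'\<close> and \<open>B'\<close>, a large \<open>A'\<close> or
  \<open>B'\<close> bounds both \<open>A\<close> and \<open>B\<close>; these alternatives are the
  two boxes. The constant 20 comes from \<open>B B' = 4 b - 4 x\<close> with
  \<open>|x| \<le> 4 H\<close>.\<close>

lemma near_pairs_member:
  fixes a b c d x :: int
  assumes H: "H \<ge> 1" "\<bar>b\<bar> \<le> int H" "\<bar>c\<bar> \<le> int H" "\<bar>d\<bar> \<le> int H" "\<bar>x\<bar> \<le> 4 * int H"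
    and uvw: "u \<ge> 1" "v \<ge> 1" "w \<ge> 1" and \<epsilon>: "\<epsilon> \<in> {1, -1}"
    and P: "x\<^sup>2 - 4 * d = int (u * v\<^sup>2)" and Q: "a\<^sup>2 - 4 * b + 4 * x = int (u * w\<^sup>2)"
    and S: "x * a - 2 * c = \<epsilon> * int (u * v * w)"
  shows "(x, a) \<in> near_pairs H \<epsilon> u v w"
proof -
  define s where "s = sqrt (real u)"
  define h where "h = real H"
  have s: "s > 0" "s * s = real u" using uvw by (simp_all add: s_def)
  have h: "h > 0" using H by (simp add: h_def)
  have e: "(of_int \<epsilon> :: real) * of_int \<epsilon> = 1" using \<epsilon> by auto
  define A A' B B' where "A = of_int x + s * v" and "A' = of_int x - s * v"
    and "B = of_int a + of_int \<epsilon> * s * w" and "B' = of_int a - of_int \<epsilon> * s * w"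
  note defs = A_def A'_def B_def B'_def
  have P': "(of_int x)\<^sup>2 - 4 * of_int d = real u * (real v)\<^sup>2" using arg_cong[OF P, of real_of_int] by simp
  have Q': "(of_int a)\<^sup>2 - 4 * of_int b + 4 * of_int x = real u * (real w)\<^sup>2"
    using arg_cong[OF Q, of real_of_int] by simp
  have S': "of_int x * of_int a - 2 * of_int c = of_int \<epsilon> * (real u * real v * real w)"
    using arg_cong[OF S, of real_of_int] by simp
  have AA: "A * A' = 4 * of_int d"
  proof -
    have "A * A' = (of_int x)\<^sup>2 - (s * s) * (real v)\<^sup>2" unfolding defs by algebra
    then show ?thesis using P' s by simp
  qed
  have BB: "B * B' = 4 * of_int b - 4 * of_int x"
  proof -
    have "B * B' = (of_int a)\<^sup>2 - (of_int \<epsilon> * of_int \<epsilon>) * (s * s) * (real w)\<^sup>2" unfolding defs by algebra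
    then show ?thesis using Q' s e by simp
  qed
  have AB: "A * B' + A' * B = 4 * of_int c"
  proof -
    have "A * B' + A' * B = 2 * (of_int x * of_int a - of_int \<epsilon> * (s * s) * real v * real w)"
      unfolding defs by algebra
    then show ?thesis using S' s by simp
  qed
  have bd: "\<bar>of_int b\<bar> \<le> h" "\<bar>of_int c\<bar> \<le> h" "\<bar>of_int d\<bar> \<le> h" "\<bar>of_int x\<bar> \<le> 4 * h"
    using H by (simp_all add: h_def flip: of_int_abs)
  have L1: "\<bar>A * A'\<bar> \<le> 4 * h" using AA bd by simp
  have L2: "\<bar>B * B'\<bar> \<le> 20 * h" using BB bd by simp
  have L3: "\<bar>A * B' + A' * B\<bar> \<le> 4 * h" using AB bd by simp
  have "\<bar>(A * B') * (A' * B)\<bar> = \<bar>A * A'\<bar> * \<bar>B * B'\<bar>" by (simp add: abs_mult algebra_simps)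
  also have "\<dots> \<le> (4 * h) * (20 * h)" using L1 L2 h by (intro mult_mono) auto
  finally have L4: "\<bar>(A * B') * (A' * B)\<bar> \<le> 80 * h\<^sup>2" by (simp add: power2_eq_square)
  have L5: "\<bar>A * B'\<bar> \<le> 20 * h" by (rule bounded_of_sum_and_product[OF L3 L4 h])
  have L6: "\<bar>A' * B\<bar> \<le> 20 * h"
    by (rule bounded_of_sum_and_product[of _ "A * B'"]) (use L3 L4 h in \<open>simp_all add: ac_simps\<close>)
  define m where "m = s * real (max v w)"
  have m: "m > 0" using s uvw by (simp add: m_def)
  have small: "\<bar>y\<bar> \<le> 20 * h / m" if "\<bar>z\<bar> \<ge> m" "\<bar>z * y\<bar> \<le> 20 * h" for y z
  proof -
    have "m * \<bar>y\<bar> \<le> \<bar>z\<bar> * \<bar>y\<bar>" using that(1) by (intro mult_right_mono) auto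
    then have "m * \<bar>y\<bar> \<le> 20 * h" using that(2) by (simp add: abs_mult)
    then show ?thesis using m by (simp add: pos_le_divide_eq mult.commute)
  qed
  have large: "\<bar>A\<bar> \<ge> m \<or> \<bar>A'\<bar> \<ge> m \<or> \<bar>B\<bar> \<ge> m \<or> \<bar>B'\<bar> \<ge> m"
  proof (cases "w \<le> v")
    case True
    then have "A - A' = 2 * m" by (simp add: defs m_def)
    then show ?thesis by linarith
  next
    case False
    have "B - B' = of_int \<epsilon> * (2 * (s * w))" by (simp add: defs)
    then have "B - B' = 2 * m \<or> B - B' = - (2 * m)" using False \<epsilon> by (auto simp: m_def max_def)
    then show ?thesis by linarith
  qed
  have "\<bar>A * A'\<bar> \<le> 20 * h" using L1 h by simp
  then have "\<bar>A'\<bar> \<le> 20 * h / m \<and> \<bar>B'\<bar> \<le> 20 * h / m \<or> \<bar>A\<bar> \<le> 20 * h / m \<and> \<bar>B\<bar> \<le> 20 * h / m"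
    using large small[of A A'] small[of A B'] small[of B A'] small[of B B']
      small[of A' A] small[of A' B] small[of B' A] small[of B' B] L2 L5 L6
    by (auto simp: mult.commute)
  then show ?thesis
    unfolding near_pairs_def Let_def defs m_def s_def h_def by auto
qed

text \<open>In each degenerate case \<open>(x, a)\<close> determines \<open>c\<close> and one of
  \<open>b\<close>, \<open>d\<close>, while the other one ranges freely over the box.\<close>

lemma resolvent_set_cover:
  assumes H: "H \<ge> 1"
  shows "resolvent_set H \<subseteq>
    (\<lambda>((x, a), b). (a, b, x * a div 2, x\<^sup>2 div 4)) ` (small_products H \<times> {-int H..int H}) \<union>
    (\<lambda>((x, a), d). (a, x + a\<^sup>2 div 4, x * a div 2, d)) ` (small_products H \<times> {-int H..int H}) \<union>
    (\<Union>\<epsilon>\<in>{1, -1}. decode 1 \<epsilon> ` real_params \<epsilon> H \<union> decode (-1) \<epsilon> ` imaginary_params H)"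
    (is "_ \<subseteq> ?T1 \<union> ?T2 \<union> ?T3")
proof
  fix t assume "t \<in> resolvent_set H"
  then obtain a b c d x where t: "t = (a, b, c, d)"
    and bd: "\<bar>a\<bar> \<le> int H" "\<bar>b\<bar> \<le> int H" "\<bar>c\<bar> \<le> int H" "\<bar>d\<bar> \<le> int H"
    and eq: "(x\<^sup>2 - 4 * d) * (a\<^sup>2 - 4 * b + 4 * x) = (x * a - 2 * c)\<^sup>2"
    by (auto simp: resolvent_set_def abs_le_iff)
  have xb: "\<bar>x\<bar> \<le> 4 * int H" using resolvent_root_bound[OF _ bd eq] H by simp
  have I: "b \<in> {-int H..int H}" "d \<in> {-int H..int H}" using bd by auto
  consider "x\<^sup>2 - 4 * d = 0" | "a\<^sup>2 - 4 * b + 4 * x = 0" | "x\<^sup>2 - 4 * d \<noteq> 0" "a\<^sup>2 - 4 * b + 4 * x \<noteq> 0" by blast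
  then show "t \<in> ?T1 \<union> ?T2 \<union> ?T3"
  proof cases
    case 1
    then have "x * a = 2 * c" using eq by simp
    then have "(x, a) \<in> small_products H" using bd xb by (simp add: small_products_def)
    moreover have "t = (a, b, x * a div 2, x\<^sup>2 div 4)" using t \<open>x * a = 2 * c\<close> 1 by simp
    ultimately have "t \<in> ?T1" using I by (intro image_eqI[where x = "((x, a), b)"]) auto
    then show ?thesis by blast
  next
    case 2
    then have "x * a = 2 * c" using eq by simp
    then have "(x, a) \<in> small_products H" using bd xb by (simp add: small_products_def)
    moreover have "a\<^sup>2 = 4 * (b - x)" using 2 by simp
    then have "t = (a, x + a\<^sup>2 div 4, x * a div 2, d)" using t \<open>x * a = 2 * c\<close> by simp
    ultimately have "t \<in> ?T2" using I by (intro image_eqI[where x = "((x, a), d)"]) auto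
    then show ?thesis by blast
  next
    case 3
    from square_product_decompose[OF 3 eq] obtain \<eta> \<epsilon> u v w where
      signs: "\<eta> \<in> {1, -1}" "\<epsilon> \<in> {1, -1}" and uvw: "u \<ge> 1" "v \<ge> 1" "w \<ge> 1"
      and P: "x\<^sup>2 - 4 * d = \<eta> * int (u * v\<^sup>2)" and Q: "a\<^sup>2 - 4 * b + 4 * x = \<eta> * int (u * w\<^sup>2)"
      and S: "x * a - 2 * c = \<epsilon> * int (u * v * w)"
      by blast
    have "a\<^sup>2 + 4 * x - \<eta> * int (u * w\<^sup>2) = 4 * b" "x * a - \<epsilon> * int (u * v * w) = 2 * c"
      "x\<^sup>2 - \<eta> * int (u * v\<^sup>2) = 4 * d"
      using P Q S by linarith+
    then have dec: "t = decode \<eta> \<epsilon> (u, v, w, x, a)" unfolding t decode_def by simp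
    have sq: "y\<^sup>2 \<le> m\<^sup>2" if "\<bar>y\<bar> \<le> m" for y m :: int
      using that by (metis abs_ge_zero power2_abs power_mono)
    show ?thesis
    proof (cases "\<eta> = 1")
      case True
      have "int (u * v\<^sup>2) \<le> 21 * (int H)\<^sup>2" "int (u * w\<^sup>2) \<le> 21 * (int H)\<^sup>2"
      proof -
        have "int H * 1 \<le> int H * int H" using H by (intro mult_left_mono) auto
        then have "int H \<le> (int H)\<^sup>2" by (simp add: power2_eq_square)
        moreover have "(4 * int H)\<^sup>2 = 16 * (int H)\<^sup>2" by (simp add: power_mult_distrib)
        moreover have "int (u * v\<^sup>2) = x\<^sup>2 - 4 * d" "int (u * w\<^sup>2) = a\<^sup>2 - 4 * b + 4 * x"
          using P Q True by simp_all
        ultimately show "int (u * v\<^sup>2) \<le> 21 * (int H)\<^sup>2" "int (u * w\<^sup>2) \<le> 21 * (int H)\<^sup>2"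
          using bd xb sq[OF xb] sq[OF bd(1)] by linarith+
      qed
      then have "int (u * (max v w)\<^sup>2) \<le> int (21 * H\<^sup>2)" by (auto simp: max_def)
      then have "u * (max v w)\<^sup>2 \<le> 21 * H\<^sup>2" by (simp only: of_nat_le_iff)
      moreover have "(x, a) \<in> near_pairs H \<epsilon> u v w"
        using near_pairs_member[OF H bd(2-4) xb uvw signs(2)] P Q S True by simp
      ultimately have "(u, v, w, x, a) \<in> real_params \<epsilon> H" using uvw by (simp add: real_params_def)
      then show ?thesis using dec True signs(2) by blast
    next
      case False
      then have \<eta>: "\<eta> = -1" using signs by simp
      have "int (u * v\<^sup>2) \<ge> 0" "int (u * w\<^sup>2) \<ge> 0" by simp_all
      moreover have "x\<^sup>2 + int (u * v\<^sup>2) = 4 * d" "a\<^sup>2 + int (u * w\<^sup>2) = 4 * b - 4 * x"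
        using P Q \<eta> by simp_all
      ultimately have "int (u * v\<^sup>2) \<le> int (20 * H)" "int (u * w\<^sup>2) \<le> int (20 * H)" "x\<^sup>2 \<le> 20 * int H" "a\<^sup>2 \<le> 20 * int H"
        using bd xb zero_le_power2[of x] zero_le_power2[of a] unfolding of_nat_mult[of 20 H] of_nat_numeral
        by linarith+
      then have "(u, v, w, x, a) \<in> imaginary_params H"
        using uvw unfolding imaginary_params_def of_nat_le_iff by simp
      then show ?thesis using dec \<eta> signs(2) by blast
    qed
  qed
qed

section \<open>Counting the parameters\<close>

lemma card_near_pairs:
  assumes uvw: "u \<ge> 1" "v \<ge> 1" "w \<ge> 1" and le: "u * (max v w)\<^sup>2 \<le> 21 * H\<^sup>2"
  shows "finite (near_pairs H \<epsilon> u v w)"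
    "real (card (near_pairs H \<epsilon> u v w)) \<le> 7200 * (real H)\<^sup>2 / (real u * (real (max v w))\<^sup>2)"
proof -
  define s where "s = sqrt (real u)"
  define M where "M = real (max v w)"
  define h where "h = real H"
  define \<rho> where "\<rho> = 20 * h / (s * M)"
  have s: "s > 0" "s\<^sup>2 = real u" using uvw by (simp_all add: s_def)
  have M: "M > 0" using uvw by (simp add: M_def)
  have "real (u * (max v w)\<^sup>2) \<le> real (21 * H\<^sup>2)" using le by (simp only: of_nat_le_iff)
  then have "(s * M)\<^sup>2 \<le> 21 * h\<^sup>2" using s by (simp add: M_def h_def power_mult_distrib)
  also have "\<dots> \<le> (20 * h)\<^sup>2" by (simp add: power_mult_distrib)
  finally have "s * M \<le> 20 * h" by (rule power2_le_imp_le) (simp add: h_def)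
  \<comment> \<open>This is what the bound on \<open>u (max v w)^2\<close> is for:
    \<open>2 \<rho> + 1\<close> integers in an interval become at most \<open>3 \<rho>\<close>,
    without an additive term.\<close>
  then have \<rho>: "\<rho> \<ge> 1" using s M by (simp add: \<rho>_def)
  define I where "I z = {x::int. \<bar>of_int x - z\<bar> \<le> \<rho>}" for z
  have fin: "finite (I z)" and card: "real (card (I z)) \<le> 3 * \<rho>" for z
    unfolding I_def using card_int_near[of \<rho> z] \<rho> by auto
  have eq: "near_pairs H \<epsilon> u v w =
      I (s * v) \<times> I (of_int \<epsilon> * s * w) \<union> I (- (s * v)) \<times> I (- (of_int \<epsilon> * s * w))"
    unfolding near_pairs_def Let_def I_def \<rho>_def s_def M_def h_def by auto
  show "finite (near_pairs H \<epsilon> u v w)" unfolding eq using fin by simp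
  have pair: "real (card (I y \<times> I z)) \<le> 9 * \<rho>\<^sup>2" for y z
  proof -
    have "real (card (I y)) * real (card (I z)) \<le> (3 * \<rho>) * (3 * \<rho>)"
      using card \<rho> by (intro mult_mono) auto
    then show ?thesis by (simp add: card_cartesian_product power2_eq_square)
  qed
  have "real (card (near_pairs H \<epsilon> u v w)) \<le>
      real (card (I (s * v) \<times> I (of_int \<epsilon> * s * w))) + real (card (I (- (s * v)) \<times> I (- (of_int \<epsilon> * s * w))))"
    unfolding eq of_nat_add[symmetric] of_nat_le_iff by (rule card_Un_le)
  also have "\<dots> \<le> 18 * \<rho>\<^sup>2" using pair[of "s * v" "of_int \<epsilon> * s * w"] pair[of "- (s * v)" "- (of_int \<epsilon> * s * w)"] by linarith
  also have "\<dots> = 7200 * h\<^sup>2 / (real u * M\<^sup>2)"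
    unfolding \<rho>_def power_divide power_mult_distrib s by simp
  finally show "real (card (near_pairs H \<epsilon> u v w)) \<le> 7200 * (real H)\<^sup>2 / (real u * (real (max v w))\<^sup>2)"
    by (simp add: h_def M_def)
qed

lemma card_real_params:
  assumes H: "H \<ge> 1"
  shows "finite (real_params \<epsilon> H)"
    "real (card (real_params \<epsilon> H)) \<le> 14400 * (real H)\<^sup>2 * (1 + ln (21 * (real H)\<^sup>2)) * (1 + ln (5 * real H))"
proof -
  define X where "X u v w = (if u * (max v w)\<^sup>2 \<le> 21 * H\<^sup>2 then near_pairs H \<epsilon> u v w else {})" for u v w
  \<comment> \<open>\<open>5 H\<close> is enough for \<open>v\<close> and \<open>w\<close> because
    \<open>21 \<le> 5^2\<close>.\<close>
  define U V where "U = {1..21 * H\<^sup>2}" and "V = {1..5 * H}"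
  let ?T = "SIGMA u:U. SIGMA v:V. SIGMA w:V. X u v w"
  have sub: "real_params \<epsilon> H \<subseteq> ?T"
  proof
    fix t assume "t \<in> real_params \<epsilon> H"
    then obtain u v w x a where t: "t = (u, v, w, x, a)" and uvw: "u \<ge> 1" "v \<ge> 1" "w \<ge> 1"
      and le: "u * (max v w)\<^sup>2 \<le> 21 * H\<^sup>2" and near: "(x, a) \<in> near_pairs H \<epsilon> u v w"
      by (auto simp: real_params_def)
    have M: "max v w \<ge> 1" using uvw by simp
    have "u \<le> u * (max v w)\<^sup>2" using M by simp
    then have "u \<in> U" using order_trans[OF _ le] uvw by (simp add: U_def)
    have "1 * (max v w)\<^sup>2 \<le> u * (max v w)\<^sup>2" using uvw by (intro mult_right_mono) auto
    also note le
    also have "21 * H\<^sup>2 \<le> (5 * H)\<^sup>2" by (simp add: power_mult_distrib)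
    finally have "(max v w)\<^sup>2 \<le> (5 * H)\<^sup>2" by simp
    then have "max v w \<le> 5 * H" by (rule power2_le_imp_le) simp
    then have "v \<in> V" "w \<in> V" using uvw by (auto simp: V_def)
    then show "t \<in> ?T" using \<open>u \<in> U\<close> le near by (simp add: t X_def)
  qed
  have X: "finite (X u v w)" "real (card (X u v w)) \<le> 7200 * (real H)\<^sup>2 / (real u * (real (max v w))\<^sup>2)"
    if "u \<in> U" "v \<in> V" "w \<in> V" for u v w
    using card_near_pairs[of u v w H \<epsilon>] that by (auto simp: X_def U_def V_def)
  have fU: "finite U" and fV: "finite V" by (simp_all add: U_def V_def)
  have f1: "finite (SIGMA w:V. X u v w)" if "u \<in> U" "v \<in> V" for u v
    by (rule finite_SigmaI[OF fV X(1)[OF that]])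
  have f2: "finite (SIGMA v:V. SIGMA w:V. X u v w)" if "u \<in> U" for u
    by (rule finite_SigmaI[OF fV f1[OF that]])
  have fT: "finite ?T" by (rule finite_SigmaI[OF fU f2])
  show "finite (real_params \<epsilon> H)" using finite_subset[OF sub fT] .
  have "card ?T = (\<Sum>u\<in>U. \<Sum>v\<in>V. \<Sum>w\<in>V. card (X u v w))"
    using X(1) f1 f2 fU fV by simp
  then have "real (card ?T) = (\<Sum>u\<in>U. \<Sum>v\<in>V. \<Sum>w\<in>V. real (card (X u v w)))" by simp
  also have "\<dots> \<le> (\<Sum>u\<in>U. \<Sum>v\<in>V. \<Sum>w\<in>V. 7200 * (real H)\<^sup>2 / (real u * (real (max v w))\<^sup>2))"
    using X by (intro sum_mono) auto
  also have "\<dots> = (\<Sum>u\<in>U. \<Sum>v\<in>V. \<Sum>w\<in>V. 7200 * (real H)\<^sup>2 * (1 / real u * (1 / (real (max v w))\<^sup>2)))"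
    by simp
  also have "\<dots> = 7200 * (real H)\<^sup>2 * ((\<Sum>u\<in>U. 1 / real u) * (\<Sum>v\<in>V. \<Sum>w\<in>V. 1 / (real (max v w))\<^sup>2))"
    by (simp only: sum_distrib_left[symmetric] sum_distrib_right[symmetric])
  also have "\<dots> \<le> 7200 * (real H)\<^sup>2 * ((1 + ln (21 * (real H)\<^sup>2)) * (2 * (1 + ln (5 * real H))))"
  proof (intro mult_left_mono mult_mono)
    show "(\<Sum>u\<in>U. 1 / real u) \<le> 1 + ln (21 * (real H)\<^sup>2)"
      using sum_inverse_le_ln[of "21 * H\<^sup>2"] H by (simp add: U_def)
    have "(\<Sum>v\<in>V. \<Sum>w\<in>V. 1 / (real (max v w))\<^sup>2) \<le> 2 * (\<Sum>v\<in>V. 1 / real v)"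
      unfolding V_def by (rule sum_max_square_le)
    also have "(\<Sum>v\<in>V. 1 / real v) \<le> 1 + ln (5 * real H)"
      using sum_inverse_le_ln[of "5 * H"] H by (simp add: V_def)
    finally show "(\<Sum>v\<in>V. \<Sum>w\<in>V. 1 / (real (max v w))\<^sup>2) \<le> 2 * (1 + ln (5 * real H))" by simp
    have "21 * (real H)\<^sup>2 \<ge> 1" using H by (simp add: one_le_power order_trans[of 1 "(real H)\<^sup>2"])
    then show "0 \<le> 1 + ln (21 * (real H)\<^sup>2)" by (simp add: ln_ge_zero)
  qed (auto intro!: sum_nonneg)
  finally have "real (card ?T) \<le> 14400 * (real H)\<^sup>2 * (1 + ln (21 * (real H)\<^sup>2)) * (1 + ln (5 * real H))"
    by (simp add: algebra_simps)
  moreover have "card (real_params \<epsilon> H) \<le> card ?T" by (rule card_mono[OF fT sub])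
  ultimately show "real (card (real_params \<epsilon> H)) \<le> 14400 * (real H)\<^sup>2 * (1 + ln (21 * (real H)\<^sup>2)) * (1 + ln (5 * real H))"
    by linarith
qed

text \<open>Given \<open>u\<close>, each of \<open>v\<close>, \<open>w\<close> has at most
  \<open>sqrt (20 H / u)\<close> values and each of \<open>x\<close>, \<open>a\<close> at most
  \<open>3 sqrt (20 H)\<close>. That is \<open>3600 H^2 / u\<close> tuples, and only the sum over
  \<open>u\<close> gives a logarithm.\<close>

lemma card_imaginary_params:
  assumes H: "H \<ge> 1"
  shows "finite (imaginary_params H)"
    "real (card (imaginary_params H)) \<le> 3600 * (real H)\<^sup>2 * (1 + ln (20 * real H))"
proof -
  define q where "q = sqrt (20 * real H)"
  define r where "r u = sqrt (20 * real H / real u)" for u :: nat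
  define W where "W u = {x::nat. 1 \<le> x \<and> real x \<le> r u}" for u
  define X where "X = {x::int. \<bar>of_int x - 0\<bar> \<le> q}"
  define U where "U = {1..20 * H}"
  let ?T = "SIGMA u:U. W u \<times> W u \<times> X \<times> X"
  have q: "q \<ge> 1" "q\<^sup>2 = 20 * real H" using H by (simp_all add: q_def)
  have r: "r u \<ge> 0" "(r u)\<^sup>2 = 20 * real H / real u" for u by (simp_all add: r_def)
  have inW: "v \<in> W u" if "u \<ge> 1" "v \<ge> 1" "u * v\<^sup>2 \<le> 20 * H" for u v
  proof -
    have "real (u * v\<^sup>2) \<le> real (20 * H)" using that(3) by (simp only: of_nat_le_iff)
    then have "(real v)\<^sup>2 \<le> 20 * real H / real u" using that(1) by (simp add: field_simps)
    then have "real v \<le> r u" unfolding r_def by (rule real_le_rsqrt)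
    then show ?thesis using that by (simp add: W_def)
  qed
  have inX: "x \<in> X" if "x\<^sup>2 \<le> 20 * int H" for x
  proof -
    have "real_of_int (x\<^sup>2) \<le> real_of_int (20 * int H)" using that by (simp only: of_int_le_iff)
    then have "\<bar>of_int x\<bar> \<le> q" unfolding q_def by (intro real_le_rsqrt) simp
    then show ?thesis by (simp add: X_def)
  qed
  have sub: "imaginary_params H \<subseteq> ?T"
  proof
    fix t assume "t \<in> imaginary_params H"
    then obtain u v w x a where t: "t = (u, v, w, x, a)" and uvw: "u \<ge> 1" "v \<ge> 1" "w \<ge> 1"
      and le: "u * v\<^sup>2 \<le> 20 * H" "u * w\<^sup>2 \<le> 20 * H" "x\<^sup>2 \<le> 20 * int H" "a\<^sup>2 \<le> 20 * int H"
      by (auto simp: imaginary_params_def)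
    have "u \<le> u * v\<^sup>2" using uvw by simp
    then have "u \<in> U" using order_trans[OF _ le(1)] uvw by (simp add: U_def)
    then show "t \<in> ?T" using inW[OF uvw(1,2) le(1)] inW[OF uvw(1,3) le(2)] inX le by (simp add: t)
  qed
  have W: "finite (W u)" "real (card (W u)) \<le> r u" for u
    unfolding W_def using card_nat_le[OF r(1)] by auto
  have X: "finite X" "real (card X) \<le> 3 * q"
    unfolding X_def using card_int_near[of q 0] q by auto
  have fT: "finite ?T" using W X by (auto simp: U_def)
  show "finite (imaginary_params H)" using finite_subset[OF sub fT] .
  have each: "real (card (W u \<times> W u \<times> X \<times> X)) \<le> 3600 * (real H)\<^sup>2 * (1 / real u)" for u
  proof -
    have "(real (card (W u)) * real (card (W u))) * (real (card X) * real (card X)) \<le> (r u * r u) * ((3 * q) * (3 * q))"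
      using W X r q by (intro mult_mono) auto
    also have "\<dots> = 9 * (r u)\<^sup>2 * q\<^sup>2" by (simp add: power2_eq_square)
    also have "\<dots> = 3600 * (real H)\<^sup>2 * (1 / real u)" unfolding r q by (simp add: power2_eq_square)
    finally show ?thesis by (simp add: card_cartesian_product ac_simps)
  qed
  have "real (card ?T) = (\<Sum>u\<in>U. real (card (W u \<times> W u \<times> X \<times> X)))"
    using W X by (subst card_SigmaI) (auto simp: U_def)
  also have "\<dots> \<le> (\<Sum>u\<in>U. 3600 * (real H)\<^sup>2 * (1 / real u))" by (intro sum_mono each)
  also have "\<dots> = 3600 * (real H)\<^sup>2 * (\<Sum>u\<in>U. 1 / real u)" by (simp only: sum_distrib_left)
  also have "\<dots> \<le> 3600 * (real H)\<^sup>2 * (1 + ln (20 * real H))"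
    using sum_inverse_le_ln[of "20 * H"] H by (intro mult_left_mono) (auto simp: U_def)
  finally show "real (card (imaginary_params H)) \<le> 3600 * (real H)\<^sup>2 * (1 + ln (20 * real H))"
    using card_mono[OF fT sub] by linarith
qed

lemma card_small_products:
  assumes H: "H \<ge> 1"
  shows "finite (small_products H)" "real (card (small_products H)) \<le> 40 * real H * (1 + ln (4 * real H))"
proof -
  \<comment> \<open>For \<open>x = 0\<close> the bound on the product says nothing about
    \<open>a\<close>, and \<open>|a| \<le> 4 H\<close> takes over.\<close>
  define \<rho> where "\<rho> k = (if k = 0 then 4 * real H else 2 * real H / real k)" for k :: nat
  have \<rho>: "\<rho> k \<ge> 0" for k by (simp add: \<rho>_def)
  define A where "A x = {a::int. \<bar>of_int a - 0\<bar> \<le> \<rho> (nat \<bar>x\<bar>)}" for x :: int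
  let ?I = "{- int (4 * H)..int (4 * H)}"
  let ?T = "SIGMA x:?I. A x"
  have A: "finite (A x)" "real (card (A x)) \<le> 2 * \<rho> (nat \<bar>x\<bar>) + 1" for x
    unfolding A_def using card_int_near[OF \<rho>[of "nat \<bar>x\<bar>"], of 0] by auto
  have sub: "small_products H \<subseteq> ?T"
  proof
    fix t assume "t \<in> small_products H"
    then obtain x a where t: "t = (x, a)" and le: "\<bar>x\<bar> \<le> 4 * int H" "\<bar>a\<bar> \<le> 4 * int H" "\<bar>x * a\<bar> \<le> 2 * int H"
      by (auto simp: small_products_def)
    have "\<bar>real_of_int a\<bar> \<le> \<rho> (nat \<bar>x\<bar>)"
    proof (cases "x = 0")
      case True
      have "real_of_int \<bar>a\<bar> \<le> real_of_int (4 * int H)" using le(2) by (simp only: of_int_le_iff)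
      then show ?thesis using True by (simp add: \<rho>_def)
    next
      case False
      have "real_of_int \<bar>x * a\<bar> \<le> real_of_int (2 * int H)" using le(3) by (simp only: of_int_le_iff)
      then have "\<bar>of_int x\<bar> * \<bar>of_int a\<bar> \<le> 2 * real H" by (simp add: abs_mult)
      then show ?thesis using False by (simp add: \<rho>_def pos_le_divide_eq mult.commute)
    qed
    then show "t \<in> ?T" using le(1) by (auto simp: t A_def)
  qed
  have fT: "finite ?T" using A by auto
  show "finite (small_products H)" using finite_subset[OF sub fT] .
  have "real (card ?T) = (\<Sum>x\<in>?I. real (card (A x)))"
    using A by (subst card_SigmaI) auto
  also have "\<dots> \<le> (\<Sum>x\<in>?I. 2 * \<rho> (nat \<bar>x\<bar>) + 1)" by (intro sum_mono A)
  also have "\<dots> \<le> 2 * (\<Sum>k\<le>4 * H. 2 * \<rho> k + 1)"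
    by (rule sum_int_abs_le[where g = "\<lambda>k. 2 * \<rho> k + 1"]) (simp add: \<rho> add_nonneg_nonneg)
  also have "(\<Sum>k\<le>4 * H. 2 * \<rho> k + 1) = (8 * real H + 1) + (\<Sum>k=1..4 * H. 4 * real H * (1 / real k) + 1)"
  proof -
    have "{..4 * H} = insert 0 {1..4 * H}" by auto
    then show ?thesis by (simp add: \<rho>_def)
  qed
  also have "(\<Sum>k=1..4 * H. 4 * real H * (1 / real k) + 1) = 4 * real H * (\<Sum>k=1..4 * H. 1 / real k) + 4 * real H"
    by (simp only: sum.distrib sum_distrib_left) simp
  also have "\<dots> \<le> 4 * real H * (1 + ln (4 * real H)) + 4 * real H"
    using sum_inverse_le_ln[of "4 * H"] H by (intro add_right_mono mult_left_mono) auto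
  finally have "real (card ?T) \<le> 8 * real H * (1 + ln (4 * real H)) + 24 * real H + 2" by (simp add: algebra_simps)
  also have "\<dots> \<le> 8 * real H * (1 + ln (4 * real H)) + 32 * real H * (1 + ln (4 * real H))"
  proof -
    have "ln (4 * real H) \<ge> 0" using H by (simp add: ln_ge_zero)
    then have "32 * real H * 1 \<le> 32 * real H * (1 + ln (4 * real H))" by (intro mult_left_mono) auto
    moreover have "real H \<ge> 1" using H by simp
    ultimately show ?thesis by linarith
  qed
  finally show "real (card (small_products H)) \<le> 40 * real H * (1 + ln (4 * real H))"
    using card_mono[OF fT sub] by (simp add: algebra_simps)
qed

lemma card_resolvent_set:
  assumes H: "H \<ge> 3"
  shows "finite (resolvent_set H)"
    "real (card (resolvent_set H)) \<le> 10000000 * (real H)\<^sup>2 * (ln (real H))\<^sup>2"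
proof -
  have H1: "H \<ge> 1" using H by simp
  let ?I = "{-int H..int H}"
  let ?T1 = "(\<lambda>((x, a), b). (a, b, x * a div 2, x\<^sup>2 div 4)) ` (small_products H \<times> ?I)"
  let ?T2 = "(\<lambda>((x, a), d). (a, x + a\<^sup>2 div 4, x * a div 2, d)) ` (small_products H \<times> ?I)"
  let ?R = "\<lambda>\<epsilon>. decode 1 \<epsilon> ` real_params \<epsilon> H" and ?J = "\<lambda>\<epsilon>. decode (-1) \<epsilon> ` imaginary_params H"
  note cover = resolvent_set_cover[OF H1]
  have T: "(\<Union>\<epsilon>\<in>{1, -1}. ?R \<epsilon> \<union> ?J \<epsilon>) = (?R 1 \<union> ?J 1) \<union> (?R (-1) \<union> ?J (-1))" by blast
  note fins = card_small_products(1)[OF H1] card_real_params(1)[OF H1] card_imaginary_params(1)[OF H1]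
  have fT: "finite (?T1 \<union> ?T2 \<union> ((?R 1 \<union> ?J 1) \<union> (?R (-1) \<union> ?J (-1))))" using fins by simp
  show "finite (resolvent_set H)" using finite_subset[OF cover[unfolded T] fT] .
  define h l where "h = real H" and "l = ln h"
  have h: "h \<ge> 3" using H by (simp add: h_def)
  \<comment> \<open>\<open>H \<ge> 3\<close> exceeds \<open>exp 1\<close>, so
    \<open>l \<ge> 1\<close> and additive constants can be absorbed into multiples of
    \<open>l\<close>.\<close>
  have "ln h \<ge> ln (exp 1)" using exp_le h by (intro ln_mono) auto
  then have l: "l \<ge> 1" by (simp add: l_def)
  have c: "ln (k * h) \<le> k - 1 + l" if "k > 0" for k
    using ln_le_minus_one[OF that] that h by (simp add: ln_mult l_def)
  have c21: "1 + ln (21 * h\<^sup>2) \<le> 23 * l"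
    using ln_le_minus_one[of 21] h l by (simp add: ln_mult ln_realpow l_def)
  have c5: "1 + ln (5 * h) \<le> 6 * l" and c4: "1 + ln (4 * h) \<le> 5 * l" and c20: "1 + ln (20 * h) \<le> 21 * l"
    using c[of 5] c[of 4] c[of 20] l by auto
  have pos: "0 \<le> 1 + ln (k * h)" if "k \<ge> 1" for k
  proof -
    have "k * h \<ge> 1 * 1" using that h by (intro mult_mono) auto
    then show ?thesis by (simp add: ln_ge_zero)
  qed
  have B1: "real (card (small_products H)) \<le> 200 * h * l"
  proof -
    have "real (card (small_products H)) \<le> 40 * h * (1 + ln (4 * h))"
      using card_small_products(2)[OF H1] by (simp add: h_def)
    also have "\<dots> \<le> 40 * h * (5 * l)" using c4 h by (intro mult_left_mono) auto
    finally show ?thesis by simp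
  qed
  have B2: "real (card (small_products H \<times> ?I)) \<le> 600 * (h\<^sup>2 * l\<^sup>2)"
  proof -
    have "real (card (small_products H)) * (2 * h + 1) \<le> (200 * h * l) * (3 * h)"
      using B1 h l by (intro mult_mono) auto
    also have "\<dots> = 600 * h\<^sup>2 * l" by (simp add: power2_eq_square)
    also have "\<dots> \<le> 600 * h\<^sup>2 * l\<^sup>2" using l h by (intro mult_left_mono) (auto simp: power2_eq_square)
    finally show ?thesis by (simp add: card_cartesian_product h_def ac_simps)
  qed
  have B3: "real (card (real_params \<epsilon> H)) \<le> 1987200 * (h\<^sup>2 * l\<^sup>2)" for \<epsilon>
  proof -
    have "real (card (real_params \<epsilon> H)) \<le> 14400 * h\<^sup>2 * (1 + ln (21 * h\<^sup>2)) * (1 + ln (5 * h))"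
      using card_real_params(2)[OF H1, of \<epsilon>] by (simp add: h_def)
    also have "\<dots> \<le> 14400 * h\<^sup>2 * (23 * l) * (6 * l)"
      using c21 c5 pos[of 5] pos[of "21 * h"] l h
      by (intro mult_mono mult_nonneg_nonneg) (auto simp: power2_eq_square mult.assoc)
    finally show ?thesis by (simp add: power2_eq_square ac_simps)
  qed
  have B4: "real (card (imaginary_params H)) \<le> 75600 * (h\<^sup>2 * l\<^sup>2)"
  proof -
    have "real (card (imaginary_params H)) \<le> 3600 * h\<^sup>2 * (1 + ln (20 * h))"
      using card_imaginary_params(2)[OF H1] by (simp add: h_def)
    also have "\<dots> \<le> 3600 * h\<^sup>2 * (21 * l)" using c20 h by (intro mult_left_mono) auto
    also have "\<dots> = 75600 * (h\<^sup>2 * l)" by simp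
    also have "\<dots> \<le> 75600 * (h\<^sup>2 * l\<^sup>2)" using l h by (intro mult_left_mono) (auto simp: power2_eq_square)
    finally show ?thesis .
  qed
  have U: "real (card (X \<union> Y)) \<le> real (card X) + real (card Y)" for X Y :: "(int \<times> int \<times> int \<times> int) set"
    unfolding of_nat_add[symmetric] of_nat_le_iff by (rule card_Un_le)
  have "card ?T1 \<le> card (small_products H \<times> ?I)" "card ?T2 \<le> card (small_products H \<times> ?I)"
    "card (?R \<epsilon>) \<le> card (real_params \<epsilon> H)" "card (?J \<epsilon>) \<le> card (imaginary_params H)" for \<epsilon>
    by (rule card_image_le, use fins in simp)+
  then have C: "real (card ?T1) \<le> 600 * (h\<^sup>2 * l\<^sup>2)" "real (card ?T2) \<le> 600 * (h\<^sup>2 * l\<^sup>2)"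
    "real (card (?R \<epsilon>)) \<le> 1987200 * (h\<^sup>2 * l\<^sup>2)" "real (card (?J \<epsilon>)) \<le> 75600 * (h\<^sup>2 * l\<^sup>2)" for \<epsilon>
    using B2 B3[of \<epsilon>] B4 by (meson of_nat_mono order_trans)+
  have "real (card (resolvent_set H)) \<le> real (card (?T1 \<union> ?T2 \<union> ((?R 1 \<union> ?J 1) \<union> (?R (-1) \<union> ?J (-1)))))"
    using card_mono[OF fT cover[unfolded T]] by (simp only: of_nat_le_iff)
  \<comment> \<open>Twice \<open>600 + 1987200 + 75600\<close>, for the two degenerate cases and the
    two signs \<open>\<epsilon>\<close>, stays below this.\<close>
  also have "\<dots> \<le> 5000000 * (h\<^sup>2 * l\<^sup>2)"
    using U[of "?T1 \<union> ?T2" "(?R 1 \<union> ?J 1) \<union> (?R (-1) \<union> ?J (-1))"] U[of ?T1 ?T2]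
      U[of "?R 1 \<union> ?J 1" "?R (-1) \<union> ?J (-1)"] U[of "?R 1" "?J 1"] U[of "?R (-1)" "?J (-1)"]
      C(1,2) C(3,4)[of 1] C(3,4)[of "-1"]
    by linarith
  also have "\<dots> \<le> 10000000 * (h\<^sup>2 * l\<^sup>2)" by simp
  finally show "real (card (resolvent_set H)) \<le> 10000000 * (real H)\<^sup>2 * (ln (real H))\<^sup>2"
    by (simp add: h_def l_def)
qed

section \<open>The lower bound\<close>

lemma rational_sqrt_of_int:
  assumes "r \<in> \<rat>" "r\<^sup>2 = (of_int n :: complex)"
  shows "\<exists>m::int. n = m\<^sup>2"
proof -
  have "poly [:- of_int n, 0, 1:] r = 0" using assms(2) by (simp add: power2_eq_square)
  then have "algebraic_int r"
    by (intro algebraic_int.intros[of "[:- of_int n, 0, 1:]"]) (auto simp: coeff_pCons split: nat.splits)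
  then obtain m where m: "r = of_int m" using rational_algebraic_int_is_int[of r] assms(1) Ints_cases by blast
  have "(of_int n :: complex) = of_int (m\<^sup>2)" using assms(2) m by simp
  then show ?thesis by (intro exI[of _ m]) (simp only: of_int_eq_iff)
qed

lemma square_mod_3: "(m::int)\<^sup>2 mod 3 \<noteq> 2"
proof -
  have "m mod 3 \<in> {0, 1, 2}" by auto
  moreover have "m\<^sup>2 mod 3 = (m mod 3)\<^sup>2 mod 3" by (simp add: power_mod)
  ultimately show ?thesis by auto
qed

text \<open>Modulo 3 only \<open>- u (4 v)^2\<close> survives in \<open>nd\<close>, and it is
  \<open>-1\<close>; the factor \<open>u\<close> is 1 and changes nothing. A squarefree
  \<open>u \<ge> 2\<close> is no square, so \<open>s\<close> is irrational.\<close>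

lemma D4_family:
  fixes a w x v u :: int
  assumes w: "w \<noteq> 0" and dvd: "3 dvd a" "3 dvd w" "3 dvd x" and mod: "v mod 3 = 1" "u mod 3 = 1"
    and u: "squarefree u" "u \<ge> 2"
  defines "g \<equiv> quartic (2 * a) (2 * x + a\<^sup>2 - u * w\<^sup>2) (2 * (a * x - u * v * w)) (x\<^sup>2 - u * v\<^sup>2)"
  shows "galois_group g \<cong> D4" "irreducible (map_poly (of_int :: int \<Rightarrow> rat) g)"
proof -
  define nd where "nd = (a\<^sup>2 + u * w\<^sup>2 - 4 * x)\<^sup>2 - u * (2 * a * w - 4 * v)\<^sup>2"
  obtain a' w' x' v' u' where abs: "a = 3 * a'" "w = 3 * w'" "x = 3 * x'" "v = 3 * v' + 1" "u = 3 * u' + 1"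
    using dvd mod by (metis dvdE mult_div_mod_eq)
  have "\<exists>t. nd = 3 * t + 2"
  proof -
    define B where "B = 2 * a' * w - 4 * v'"
    have "nd = 9 * (3 * a'\<^sup>2 + u * 3 * w'\<^sup>2 - 4 * x')\<^sup>2 - (3 * u' + 1) * (3 * B - 4)\<^sup>2"
      unfolding nd_def abs(1,3) B_def using abs(2,4,5) by algebra
    also have "\<dots> = 3 * (3 * (3 * a'\<^sup>2 + u * 3 * w'\<^sup>2 - 4 * x')\<^sup>2 - u' * (3 * B - 4)\<^sup>2 - 3 * B\<^sup>2 + 8 * B - 6) + 2"
      by algebra
    finally show ?thesis by blast
  qed
  then obtain t where t: "nd = 3 * t + 2" ..
  then have nd: "nd mod 3 = 2" by simp
  define z where "z = u' * nd + t"
  have "u * nd = 3 * z + 2" using t abs(5) unfolding z_def by algebra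
  then have und: "(u * nd) mod 3 = 2" by simp
  have usq: "u \<noteq> m\<^sup>2" for m
  proof
    assume "u = m\<^sup>2"
    then have "m dvd 1" using u(1) by (auto simp: squarefree_def)
    then have "\<bar>m\<bar> = 1" by simp
    then have "m\<^sup>2 = 1" by (metis power2_abs power_one)
    then show False using u(2) \<open>u = m\<^sup>2\<close> by simp
  qed
  define s e1 e2 where "s = csqrt (of_int u)"
    and "e1 = csqrt ((of_int a + of_int w * s)\<^sup>2 - 4 * (of_int x + of_int v * s))"
    and "e2 = csqrt ((of_int a - of_int w * s)\<^sup>2 - 4 * (of_int x - of_int v * s))"
  interpret quadratic_norm a w x v u nd s e1 e2
  proof
    show "s \<notin> \<rat>" using rational_sqrt_of_int[of s u] usq by (auto simp: s_def)
    show "r\<^sup>2 \<noteq> of_int nd" "r\<^sup>2 \<noteq> of_int (u * nd)" if "r \<in> \<rat>" for r :: complex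
      using rational_sqrt_of_int[OF that] square_mod_3 nd und by metis+
  qed (simp_all add: w nd_def s_def e1_def e2_def)
  show "galois_group g \<cong> D4" "irreducible (map_poly (of_int :: int \<Rightarrow> rat) g)"
    using galois_D4 irreducible_f unfolding f_def g_def by auto
qed

text \<open>At every prime the multiplicity of a squarefree number is 0 or 1, so it is the parity of
  the multiplicity of the product.\<close>

lemma squarefree_times_square_unique:
  fixes u u' v v' :: nat
  assumes "squarefree u" "squarefree u'" "u * v\<^sup>2 = u' * v'\<^sup>2" "v \<noteq> 0" "v' \<noteq> 0"
  shows "u = u'" "v = v'"
proof -
  have u0: "u \<noteq> 0" "u' \<noteq> 0" using assms(1,2) by (auto intro: Nat.gr0I)
  show uu: "u = u'"
  proof (rule multiplicity_eq_nat)
    fix p :: nat assume p: "prime p"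
    have "multiplicity p (u * v\<^sup>2) = multiplicity p u + 2 * multiplicity p v"
      "multiplicity p (u' * v'\<^sup>2) = multiplicity p u' + 2 * multiplicity p v'"
      using p u0 assms(4,5)
      by (simp_all add: prime_elem_multiplicity_mult_distrib prime_elem_multiplicity_power_distrib)
    moreover have "multiplicity p u \<le> 1" "multiplicity p u' \<le> 1"
      using assms(1,2) p u0 by (auto simp: squarefree_factorial_semiring'')
    moreover have "multiplicity p (u * v\<^sup>2) = multiplicity p (u' * v'\<^sup>2)" using assms(3) by simp
    moreover have "i = k" if "i + 2 * j = k + 2 * l" "i \<le> 1" "k \<le> 1" for i j k l :: nat
      using that by presburger
    ultimately show "multiplicity p u = multiplicity p u'" by metis
  qed (use u0 in auto)
  then show "v = v'" using assms(3) u0 by simp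
qed

section \<open>Harmonic sum over squarefree numbers\<close>

definition sqfree_set :: "nat \<Rightarrow> nat set" where
  "sqfree_set k = {u \<in> {2..k\<^sup>2}. squarefree u \<and> u mod 3 = 1}"

lemma sum_inverse_squares_le: "(\<Sum>q=1..n. 1 / (real q)\<^sup>2) \<le> 2"
proof -
  have "(\<Sum>q=1..n. 1 / (real q)\<^sup>2) \<le> 2 - 1 / real n" if "n \<ge> 1"
    using that
  proof (induction n rule: dec_induct)
    case (step n)
    have "1 / (real (Suc n))\<^sup>2 \<le> 1 / real n - 1 / real (Suc n)"
      using step.hyps by (simp add: divide_simps power2_eq_square)
    then show ?case using step by (simp add: sum.cl_ivl_Suc)
  qed simp
  then show ?thesis by (cases "n \<ge> 1") (auto intro: order_trans)
qed

lemma sqfree_part_mod_3: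
  fixes n :: nat
  assumes "n mod 3 = 1"
  shows "squarefree_part n mod 3 = 1"
proof -
  define s q where "s = squarefree_part n" and "q = square_part n"
  have n: "n = s * q\<^sup>2" unfolding s_def q_def by (rule squarefree_decompose)
  have "n mod 3 = (s mod 3) * ((q mod 3) * (q mod 3)) mod 3"
    unfolding n power2_eq_square by (rule mod_mult_cong[OF _ mod_mult_cong]) simp_all
  then have *: "(s mod 3) * ((q mod 3) * (q mod 3)) mod 3 = 1" using assms by simp
  have "j = 1" if "j * (i * i) mod 3 = 1" "j < 3" "i < 3" for i j :: nat
  proof -
    have "i = 0 \<or> i = 1 \<or> i = 2" "j = 0 \<or> j = 1 \<or> j = 2" using that(2,3) by auto
    then show ?thesis using that(1) by (elim disjE) simp_all
  qed
  from this[OF *] have "s mod 3 = 1" by simp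
  then show ?thesis by (simp only: s_def)
qed

text \<open>Writing each \<open>n = 3 m + 1\<close> as a squarefree \<open>s\<close> times a square
  \<open>q^2\<close> bounds the sum of \<open>1/n\<close> by the sum of \<open>1/s\<close> times
  that of \<open>1/q^2\<close>, which is at most 2. With \<open>1/m \<le> 4 / (3 m + 1)\<close> this
  makes the factor 8. The loss of 1 comes from the squarefree part 1, which is left out of
  \<open>sqfree_set\<close> because \<open>u = 1\<close> has a rational square root.
  \<open>k \<ge> 4\<close> gives \<open>3 k + 1 \<le> k^2\<close>.\<close>

lemma sum_sqfree_set_ge:
  assumes k: "k \<ge> 4"
  shows "ln (real k) / 8 - 1 \<le> (\<Sum>u\<in>sqfree_set k. 1 / real u)"
proof -
  let ?U = "insert 1 (sqfree_set k)"
  define N where "N = (\<lambda>m. 3 * m + 1) ` {1..k}"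
  define \<phi> where "\<phi> n = (squarefree_part n, square_part n)" for n :: nat
  have n: "squarefree_part n * (square_part n)\<^sup>2 = n" for n :: nat
    by (rule squarefree_decompose[symmetric])
  have inj: "inj_on \<phi> N"
    by (rule inj_onI) (auto simp: \<phi>_def intro: squarefree_decomposition_unique)
  have fin: "finite (sqfree_set k)" by (simp add: sqfree_set_def)
  have sub: "\<phi> ` N \<subseteq> ?U \<times> {1..k}"
  proof
    fix t assume "t \<in> \<phi> ` N"
    then obtain n where t: "t = \<phi> n" and "n \<in> N" by auto
    then have n1: "n \<ge> 1" "n \<le> 3 * k + 1" "n mod 3 = 1" unfolding N_def by auto
    have "3 * k + 1 \<le> 4 * k" using k by simp
    also have "\<dots> \<le> k * k" using k by (intro mult_right_mono) auto
    finally have nk: "n \<le> k\<^sup>2" using n1 by (simp add: power2_eq_square)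
    have pos: "squarefree_part n \<ge> 1" "square_part n \<ge> 1"
      using n[of n] n1 by (auto simp: Suc_le_eq intro!: Nat.gr0I)
    have "squarefree_part n * 1 \<le> squarefree_part n * (square_part n)\<^sup>2"
      using pos by (intro mult_left_mono) auto
    then have 1: "squarefree_part n \<le> k\<^sup>2" using n[of n] nk by simp
    have "1 * (square_part n)\<^sup>2 \<le> squarefree_part n * (square_part n)\<^sup>2"
      using pos by (intro mult_right_mono) auto
    then have "(square_part n)\<^sup>2 \<le> n" using n[of n] by simp
    then have "(square_part n)\<^sup>2 \<le> k\<^sup>2" using nk by (rule order_trans)
    then have "square_part n \<le> k" by (rule power2_le_imp_le) simp
    moreover have "squarefree_part n \<in> ?U"
      using 1 pos sqfree_part_mod_3[OF n1(3)] by (auto simp: sqfree_set_def)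
    ultimately show "t \<in> ?U \<times> {1..k}" using pos by (simp add: t \<phi>_def)
  qed
  have "ln (real (Suc k) / real 1) \<le> (\<Sum>m=1..<Suc k. 1 / real m)" by (rule sum_inverse_ge_ln) auto
  moreover have "ln (real k) \<le> ln (real (Suc k))" using k by simp
  ultimately have "ln (real k) \<le> (\<Sum>m=1..k. 1 / real m)" by (simp add: atLeastLessThanSuc_atLeastAtMost)
  also have "\<dots> \<le> (\<Sum>m=1..k. 4 * (1 / real (3 * m + 1)))"
    by (intro sum_mono) (simp add: field_simps)
  also have "\<dots> = 4 * (\<Sum>n\<in>N. 1 / real n)"
    unfolding N_def by (subst sum.reindex) (auto simp: inj_on_def sum_distrib_left)
  also have "(\<Sum>n\<in>N. 1 / real n) = (\<Sum>n\<in>N. (\<lambda>(s, q). 1 / real s * (1 / (real q)\<^sup>2)) (\<phi> n))"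
  proof (rule sum.cong[OF refl])
    fix m
    have "real m = real (squarefree_part m) * (real (square_part m))\<^sup>2"
      unfolding of_nat_power[symmetric] of_nat_mult[symmetric] n ..
    then show "1 / real m = (\<lambda>(s, q). 1 / real s * (1 / (real q)\<^sup>2)) (\<phi> m)" by (simp add: \<phi>_def)
  qed
  also have "\<dots> = (\<Sum>t\<in>\<phi> ` N. (\<lambda>(s, q). 1 / real s * (1 / (real q)\<^sup>2)) t)"
    by (simp add: sum.reindex[OF inj])
  also have "\<dots> \<le> (\<Sum>t\<in>?U \<times> {1..k}. (\<lambda>(s, q). 1 / real s * (1 / (real q)\<^sup>2)) t)"
    by (intro sum_mono2 sub) (auto simp: fin)
  also have "\<dots> = (\<Sum>s\<in>?U. 1 / real s) * (\<Sum>q=1..k. 1 / (real q)\<^sup>2)"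
    by (simp only: sum_product sum.cartesian_product)
  also have "\<dots> \<le> (\<Sum>s\<in>?U. 1 / real s) * 2"
    by (intro mult_left_mono sum_inverse_squares_le sum_nonneg) auto
  also have "(\<Sum>s\<in>?U. 1 / real s) = 1 + (\<Sum>s\<in>sqfree_set k. 1 / real s)"
    using fin by (subst sum.insert) (auto simp: sqfree_set_def)
  finally show ?thesis by simp
qed

section \<open>The family of the lower bound\<close>

definition D4_set :: "nat \<Rightarrow> (int \<times> int \<times> int \<times> int) set" where
  "D4_set H = {(a, b, c, d). a \<in> {-int H..int H} \<and> b \<in> {-int H..int H} \<and>
      c \<in> {-int H..int H} \<and> d \<in> {-int H..int H} \<and>
      irreducible (map_poly (of_int :: int \<Rightarrow> rat) (quartic a b c d)) \<and>
      galois_group (quartic a b c d) \<cong> D4}"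

lemma N_D4_eq: "N_D4 H = card (D4_set H)"
  by (simp add: N_D4_def D4_set_def)

lemma finite_D4_set: "finite (D4_set H)"
proof (rule finite_subset)
  let ?I = "{-int H..int H}"
  show "D4_set H \<subseteq> ?I \<times> ?I \<times> ?I \<times> ?I" by (auto simp: D4_set_def)
qed auto

lemma N_D4_mono: "H \<le> H' \<Longrightarrow> N_D4 H \<le> N_D4 H'"
  unfolding N_D4_eq by (rule card_mono[OF finite_D4_set]) (auto simp: D4_set_def)

text \<open>The integer part of \<open>\<nu>\<close>, where \<open>p \<nu> = 3 k^4\<close> for
  \<open>p = sqrt u v\<close>: moving \<open>x\<close> by at most \<open>3 \<nu>\<close> above
  \<open>p\<close> changes \<open>x^2 - p^2\<close> only by order \<open>k^4\<close>. The factor 3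
  ensures \<open>\<nu> \<ge> 1\<close>, since \<open>p \<le> k (3 k^3)\<close>.\<close>

definition num_steps :: "nat \<Rightarrow> nat \<Rightarrow> nat \<Rightarrow> nat" where
  "num_steps k u v = nat \<lfloor>3 * real k ^ 4 / (sqrt (real u) * real v)\<rfloor>"

text \<open>Multiples of 3 serve the congruences of \<open>D4_family\<close>; index 0 gives the
  least one not below \<open>sqrt u v\<close>.\<close>

definition multiple_above :: "nat \<Rightarrow> nat \<Rightarrow> nat \<Rightarrow> int" where
  "multiple_above u v i = 3 * (\<lceil>sqrt (real u) * real v / 3\<rceil> + int i)"

text \<open>\<open>v = 3 t + 1\<close> and \<open>w = 3 r\<close> meet the congruences. The
  \<open>v\<close> values of \<open>r\<close> turn the \<open>1/v^2\<close> from the pairs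
  \<open>(i, j)\<close> into \<open>1/v\<close>. The upper limit on \<open>t\<close> keeps the
  intervals from becoming too short, the lower limit keeps the square of their length within order
  \<open>k^4\<close>, and the ratio \<open>k\<close> between the limits leaves a sum of
  \<open>1/t\<close> of size \<open>ln k\<close>.\<close>

definition family_params :: "nat \<Rightarrow> (nat \<times> nat \<times> nat \<times> nat \<times> nat) set" where
  "family_params k = (SIGMA u:sqfree_set k. SIGMA t:{k\<^sup>2..<k ^ 3}. {3 * t + 1..<2 * (3 * t + 1)} \<times>
      {..<num_steps k u (3 * t + 1)} \<times> {..<num_steps k u (3 * t + 1)})"

definition encode :: "nat \<times> nat \<times> nat \<times> nat \<times> nat \<Rightarrow> int \<times> int \<times> int \<times> int" where
  "encode = (\<lambda>(u, t, r, i, j).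
     let v = int (3 * t + 1); w = int (3 * r); x = multiple_above u (3 * t + 1) i; a = multiple_above u (3 * r) j
     in (2 * a, 2 * x + a\<^sup>2 - int u * w\<^sup>2, 2 * (a * x - int u * v * w), x\<^sup>2 - int u * v\<^sup>2))"

text \<open>With \<open>x = p + \<eta>\<close> and \<open>a = q + \<zeta>\<close> the large terms
  \<open>p^2\<close>, \<open>q^2\<close> and \<open>p q\<close> cancel; apart from
  \<open>2 a\<close> and \<open>2 x\<close> only products with a small factor \<open>\<eta>\<close>
  or \<open>\<zeta>\<close> remain. The largest bound, \<open>144 = 2 (9 + 54 + 9)\<close>, belongs
  to \<open>2 (a x - p q)\<close>.\<close>

lemma coefficient_bounds:
  fixes x a p q \<nu> m :: real
  assumes x: "p \<le> x" "x \<le> p + 3 * \<nu>" and a: "q \<le> a" "a \<le> q + 3 * \<nu>"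
    and p: "p > 0" "p \<le> 3 * m" "p * \<nu> = 3 * m" and q: "q \<ge> 0" "q \<le> 6 * p"
    and \<nu>: "\<nu> > 0" "\<nu>\<^sup>2 \<le> m" "\<nu> \<le> m"
  shows "2 * a \<in> {0..144 * m}" "2 * x + a\<^sup>2 - q\<^sup>2 \<in> {0..144 * m}"
    "2 * (a * x - p * q) \<in> {0..144 * m}" "x\<^sup>2 - p\<^sup>2 \<in> {0..144 * m}"
proof -
  define \<eta> \<zeta> where "\<eta> = x - p" and "\<zeta> = a - q"
  have \<eta>: "0 \<le> \<eta>" "\<eta> \<le> 3 * \<nu>" and \<zeta>: "0 \<le> \<zeta>" "\<zeta> \<le> 3 * \<nu>" using x a by (auto simp: \<eta>_def \<zeta>_def)
  have m: "m > 0" using \<nu> by linarith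
  have "p * \<eta> \<le> p * (3 * \<nu>)" "p * \<zeta> \<le> p * (3 * \<nu>)" using p \<eta> \<zeta> by (auto intro!: mult_left_mono)
  then have 1: "p * \<eta> \<le> 9 * m" "p * \<zeta> \<le> 9 * m" using p(3) by auto
  have "q * \<eta> \<le> (6 * p) * (3 * \<nu>)" "q * \<zeta> \<le> (6 * p) * (3 * \<nu>)"
    using mult_mono[OF q(2) \<eta>(2)] mult_mono[OF q(2) \<zeta>(2)] p(1) \<eta> \<zeta> by simp_all
  then have 2: "q * \<eta> \<le> 54 * m" "q * \<zeta> \<le> 54 * m" using p(3) by auto
  have "\<eta> * \<eta> \<le> (3 * \<nu>) * (3 * \<nu>)" "\<zeta> * \<zeta> \<le> (3 * \<nu>) * (3 * \<nu>)" "\<eta> * \<zeta> \<le> (3 * \<nu>) * (3 * \<nu>)"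
    using mult_mono[OF \<eta>(2,2)] mult_mono[OF \<zeta>(2,2)] mult_mono[OF \<eta>(2) \<zeta>(2)] \<eta> \<zeta> by simp_all
  then have 3: "\<eta> * \<eta> \<le> 9 * m" "\<zeta> * \<zeta> \<le> 9 * m" "\<eta> * \<zeta> \<le> 9 * m" using \<nu>(2) by (auto simp: power2_eq_square)
  have 0: "0 \<le> p * \<eta>" "0 \<le> p * \<zeta>" "0 \<le> q * \<eta>" "0 \<le> q * \<zeta>" "0 \<le> \<eta> * \<eta>" "0 \<le> \<zeta> * \<zeta>" "0 \<le> \<eta> * \<zeta>"
    using p q \<eta> \<zeta> by auto
  have e: "x\<^sup>2 - p\<^sup>2 = 2 * (p * \<eta>) + \<eta> * \<eta>" "a\<^sup>2 - q\<^sup>2 = 2 * (q * \<zeta>) + \<zeta> * \<zeta>"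
    "a * x - p * q = p * \<zeta> + q * \<eta> + \<eta> * \<zeta>"
    unfolding \<eta>_def \<zeta>_def by algebra+
  show "x\<^sup>2 - p\<^sup>2 \<in> {0..144 * m}" unfolding e using 0 1 3 m by auto
  show "2 * (a * x - p * q) \<in> {0..144 * m}" unfolding e using 0 1 2 3 m by auto
  show "2 * a \<in> {0..144 * m}" using a q p(1,2) \<nu> m by auto
  have "2 * x + (a\<^sup>2 - q\<^sup>2) \<in> {0..144 * m}" unfolding e using 0 2 3 m x p(1,2) \<nu> by auto
  then show "2 * x + a\<^sup>2 - q\<^sup>2 \<in> {0..144 * m}" by (simp add: algebra_simps)
qed

lemma multiple_above_bounds:
  "sqrt (real u) * real v \<le> of_int (multiple_above u v i)"
  "of_int (multiple_above u v i) \<le> sqrt (real u) * real v + 3 * (real i + 1)"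
  unfolding multiple_above_def by (simp_all add: algebra_simps) linarith+

text \<open>The ranges of \<open>u\<close> and \<open>t\<close> put \<open>p\<close> between
  \<open>3 k^2\<close> and \<open>3 k^4\<close>, hence \<open>\<nu>\<close> between 1 and
  \<open>k^2\<close>. Rounding down a number that is at least 1 at most halves it.\<close>

lemma num_steps_bounds:
  assumes k: "k \<ge> 1" and u: "u \<in> sqfree_set k" and t: "t \<in> {k\<^sup>2..<k ^ 3}"
  defines "p \<equiv> sqrt (real u) * real (3 * t + 1)"
  defines "\<nu> \<equiv> 3 * real k ^ 4 / p"
  shows "p > 0" "p \<le> 3 * real k ^ 4" "p * \<nu> = 3 * real k ^ 4" "\<nu>\<^sup>2 \<le> real k ^ 4" "\<nu> \<le> real k ^ 4" "\<nu> \<ge> 1"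
    "real (num_steps k u (3 * t + 1)) \<le> \<nu>" "\<nu> \<le> 2 * real (num_steps k u (3 * t + 1))"
proof -
  have u2: "u \<ge> 2" "u \<le> k\<^sup>2" using u by (auto simp: sqfree_set_def)
  have s: "sqrt (real u) \<ge> 1" using u2 by simp
  have "real u \<le> (real k)\<^sup>2" using u2(2) by (simp flip: of_nat_power)
  then have sk: "sqrt (real u) \<le> real k" by (rule real_le_lsqrt[rotated]) simp
  show p: "p > 0" unfolding p_def using s by (intro mult_pos_pos) auto
  have "3 * t + 1 \<le> 3 * k ^ 3" using t by simp
  then have "real (3 * t + 1) \<le> real (3 * k ^ 3)" by (simp only: of_nat_le_iff)
  then have "p \<le> real k * (3 * real k ^ 3)" unfolding p_def using sk s by (intro mult_mono) auto
  then show pk: "p \<le> 3 * real k ^ 4" by (simp add: eval_nat_numeral algebra_simps)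
  show pn: "p * \<nu> = 3 * real k ^ 4" using p by (simp add: \<nu>_def)
  show \<nu>1: "\<nu> \<ge> 1" using p pk by (simp add: \<nu>_def)
  have "k\<^sup>2 \<le> t" using t by simp
  then have "(real k)\<^sup>2 \<le> real t" by (metis of_nat_le_iff of_nat_power)
  then have "3 * (real k)\<^sup>2 \<le> real (3 * t + 1)" by linarith
  from mult_mono[OF s this] have "3 * (real k)\<^sup>2 \<le> p" by (simp add: p_def)
  then have "3 * (real k)\<^sup>2 * \<nu> \<le> p * \<nu>" using \<nu>1 by (intro mult_right_mono) auto
  also have "\<dots> = 3 * (real k)\<^sup>2 * (real k)\<^sup>2" unfolding pn by (simp add: power2_eq_square power4_eq_xxxx)
  finally have \<nu>k: "\<nu> \<le> (real k)\<^sup>2"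
    by (rule mult_left_le_imp_le) (use k in simp)
  have "\<nu>\<^sup>2 \<le> ((real k)\<^sup>2)\<^sup>2" using \<nu>k \<nu>1 by (intro power_mono) auto
  then show "\<nu>\<^sup>2 \<le> real k ^ 4" by simp
  have "(real k)\<^sup>2 \<le> real k ^ 4" using k by (intro power_increasing) auto
  then show "\<nu> \<le> real k ^ 4" using \<nu>k by linarith
  have "1 \<le> \<lfloor>\<nu>\<rfloor>" using \<nu>1 by simp
  have n: "real (num_steps k u (3 * t + 1)) = of_int \<lfloor>\<nu>\<rfloor>"
    using \<nu>1 by (simp add: num_steps_def \<nu>_def p_def)
  show "real (num_steps k u (3 * t + 1)) \<le> \<nu>" "\<nu> \<le> 2 * real (num_steps k u (3 * t + 1))"
    unfolding n using \<open>1 \<le> \<lfloor>\<nu>\<rfloor>\<close> by linarith+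
qed

lemma squarefree_int:
  assumes "squarefree u"
  shows "squarefree (int u)"
  unfolding squarefree_def
proof (intro allI impI)
  fix x :: int assume "x\<^sup>2 dvd int u"
  then have "int ((nat \<bar>x\<bar>)\<^sup>2) dvd int u" by simp
  then have "(nat \<bar>x\<bar>)\<^sup>2 dvd u" by (simp only: of_nat_dvd_iff)
  then have "nat \<bar>x\<bar> dvd 1" using assms by (simp add: squarefree_def)
  then show "x dvd 1" by auto
qed

lemma encode_mem:
  assumes k: "k \<ge> 1" and P: "(u, t, r, i, j) \<in> family_params k"
  shows "encode (u, t, r, i, j) \<in> D4_set (144 * k ^ 4)"
proof -
  define v where "v = 3 * t + 1"
  have u: "u \<in> sqfree_set k" and t: "t \<in> {k\<^sup>2..<k ^ 3}" and r: "v \<le> r" "r < 2 * v"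
    and ij: "i < num_steps k u v" "j < num_steps k u v"
    using P by (auto simp: family_params_def v_def)
  define p where "p = sqrt (real u) * real v"
  define q where "q = sqrt (real u) * real (3 * r)"
  define \<nu> where "\<nu> = 3 * real k ^ 4 / p"
  note bd = num_steps_bounds[OF k u t, folded v_def, folded p_def, folded \<nu>_def]
  define x where "x = multiple_above u v i"
  define a where "a = multiple_above u (3 * r) j"
  define w where "w = 3 * int r"
  have "real i + 1 \<le> real (num_steps k u v)" "real j + 1 \<le> real (num_steps k u v)" using ij by auto
  then have ij': "real i + 1 \<le> \<nu>" "real j + 1 \<le> \<nu>" using bd(7) by auto
  have x: "p \<le> of_int x" "of_int x \<le> p + 3 * \<nu>" and a: "q \<le> of_int a" "of_int a \<le> q + 3 * \<nu>"
    using multiple_above_bounds[of u v i, folded x_def p_def]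
      multiple_above_bounds[of u "3 * r" j, folded a_def q_def] ij'
    by simp_all
  have "real (3 * r) \<le> 6 * real v" using r by simp
  then have "q \<le> sqrt (real u) * (6 * real v)" unfolding q_def by (intro mult_left_mono) auto
  then have q: "q \<ge> 0" "q \<le> 6 * p" by (auto simp: q_def p_def)
  have "\<nu> > 0" using bd(6) by simp
  note cb = coefficient_bounds[OF x a bd(1-3) q this bd(4,5)]
  have sq: "p\<^sup>2 = of_int (int u * (int v)\<^sup>2)" "q\<^sup>2 = of_int (int u * w\<^sup>2)" "p * q = of_int (int u * int v * w)"
    unfolding p_def q_def w_def by (simp_all add: power_mult_distrib)
  define h where "h = int (144 * k ^ 4)"
  have h: "144 * real k ^ 4 = of_int h" by (simp add: h_def)
  have range: "y \<in> {-h..h}" if "of_int y \<in> {0..144 * real k ^ 4}" for y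
    using that unfolding h by auto
  have R: "2 * a \<in> {-h..h}" "2 * x + a\<^sup>2 - int u * w\<^sup>2 \<in> {-h..h}"
    "2 * (a * x - int u * int v * w) \<in> {-h..h}" "x\<^sup>2 - int u * (int v)\<^sup>2 \<in> {-h..h}"
    by (rule range; use cb[unfolded sq] in simp)+
  have u': "squarefree u" "u \<ge> 2" "u mod 3 = 1" using u by (auto simp: sqfree_set_def)
  have "squarefree (int u)" using u'(1) by (rule squarefree_int)
  moreover have "int u mod 3 = 1" using u'(3) by (metis of_nat_1 of_nat_mod of_nat_numeral)
  moreover have "int v mod 3 = 1" by (simp add: v_def)
  moreover have "w \<noteq> 0" using r by (simp add: w_def v_def)
  moreover have "3 dvd a" "3 dvd w" "3 dvd x" by (simp_all add: a_def w_def x_def multiple_above_def)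
  ultimately have "galois_group (quartic (2 * a) (2 * x + a\<^sup>2 - int u * w\<^sup>2) (2 * (a * x - int u * int v * w))
        (x\<^sup>2 - int u * (int v)\<^sup>2)) \<cong> D4"
    "irreducible (map_poly (of_int :: int \<Rightarrow> rat) (quartic (2 * a) (2 * x + a\<^sup>2 - int u * w\<^sup>2)
        (2 * (a * x - int u * int v * w)) (x\<^sup>2 - int u * (int v)\<^sup>2)))"
    using D4_family[of w a x "int v" "int u"] u'(2) by auto
  moreover have "encode (u, t, r, i, j) = (2 * a, 2 * x + a\<^sup>2 - int u * w\<^sup>2,
      2 * (a * x - int u * int v * w), x\<^sup>2 - int u * (int v)\<^sup>2)"
    unfolding encode_def Let_def prod.case a_def x_def v_def w_def by simp
  ultimately show ?thesis
    using R unfolding D4_set_def h_def by simp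
qed

text \<open>The quartic together with the root \<open>2 x\<close> of its cubic resolvent determines all parameters,
  so \<open>encode\<close> is at most three-to-one.\<close>

lemma encode_eqD:
  assumes P: "(u, t, r, i, j) \<in> family_params k" "(u', t', r', i', j') \<in> family_params k"
    and eq: "encode (u, t, r, i, j) = encode (u', t', r', i', j')"
    and x: "multiple_above u (3 * t + 1) i = multiple_above u' (3 * t' + 1) i'"
  shows "(u, t, r, i, j) = (u', t', r', i', j')"
proof -
  have sf: "squarefree u" "squarefree u'" "r \<noteq> 0" "r' \<noteq> 0" using P by (auto simp: family_params_def sqfree_set_def)
  have a: "multiple_above u (3 * r) j = multiple_above u' (3 * r') j'"
    using eq by (simp add: encode_def Let_def)
  have "int u * (int (3 * t + 1))\<^sup>2 = int u' * (int (3 * t' + 1))\<^sup>2"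
    using eq x by (simp add: encode_def Let_def)
  then have "int (u * (3 * t + 1)\<^sup>2) = int (u' * (3 * t' + 1)\<^sup>2)" by (simp only: of_nat_mult of_nat_power)
  then have "u * (3 * t + 1)\<^sup>2 = u' * (3 * t' + 1)\<^sup>2" by (simp only: of_nat_eq_iff)
  from squarefree_times_square_unique[OF sf(1,2) this] have ut: "u = u'" "t = t'" by auto
  have "int u * (int (3 * r))\<^sup>2 = int u' * (int (3 * r'))\<^sup>2"
    using eq x a by (simp add: encode_def Let_def)
  then have "int (u * (3 * r)\<^sup>2) = int (u' * (3 * r')\<^sup>2)" by (simp only: of_nat_mult of_nat_power)
  then have "u * (3 * r)\<^sup>2 = u' * (3 * r')\<^sup>2" by (simp only: of_nat_eq_iff)
  from squarefree_times_square_unique[OF sf(1,2) this] have r: "r = r'" using sf by auto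
  show ?thesis using a x ut r by (auto simp: multiple_above_def)
qed

lemma finite_family_params: "finite (family_params k)"
  unfolding family_params_def sqfree_set_def by auto

lemma card_encode_fibre: "card {T \<in> family_params k. encode T = (a, b, c, d)} \<le> 3"
proof -
  let ?S = "{T \<in> family_params k. encode T = (a, b, c, d)}"
  \<comment> \<open>The quadratic factor has constant term \<open>x + v s\<close>, without
    denominator 2, so its conjugate product has resolvent root \<open>2 x\<close>; \<open>p\<close>
    below is the cubic resolvent.\<close>
  define X where "X = (\<lambda>(u, t, r :: nat, i, j :: nat). 2 * multiple_above u (3 * t + 1) i)"
  define p where "p = [:4 * b * d - a\<^sup>2 * d - c\<^sup>2, a * c - 4 * d, - b, 1:]"
  have "inj_on X ?S"
  proof (rule inj_onI)
    fix T T' assume T: "T \<in> ?S" "T' \<in> ?S" and X: "X T = X T'"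
    obtain u t r i j where T1: "T = (u, t, r, i, j)" by (cases T)
    obtain u' t' r' i' j' where T2: "T' = (u', t', r', i', j')" by (cases T')
    show "T = T'"
      unfolding T1 T2 by (rule encode_eqD[of _ _ _ _ _ k]) (use T X in \<open>simp_all add: T1 T2 X_def\<close>)
  qed
  then have "card ?S = card (X ` ?S)" by (simp add: card_image)
  also have "\<dots> \<le> card {z. poly p z = 0}"
  proof (rule card_mono)
    show "finite {z. poly p z = 0}" by (rule poly_roots_finite) (simp add: p_def)
    show "X ` ?S \<subseteq> {z. poly p z = 0}"
    proof
      fix z assume "z \<in> X ` ?S"
      then obtain u t r i j where T: "encode (u, t, r, i, j) = (a, b, c, d)" "z = X (u, t, r, i, j)" by auto
      define v w x y where "v = int (3 * t + 1)" and "w = int (3 * r)"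
        and "x = multiple_above u (3 * t + 1) i" and "y = multiple_above u (3 * r) j"
      have co: "a = 2 * y" "b = 2 * x + y\<^sup>2 - int u * w\<^sup>2" "c = 2 * (y * x - int u * v * w)"
        "d = x\<^sup>2 - int u * v\<^sup>2" "z = 2 * x"
        using T unfolding encode_def Let_def prod.case X_def v_def w_def x_def y_def by auto
      have "poly p z = 4 * b * d - a\<^sup>2 * d - c\<^sup>2 + z * (a * c - 4 * d + z * (- b + z))"
        by (simp add: p_def)
      also have "\<dots> = 0" unfolding co by algebra
      finally show "z \<in> {z. poly p z = 0}" by simp
    qed
  qed
  also have "\<dots> \<le> degree p" by (rule card_poly_roots_bound) (simp add: p_def)
  also have "\<dots> \<le> 3" by (simp add: p_def)
  finally show ?thesis .
qed

lemma card_family_params_le: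
  assumes "k \<ge> 1"
  shows "card (family_params k) \<le> 3 * N_D4 (144 * k ^ 4)"
proof -
  let ?P = "family_params k" and ?D = "D4_set (144 * k ^ 4)"
  have "encode T \<in> ?D" if "T \<in> ?P" for T
    using encode_mem[OF assms] that by (cases T) auto
  then have "?P \<subseteq> (\<Union>y\<in>?D. {T \<in> ?P. encode T = y})" by auto
  then have "card ?P \<le> card (\<Union>y\<in>?D. {T \<in> ?P. encode T = y})"
    using finite_D4_set finite_family_params by (intro card_mono) auto
  also have "\<dots> \<le> (\<Sum>y\<in>?D. card {T \<in> ?P. encode T = y})" by (rule card_UN_le[OF finite_D4_set])
  also have "\<dots> \<le> (\<Sum>y\<in>?D. 3)"
  proof (rule sum_mono)
    fix y show "card {T \<in> ?P. encode T = y} \<le> 3" using card_encode_fibre by (cases y) auto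
  qed
  finally show ?thesis by (simp add: N_D4_eq mult.commute)
qed

lemma card_family_params_ge:
  assumes k: "k \<ge> 4"
  shows "real k ^ 8 * ln (real k) * (ln (real k) / 8 - 1) / 2 \<le> real (card (family_params k))"
proof -
  define m where "m = real k ^ 4"
  let ?n = "\<lambda>u t. num_steps k u (3 * t + 1)"
  let ?B = "\<lambda>u t. {3 * t + 1..<2 * (3 * t + 1)} \<times> {..<?n u t} \<times> {..<?n u t}"
  have fin: "finite (sqfree_set k)" by (simp add: sqfree_set_def)
  have each: "m\<^sup>2 / 2 * (1 / real u * (1 / real t)) \<le> real (card (?B u t))"
    if ut: "u \<in> sqfree_set k" "t \<in> {k\<^sup>2..<k ^ 3}" for u t
  proof -
    define v where "v = real (3 * t + 1)"
    define p where "p = sqrt (real u) * v"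
    define \<nu> where "\<nu> = 3 * m / p"
    have bd: "p > 0" "\<nu> \<ge> 1" "\<nu> \<le> 2 * real (?n u t)"
      using num_steps_bounds(1,6,8)[OF _ ut] k by (simp_all add: p_def \<nu>_def v_def m_def)
    have u: "u \<ge> 2" using ut by (auto simp: sqfree_set_def)
    have "k\<^sup>2 \<ge> 1" using k by simp
    then have t: "t \<ge> 1" using ut by simp
    have v: "v > 0" "v \<le> 4 * real t" using t by (simp_all add: v_def)
    \<comment> \<open>The box has at least \<open>v (\<nu> / 2)^2 = 9 m^2 / (4 u v)\<close>
      elements, and \<open>v \<le> 4 t\<close> leaves the factor \<open>9/16\<close>, more than the
      claimed \<open>1/2\<close>.\<close>
    have "1 / (2 * (real u * real t)) \<le> 9 / (4 * (real u * v))"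
      using u t v by (simp add: field_simps)
    then have "m\<^sup>2 * (1 / (2 * (real u * real t))) \<le> m\<^sup>2 * (9 / (4 * (real u * v)))" by (intro mult_left_mono) auto
    moreover have "v * (\<nu> / 2)\<^sup>2 = m\<^sup>2 * (9 / (4 * (real u * v)))"
      using v u by (simp add: \<nu>_def p_def power_divide power_mult_distrib power2_eq_square field_simps)
    moreover have "v * (\<nu> / 2)\<^sup>2 \<le> v * (real (?n u t))\<^sup>2"
      using v bd by (intro mult_left_mono power_mono) auto
    moreover have "real (card (?B u t)) = v * (real (?n u t))\<^sup>2"
      by (simp add: card_cartesian_product v_def power2_eq_square algebra_simps)
    ultimately show ?thesis by simp
  qed
  have lnk: "ln (real k) \<ge> 0" using k by simp
  have T: "(\<Sum>t\<in>{k\<^sup>2..<k ^ 3}. 1 / real t) \<ge> ln (real k)"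
  proof -
    have "k\<^sup>2 \<le> k ^ 3" using k by (intro power_increasing) auto
    then have "ln (real (k ^ 3) / real (k\<^sup>2)) \<le> (\<Sum>t\<in>{k\<^sup>2..<k ^ 3}. 1 / real t)"
      using k by (intro sum_inverse_ge_ln) auto
    moreover have "real (k ^ 3) / real (k\<^sup>2) = real k" using k by (simp add: power2_eq_square power3_eq_cube)
    ultimately show ?thesis by simp
  qed
  have "m\<^sup>2 / 2 * ((ln (real k) / 8 - 1) * ln (real k)) \<le>
      m\<^sup>2 / 2 * ((\<Sum>u\<in>sqfree_set k. 1 / real u) * (\<Sum>t\<in>{k\<^sup>2..<k ^ 3}. 1 / real t))"
  proof (rule mult_left_mono)
    have "(ln (real k) / 8 - 1) * ln (real k) \<le> (\<Sum>u\<in>sqfree_set k. 1 / real u) * ln (real k)"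
      using sum_sqfree_set_ge[OF k] lnk by (intro mult_right_mono) auto
    also have "\<dots> \<le> (\<Sum>u\<in>sqfree_set k. 1 / real u) * (\<Sum>t\<in>{k\<^sup>2..<k ^ 3}. 1 / real t)"
      using T by (intro mult_left_mono sum_nonneg) auto
    finally show "(ln (real k) / 8 - 1) * ln (real k) \<le>
        (\<Sum>u\<in>sqfree_set k. 1 / real u) * (\<Sum>t\<in>{k\<^sup>2..<k ^ 3}. 1 / real t)" .
  qed simp
  also have "\<dots> = (\<Sum>u\<in>sqfree_set k. \<Sum>t\<in>{k\<^sup>2..<k ^ 3}. m\<^sup>2 / 2 * (1 / real u * (1 / real t)))"
    by (simp only: sum_distrib_left[symmetric] sum_distrib_right[symmetric])
  also have "\<dots> \<le> (\<Sum>u\<in>sqfree_set k. \<Sum>t\<in>{k\<^sup>2..<k ^ 3}. real (card (?B u t)))"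
    by (intro sum_mono each)
  also have "\<dots> = real (card (family_params k))"
    unfolding family_params_def using fin by (simp del: card_cartesian_product)
  finally show ?thesis by (simp add: m_def algebra_simps flip: power_mult)
qed

lemma N_D4_lower:
  assumes k: "k \<ge> 4" "ln (real k) \<ge> 16"
  shows "real k ^ 8 * (ln (real k))\<^sup>2 / 96 \<le> real (N_D4 (144 * k ^ 4))"
proof -
  have "real (card (family_params k)) \<le> real (3 * N_D4 (144 * k ^ 4))"
    using card_family_params_le[of k] k by (simp only: of_nat_le_iff)
  \<comment> \<open>From \<open>ln k \<ge> 16\<close>. The constant 96 is \<open>3 * 2 * 16\<close>:
    the size of the fibres, the factor in the count of the parameters, and this 16.\<close>
  moreover have "real k ^ 8 * ln (real k) * (ln (real k) / 16) \<le> real k ^ 8 * ln (real k) * (ln (real k) / 8 - 1)"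
    using k by (intro mult_left_mono) auto
  ultimately show ?thesis using card_family_params_ge[OF k(1)] by (simp add: power2_eq_square)
qed

lemma N_D4_upper:
  assumes "H \<ge> 3"
  shows "real (N_D4 H) \<le> 10000000 * (real H)\<^sup>2 * (ln (real H))\<^sup>2"
proof -
  have "D4_set H \<subseteq> resolvent_set H"
    using galois_D4_resolvent_root by (auto simp: D4_set_def resolvent_set_def)
  then have "N_D4 H \<le> card (resolvent_set H)"
    unfolding N_D4_eq by (rule card_mono[OF card_resolvent_set(1)[OF assms]])
  then show ?thesis using card_resolvent_set(2)[OF assms] by linarith
qed

theorem theorem1p5:
  shows "\<exists>C1 C2 :: real. C1 > 0 \<and> C2 > 0 \<and> (\<exists>H0::nat. \<forall>H\<ge>H0.
           C1 * real H ^ 2 * (ln (real H)) ^ 2 \<le> real (N_D4 H) \<and>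
           real (N_D4 H) \<le> C2 * real H ^ 2 * (ln (real H)) ^ 2)"
proof -
  \<comment> \<open>\<open>2304 = 144 * 2^4\<close> is the cost of passing from \<open>H\<close> to
    \<open>k\<close>, 25 that of \<open>ln H \<le> 5 ln k\<close>, and 96 comes from
    \<open>N_D4_lower\<close>.\<close>
  define C where "C = 1 / (96 * 25 * 2304\<^sup>2 :: real)"
  define K where "K = max 2304 (nat \<lceil>exp 16 :: real\<rceil>)"
  have "nat \<lceil>exp 16 :: real\<rceil> \<le> K" "K \<ge> 2304" by (simp_all add: K_def)
  then have K: "K \<ge> 2304" "real K \<ge> exp 16"
    using real_nat_ceiling_ge[of "exp 16"] by linarith+
  have "C * real H ^ 2 * (ln (real H)) ^ 2 \<le> real (N_D4 H)" if H: "H \<ge> 144 * K ^ 4" for H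
  proof -
    define A where "A = {k. 144 * k ^ 4 \<le> H}"
    have "k \<le> H" if "k \<in> A" for k
    proof -
      have "k \<le> k ^ 4" by (cases "k = 0") (auto simp: self_le_power)
      then show ?thesis using that by (simp add: A_def)
    qed
    then have fin: "finite A" by (meson finite_nat_set_iff_bounded_le)
    have KA: "K \<in> A" using H by (simp add: A_def)
    \<comment> \<open>The largest \<open>k\<close> for which \<open>144 k^4\<close> does not exceed
      \<open>H\<close>. Monotonicity of the count transfers the bound to \<open>H\<close>, and
      maximality keeps the loss to a constant factor.\<close>
    define k where "k = Max A"
    have kA: "k \<in> A" using Max_in[OF fin] KA by (auto simp: k_def)
    have kK: "k \<ge> K" using Max_ge[OF fin KA] by (simp add: k_def)
    have "Suc k \<notin> A" using Max_ge[OF fin, of "Suc k"] by (auto simp: k_def)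
    then have "H \<le> 144 * (Suc k) ^ 4" by (simp add: A_def)
    also have "\<dots> \<le> 144 * (2 * k) ^ 4" using kK K by (intro mult_left_mono power_mono) auto
    finally have Hk: "H \<le> 2304 * k ^ 4" by (simp add: power_mult_distrib)
    have k: "k \<ge> 2304" "real k \<ge> exp 16" using kK K by auto
    have ln16: "ln (real k) \<ge> 16" using k by (subst ln_ge_iff) auto
    have H1: "real H \<le> 2304 * real k ^ 4" using Hk by (metis of_nat_le_iff of_nat_mult of_nat_numeral of_nat_power)
    have "H > 0" using H K by (metis gr0I le_zero_eq mult_eq_0_iff power_eq_0_iff zero_neq_numeral)
    \<comment> \<open>\<open>k \<ge> 2304\<close> turns \<open>H \<le> 2304 k^4\<close> into
      \<open>H \<le> k^5\<close>, which makes the logarithms of \<open>H\<close> and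
      \<open>k\<close> comparable.\<close>
    have "2304 * real k ^ 4 \<le> real k * real k ^ 4" using k by (intro mult_right_mono) auto
    then have "real H \<le> real k ^ 5" using H1 by (simp add: eval_nat_numeral)
    then have "ln (real H) \<le> ln (real k ^ 5)" using \<open>H > 0\<close> k by simp
    then have l: "ln (real H) \<le> 5 * ln (real k)" using k by (simp add: ln_realpow)
    have "real H ^ 2 * (ln (real H)) ^ 2 \<le> (2304 * real k ^ 4) ^ 2 * (5 * ln (real k)) ^ 2"
      using H1 l \<open>H > 0\<close> by (intro mult_mono power_mono) auto
    also have "\<dots> = 25 * 2304\<^sup>2 * (real k ^ 8 * (ln (real k))\<^sup>2)"
      by (simp add: power_mult_distrib flip: power_mult)
    finally have "C * (real H ^ 2 * (ln (real H)) ^ 2) \<le> C * (25 * 2304\<^sup>2 * (real k ^ 8 * (ln (real k))\<^sup>2))"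
      by (intro mult_left_mono) (auto simp: C_def)
    also have "\<dots> = real k ^ 8 * (ln (real k))\<^sup>2 / 96" by (simp add: C_def)
    also have "\<dots> \<le> real (N_D4 (144 * k ^ 4))" using N_D4_lower[of k] k ln16 by simp
    also have "\<dots> \<le> real (N_D4 H)" using N_D4_mono[of "144 * k ^ 4" H] kA by (simp add: A_def)
    finally show ?thesis by (simp add: mult.assoc)
  qed
  moreover have "real (N_D4 H) \<le> 10000000 * real H ^ 2 * (ln (real H)) ^ 2" if "H \<ge> 144 * K ^ 4" for H
  proof (rule N_D4_upper)
    have "K ^ 4 \<ge> 1" using K by simp
    then show "H \<ge> 3" using that by linarith
  qed
  moreover have "C > 0" by (simp add: C_def)
  ultimately show ?thesis by (intro exI[of _ C] exI[of _ 10000000] conjI exI[of _ "144 * K ^ 4"]) auto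
qed

end
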